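(* Let $H$ be a complex separable Hilbert space of dimension at least $3$, and let $\Phi\colon\mathcal B_s(H)\to\mathcal B_s(H)$ be a surjective map (not assumed linear). Then $\Phi$ satisfies $$W(AB-BA)=W(\Phi(A)\Phi(B)-\Phi(B)\Phi(A))\quad\text{for all }A,B\in\mathcal B_s(H)$$ if and only if there exist a unitary operator $U$ on $H$, a scalar $\varepsilon\in\{1,-1\}$, a set $\mathcal S\subseteq\mathcal D$, and a function $f\colon\mathcal B_s(H)\to\mathbb R$ such that $$\Phi(A)=\begin{cases}\varepsilon\,UAU^*+f(A)I & \text{if }A\in\mathcal B_s(H)\setminus\mathcal S,\\ -\varepsilon\,UAU^*+f(A)I & \text{if }A\in\mathcal S.\end{cases}$$
   Context: For a complex Hilbert space $H$, $\mathcal B_s(H)$ denotes the set of all bounded self-adjoint operators on $H$, and $I$ is the identity operator. For a bounded linear operator $A$ on $H$, the numerical range is $W(A)=\{\langle Ax,x\rangle : x\in H,\ \|x\|=1\}$. The set $\mathcal D\subset\mathcal B_s(H)$ is the set of all real linear combinations of a projection and the identity: $\mathcal D=\{\alpha P+\delta I : P\in\mathcal B_s(H)\text{ is a projection (i.e. }P=P^*=P^2),\ \alpha,\delta\in\mathbb R\}$. The function $f$ is arbitrary (no linearity or continuity is assumed). *)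

theory Defs
  imports "HOL-Analysis.Analysis"
begin

text \<open>
  Complex Hilbert spaces. The complex inner product is linear in its first argument. The real
  structure (and hence norm and topology) is the one of \<^class>\<open>real_inner\<close>; it is tied to the complex
  structure by the axioms \<open>scaleR_scaleC\<close> and \<open>inner_Re_cinner\<close>. Together with
  conjugate symmetry, the latter gives that \<open>cinner x x\<close> is the complex number \<open>(norm x)\<^sup>2\<close>.
\<close>

class complex_hilbert_space = real_inner + complete_space +
  fixes scaleC :: "complex \<Rightarrow> 'a \<Rightarrow> 'a" (infixr \<open>*\<^sub>C\<close> 75)
    and cinner :: "'a \<Rightarrow> 'a \<Rightarrow> complex"
  assumes scaleC_add_right: "a *\<^sub>C (x + y) = a *\<^sub>C x + a *\<^sub>C y"
    and scaleC_add_left: "(a + b) *\<^sub>C x = a *\<^sub>C x + b *\<^sub>C x"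
    and scaleC_scaleC: "a *\<^sub>C (b *\<^sub>C x) = (a * b) *\<^sub>C x"
    and scaleC_one: "1 *\<^sub>C x = x"
    and scaleR_scaleC: "r *\<^sub>R x = complex_of_real r *\<^sub>C x"
    and cinner_commute: "cinner x y = cnj (cinner y x)"
    and cinner_add_left: "cinner (x + y) z = cinner x z + cinner y z"
    and cinner_scaleC_left: "cinner (a *\<^sub>C x) y = a * cinner x y"
    and inner_Re_cinner: "inner x y = Re (cinner x y)"

global_interpretation complex_vector: vector_space "scaleC :: complex \<Rightarrow> 'a \<Rightarrow> 'a::complex_hilbert_space"
  by standard (simp_all add: scaleC_add_right scaleC_add_left scaleC_scaleC scaleC_one)

lemma cinner_self: "cinner x x = complex_of_real ((norm x)\<^sup>2)"
  for x :: "'a::complex_hilbert_space"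
proof -
  have "Im (cinner x x) = 0"
    using arg_cong[OF cinner_commute[of x x], of Im] by simp
  moreover have "Re (cinner x x) = (norm x)\<^sup>2"
    by (simp add: inner_Re_cinner[symmetric] power2_norm_eq_inner)
  ultimately show ?thesis
    by (simp add: complex_eq_iff)
qed

lemma cinner_add_right: "cinner x (y + z) = cinner x y + cinner x z"
  for x :: "'a::complex_hilbert_space"
  by (metis cinner_add_left cinner_commute complex_cnj_add)

lemma cinner_scaleC_right: "cinner x (a *\<^sub>C y) = cnj a * cinner x y"
  for x :: "'a::complex_hilbert_space"
  by (metis cinner_commute cinner_scaleC_left complex_cnj_mult)

lemma Im_cinner: "Im (cinner x y) = inner x (\<i> *\<^sub>C y)"
  for x :: "'a::complex_hilbert_space"
  by (simp add: inner_Re_cinner cinner_scaleC_right)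

lemma cinner_eq_imp_eq:
  assumes "\<And>x. cinner x y = cinner x z"
  shows "y = (z::'a::complex_hilbert_space)"
  by (subst vector_eq_ldot[symmetric]) (simp add: inner_Re_cinner assms)


text \<open>
  The bounded operators on \<open>H\<close> are the elements of \<^typ>\<open>'a \<Rightarrow>\<^sub>L 'a\<close> (bounded and real-linear) that
  are moreover compatible with complex scalars.
\<close>

definition complex_linear_op :: "('a::complex_hilbert_space \<Rightarrow>\<^sub>L 'a) \<Rightarrow> bool" where
  "complex_linear_op A \<longleftrightarrow> (\<forall>c x. A (c *\<^sub>C x) = c *\<^sub>C A x)"

text \<open>The Hilbert space adjoint; for complex-linear \<open>A\<close> it exists, see \<open>cinner_adj\<close>.\<close>

definition adj :: "('a::complex_hilbert_space \<Rightarrow>\<^sub>L 'a) \<Rightarrow> ('a \<Rightarrow>\<^sub>L 'a)" where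
  "adj A = (THE B :: 'a \<Rightarrow>\<^sub>L 'a. \<forall>x y. cinner (A x) y = cinner x (B y))"

definition self_adjoint_ops :: "('a::complex_hilbert_space \<Rightarrow>\<^sub>L 'a) set" where
  "self_adjoint_ops = {A. complex_linear_op A \<and> adj A = A}"

definition projection :: "('a::complex_hilbert_space \<Rightarrow>\<^sub>L 'a) \<Rightarrow> bool" where
  "projection P \<longleftrightarrow> P \<in> self_adjoint_ops \<and> P o\<^sub>L P = P"

definition unitary :: "('a::complex_hilbert_space \<Rightarrow>\<^sub>L 'a) \<Rightarrow> bool" where
  "unitary U \<longleftrightarrow> complex_linear_op U \<and> adj U o\<^sub>L U = id_blinfun \<and> U o\<^sub>L adj U = id_blinfun"

definition numerical_range :: "('a::complex_hilbert_space \<Rightarrow>\<^sub>L 'a) \<Rightarrow> complex set" where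
  "numerical_range A = {cinner (A x) x | x. norm x = 1}"

definition commutator :: "('a::complex_hilbert_space \<Rightarrow>\<^sub>L 'a) \<Rightarrow> ('a \<Rightarrow>\<^sub>L 'a) \<Rightarrow> ('a \<Rightarrow>\<^sub>L 'a)" where
  "commutator A B = (A o\<^sub>L B) - (B o\<^sub>L A)"

definition projection_identity_combinations :: "('a::complex_hilbert_space \<Rightarrow>\<^sub>L 'a) set" where
  "projection_identity_combinations =
     {\<alpha> *\<^sub>R P + \<delta> *\<^sub>R id_blinfun | \<alpha> P \<delta>. projection P}"


lemma riesz_real:
  fixes \<phi> :: "'a::{real_inner, complete_space} \<Rightarrow> real"
  assumes "bounded_linear \<phi>"
  shows "\<exists>z. \<forall>y. \<phi> y = inner z y"
proof -
  interpret bounded_linear \<phi> by fact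
  define J where "J x = (norm x)\<^sup>2 - 2 * \<phi> x" for x
  obtain M where M: "\<And>x. norm (\<phi> x) \<le> norm x * M"
    using bounded by blast
  have Jge: "- M\<^sup>2 \<le> J x" for x
  proof -
    have "\<phi> x \<le> norm x * M" using M[of x] by simp
    moreover have "0 \<le> (norm x - M)\<^sup>2" by simp
    ultimately show ?thesis
      unfolding J_def power2_diff by (simp add: algebra_simps)
  qed
  define d where "d = Inf (range J)"
  have bdd: "bdd_below (range J)"
    using Jge by (auto intro!: bdd_belowI)
  have dle: "d \<le> J x" for x
    unfolding d_def by (rule cInf_lower) (use bdd in auto)
  have mid: "(norm (x - y))\<^sup>2 = 2 * J x + 2 * J y - 4 * J ((1/2) *\<^sub>R (x + y))" for x y
    unfolding J_def power2_norm_eq_inner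
    by (simp add: add scaleR inner_commute algebra_simps)
  have "\<exists>x. J x < d + 1 / real (Suc n)" for n
  proof -
    have "Inf (range J) < d + 1 / real (Suc n)" by (simp add: d_def)
    then show ?thesis using bdd by (subst (asm) cInf_less_iff) auto
  qed
  then obtain X where X: "\<And>n. J (X n) < d + 1 / real (Suc n)" by metis
  have close: "(norm (X m - X n))\<^sup>2 \<le> 4 / real (Suc k)" if "k \<le> m" "k \<le> n" for k m n
  proof -
    have "1 / real (Suc m) \<le> 1 / real (Suc k)" "1 / real (Suc n) \<le> 1 / real (Suc k)"
      using that by (simp_all add: frac_le)
    then show ?thesis
      using mid[of "X m" "X n"] X[of m] X[of n] dle[of "(1/2) *\<^sub>R (X m + X n)"] by simp
  qed
  have "Cauchy X"
  proof (rule metric_CauchyI)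
    fix e :: real assume e: "e > 0"
    then obtain k where k: "4 / e\<^sup>2 < real (Suc k)"
      by (metis reals_Archimedean2 less_trans of_nat_less_iff lessI)
    then have "4 / real (Suc k) < e\<^sup>2"
      using e by (simp add: field_simps)
    then have "dist (X m) (X n) < e" if "k \<le> m" "k \<le> n" for m n
      using close[OF that] e unfolding dist_norm
      by (meson le_less_trans less_imp_le power_less_imp_less_base)
    then show "\<exists>M. \<forall>m\<ge>M. \<forall>n\<ge>M. dist (X m) (X n) < e" by blast
  qed
  then obtain z where z: "X \<longlonglongrightarrow> z"
    using Cauchy_convergent convergentD by blast
  have "(\<lambda>n. J (X n)) \<longlonglongrightarrow> J z"
    unfolding J_def by (intro tendsto_intros tendsto z)
  moreover have "(\<lambda>n. d + 1 / real (Suc n)) \<longlonglongrightarrow> d + 0"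
    by (intro tendsto_intros LIMSEQ_Suc[OF lim_1_over_n])
  ultimately have Jz: "J z \<le> d"
    using LIMSEQ_le[of "\<lambda>n. J (X n)" "J z" "\<lambda>n. d + 1 / real (Suc n)" "d + 0"] X
    by (simp add: less_imp_le)
  have "\<phi> y = inner z y" for y
  proof -
    define c where "c = inner z y - \<phi> y"
    have q: "0 \<le> t * (t * inner y y + 2 * c)" for t
    proof -
      have "J z \<le> J (z + t *\<^sub>R y)" using Jz dle order_trans by blast
      then show ?thesis
        unfolding J_def power2_norm_eq_inner c_def
        by (simp add: add scaleR inner_commute algebra_simps)
    qed
    have "c = 0"
    proof (cases "y = 0")
      case True
      then show ?thesis by (simp add: c_def)
    next
      case False
      then have p: "inner y y > 0" by simp
      have "0 \<le> - (c\<^sup>2 / inner y y)"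
        using q[of "- c / inner y y"] p by (simp add: power2_eq_square)
      then have "c\<^sup>2 / inner y y \<le> 0" by simp
      with p show "c = 0"
        by (auto simp: divide_le_0_iff simp del: inner_gt_zero_iff)
    qed
    then show ?thesis by (simp add: c_def)
  qed
  then show ?thesis by blast
qed

lemma adj_unique:
  fixes A B :: "'a::complex_hilbert_space \<Rightarrow>\<^sub>L 'a"
  assumes "\<And>x y. cinner (A x) y = cinner x (B y)"
  shows "adj A = B"
  unfolding adj_def
proof (rule the_equality)
  fix C :: "'a \<Rightarrow>\<^sub>L 'a"
  assume "\<forall>x y. cinner (A x) y = cinner x (C y)"
  then show "C = B"
    using assms by (intro blinfun_eqI cinner_eq_imp_eq) metis
qed (simp add: assms)

lemma cinner_adj:
  assumes "complex_linear_op A"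
  shows "cinner (A x) y = cinner x (adj A y)"
proof -
  have "\<forall>y. \<exists>z. \<forall>x. inner y (A x) = inner z x"
  proof
    fix y
    show "\<exists>z. \<forall>x. inner y (A x) = inner z x"
      by (rule riesz_real)
        (rule bounded_linear_compose[OF bounded_linear_inner_right blinfun.bounded_linear_right])
  qed
  then obtain b where b: "\<And>x y. inner y (A x) = inner (b y) x" by metis
  have lin: "bounded_linear b"
  proof (rule bounded_linear_intro)
    show "b (x + y) = b x + b y" for x y
      by (subst vector_eq_rdot[symmetric]) (simp add: inner_add_left b[symmetric])
    show "b (r *\<^sub>R x) = r *\<^sub>R b x" for r x
      by (subst vector_eq_rdot[symmetric]) (simp add: inner_add_left b[symmetric])
    show "norm (b y) \<le> norm y * norm A" for y
    proof -
      have "norm (b y) * norm (b y) = inner y (A (b y))"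
        by (simp add: b norm_eq_sqrt_inner)
      also have "\<dots> \<le> norm y * norm (A (b y))"
        by (rule norm_cauchy_schwarz)
      also have "\<dots> \<le> norm y * (norm A * norm (b y))"
        by (intro mult_left_mono norm_blinfun) simp
      finally have "norm (b y) * norm (b y) \<le> (norm y * norm A) * norm (b y)" by simp
      then show ?thesis
        by (cases "b y = 0") (simp, metis mult_right_le_imp_le zero_less_norm_iff)
    qed
  qed
  define B where "B = Blinfun b"
  have B: "B y = b y" for y
    by (simp add: B_def bounded_linear_Blinfun_apply lin)
  have re: "Re (cinner (A x) y) = Re (cinner x (B y))" for x y
    using b[of y x] by (simp add: B inner_Re_cinner[symmetric] inner_commute)
  have "cinner (A x) y = cinner x (B y)" for x y
  proof (rule complex_eqI[OF re])
    have "Re (cinner (A (\<i> *\<^sub>C x)) y) = Re (cinner (\<i> *\<^sub>C x) (B y))"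
      by (rule re)
    then show "Im (cinner (A x) y) = Im (cinner x (B y))"
      using assms by (simp add: complex_linear_op_def cinner_scaleC_left)
  qed
  then show ?thesis
    using adj_unique[of A B] by simp
qed

lemma complex_linear_op_adj: "complex_linear_op A \<Longrightarrow> complex_linear_op (adj A)"
  unfolding complex_linear_op_def[of "adj A"]
  by (intro allI cinner_eq_imp_eq) (simp add: cinner_adj[symmetric] cinner_scaleC_right)

end

(*
  Commutators of self-adjoint operators are skew-adjoint, so W(AB - BA) is governed by the real set
  {Im <Bv, Av> : norm v = 1}. It is {0} iff A and B commute, and it is symmetric about 0 for all B iff
  A is a real combination of a projection and I: otherwise some x, Ax, A^2 x are independent and
  a suitable B of rank two makes i(AB - BA) a traceless form of rank three, whose extreme values
  differ in modulus. Hence the map preserves commutation and these combinations, and then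
  the affine combinations of rank-one projections, which are recognised by commutation alone.

  The radius of W(AP - PA) for the projection P onto a unit vector x is the standard deviation of A
  at x. This yields a transformation of rays which preserves p - p^2 for the transition
  probability p; orthonormal triples rule out the exchange of p with 1 - p, and Wigner's theorem
  provides a unitary or antiunitary U. After undoing U the map preserves all
  variances, and polarisation gives A -> s(A) A + d(A) I with signs s(A). Finally s(A) s(B) is
  constant whenever W(AB - BA) is not symmetric; three operators that are pairwise in this relation
  exclude antiunitary U, and connectedness of the relation makes s constant outside the
  combinations of projections and I.
*)
theory Submission
  imports Defs
begin

section \<open>Complex inner product spaces\<close>

text \<open>Dimension three is decisive: in dimension two every self-adjoint operator is a
  combination of a projection and \<open>I\<close>, so all commutator ranges are symmetric and the
  signs could vary freely. Those combinations are exactly the operators whose sign is invisible: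
  conjugation by \<open>2P - I\<close> negates the commutator, and this also gives the converse
  implication.

  Operators are controlled vector by vector, without a spectral theorem. The main obstacle is that a
  ray goes only to an affine function of a ray with unknown slope, so that variances are at first
  compared only up to slopes. An equal superposition of two orthogonal unit vectors has p - p^2 =
  1/4, the maximal value; comparing it in both directions forces the squared slope to be 1.

  An antiunitary map reverses all imaginary parts, so s(A) s(B) would be -1 for every asymmetric
  pair; for three pairwise asymmetric operators the product of these values is a square, a
  contradiction.\<close>

lemma cinner_zero_left [simp]: "cinner 0 (y::'a::complex_hilbert_space) = 0"
  using cinner_add_left[of 0 0 y] by simp

lemma cinner_zero_right [simp]: "cinner (x::'a::complex_hilbert_space) 0 = 0"
  using cinner_add_right[of x 0 0] by simp

lemma cinner_minus_left: "cinner (- x) (y::'a::complex_hilbert_space) = - cinner x y"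
  using cinner_add_left[of x "- x" y] by (simp add: eq_neg_iff_add_eq_0 add.commute)

lemma cinner_minus_right: "cinner (x::'a::complex_hilbert_space) (- y) = - cinner x y"
  using cinner_add_right[of x y "- y"] by (simp add: eq_neg_iff_add_eq_0 add.commute)

lemma cinner_diff_left: "cinner (x - y) (z::'a::complex_hilbert_space) = cinner x z - cinner y z"
  using cinner_add_left[of x "- y" z] by (simp add: cinner_minus_left)

lemma cinner_diff_right: "cinner (x::'a::complex_hilbert_space) (y - z) = cinner x y - cinner x z"
  using cinner_add_right[of x y "- z"] by (simp add: cinner_minus_right)

lemma cinner_scaleR_left: "cinner (r *\<^sub>R x) (y::'a::complex_hilbert_space) = complex_of_real r * cinner x y"
  by (simp add: scaleR_scaleC cinner_scaleC_left)

lemma cinner_scaleR_right: "cinner x (r *\<^sub>R (y::'a::complex_hilbert_space)) = complex_of_real r * cinner x y"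
  by (simp add: scaleR_scaleC cinner_scaleC_right)

lemmas cinner_simps = cinner_add_left cinner_add_right cinner_minus_left cinner_minus_right
  cinner_diff_left cinner_diff_right cinner_scaleR_left cinner_scaleR_right
  cinner_scaleC_left cinner_scaleC_right

lemma cinner_eq_0_commute: "cinner x y = 0 \<longleftrightarrow> cinner y (x::'a::complex_hilbert_space) = 0"
  by (metis cinner_commute complex_cnj_zero)

lemma norm_sq_cinner: "(norm x)\<^sup>2 = Re (cinner x (x::'a::complex_hilbert_space))"
  by (simp add: cinner_self)

lemma norm_scaleC: "norm (c *\<^sub>C (x::'a::complex_hilbert_space)) = cmod c * norm x"
proof -
  have "(norm (c *\<^sub>C x))\<^sup>2 = Re (c * cnj c * cinner x x)"
    by (simp only: norm_sq_cinner cinner_simps mult.assoc mult.left_commute[of "cnj c"])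
  also have "\<dots> = (cmod c * norm x)\<^sup>2"
    by (simp add: complex_norm_square[symmetric] cinner_self power_mult_distrib)
  finally show ?thesis by (simp add: power2_eq_iff_nonneg)
qed

lemma cmod_cinner_le: "cmod (cinner x y) \<le> norm x * norm (y::'a::complex_hilbert_space)"
proof (cases "cinner x y = 0")
  case False
  \<comment> \<open>A phase that turns the inner product into its modulus, so that the real
    Cauchy-Schwarz inequality applies.\<close>
  define c where "c = cnj (sgn (cinner x y))"
  have "inner (c *\<^sub>C x) y = Re (c * cinner x y)"
    by (simp add: inner_Re_cinner cinner_simps)
  also have "c * cinner x y = complex_of_real (cmod (cinner x y))"
    using False unfolding c_def sgn_eq
    by (simp add: mult.commute[of "cnj _"] complex_norm_square[symmetric] power2_eq_square)
  finally have "cmod (cinner x y) \<le> norm (c *\<^sub>C x) * norm y"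
    by (metis Re_complex_of_real norm_cauchy_schwarz)
  moreover have "cmod c = 1" using False by (simp add: c_def norm_sgn)
  ultimately show ?thesis by (simp add: norm_scaleC)
qed simp

lemma norm_eq_1_cinner: "norm (x::'a::complex_hilbert_space) = 1 \<longleftrightarrow> cinner x x = 1"
proof -
  have "cinner x x = 1 \<longleftrightarrow> (norm x)\<^sup>2 = 1"
    unfolding cinner_self by (rule of_real_eq_1_iff)
  also have "\<dots> \<longleftrightarrow> norm x = 1"
    unfolding power2_eq_1_iff using norm_ge_zero[of x] by linarith
  finally show ?thesis by simp
qed

lemma cinner_self_eq_0_iff [simp]: "cinner x x = 0 \<longleftrightarrow> x = (0::'a::complex_hilbert_space)"
  by (simp add: cinner_self)

lemma norm_add_orth:
  "cinner x y = 0 \<Longrightarrow> (norm (x + y))\<^sup>2 = (norm x)\<^sup>2 + (norm (y::'a::complex_hilbert_space))\<^sup>2"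
  using cinner_eq_0_commute[of x y] by (simp only: norm_sq_cinner) (simp add: cinner_simps)

lemma normalize_vec:
  assumes "x \<noteq> (0::'a::complex_hilbert_space)"
  obtains r where "r > 0" "norm (r *\<^sub>R x) = 1"
  using assms that[of "1 / norm x"] by simp

text \<open>By the convention \<open>x / 0 = 0\<close>, \<open>residual 0 s = s\<close>, so that the residual is always orthogonal to \<open>u\<close>.\<close>

definition residual :: "'a \<Rightarrow> 'a \<Rightarrow> 'a::complex_hilbert_space" where
  "residual u s = s - (cinner s u / cinner u u) *\<^sub>C u"

lemma residual_orth [simp]: "cinner (residual u s) u = 0" "cinner u (residual u s) = 0"
proof -
  show "cinner (residual u s) u = 0"
    by (cases "u = 0") (simp_all add: residual_def cinner_simps)
  then show "cinner u (residual u s) = 0" by (simp add: cinner_eq_0_commute)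
qed

lemma residual_decomp: "s = (cinner s u / cinner u u) *\<^sub>C u + residual u s"
  by (simp add: residual_def)

section \<open>Self-adjoint operators\<close>

text \<open>Symmetry with respect to the complex-valued product forces complex linearity, so
  membership can be verified by this one identity.\<close>

lemma self_adjoint_iff:
  "A \<in> self_adjoint_ops \<longleftrightarrow> (\<forall>x y. cinner (A x) y = cinner x (A y))"
proof
  assume "A \<in> self_adjoint_ops"
  then show "\<forall>x y. cinner (A x) y = cinner x (A y)"
    unfolding self_adjoint_ops_def using cinner_adj[of A] by auto
next
  assume *: "\<forall>x y. cinner (A x) y = cinner x (A y)"
  have "A (c *\<^sub>C x) = c *\<^sub>C A x" for c x
    by (rule cinner_eq_imp_eq) (simp add: *[rule_format, symmetric] cinner_simps)
  then show "A \<in> self_adjoint_ops"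
    unfolding self_adjoint_ops_def complex_linear_op_def using * adj_unique[of A A] by auto
qed

lemma self_adjoint_cinner: "A \<in> self_adjoint_ops \<Longrightarrow> cinner (A x) y = cinner x (A y)"
  by (simp add: self_adjoint_iff)

lemma self_adjoint_scaleC: "A \<in> self_adjoint_ops \<Longrightarrow> A (c *\<^sub>C x) = c *\<^sub>C A x"
  by (simp add: self_adjoint_ops_def complex_linear_op_def)

lemma self_adjoint_cinner_self:
  assumes "A \<in> self_adjoint_ops"
  shows "cinner (A x) x = complex_of_real (Re (cinner (A x) x))"
    and "Im (cinner (A x) x) = 0" "Im (cinner x (A x)) = 0"
proof -
  have "cinner (A x) x = cnj (cinner (A x) x)"
    using self_adjoint_cinner[OF assms, of x x] cinner_commute[of "A x" x] by simp
  then show *: "Im (cinner (A x) x) = 0"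
    by (metis Reals_cnj_iff complex_is_Real_iff)
  then show "cinner (A x) x = complex_of_real (Re (cinner (A x) x))" by (simp add: complex_eq_iff)
  show "Im (cinner x (A x)) = 0" using * self_adjoint_cinner[OF assms, of x x] by simp
qed

lemma id_self_adjoint [simp]: "id_blinfun \<in> self_adjoint_ops"
  by (simp add: self_adjoint_iff)

lemma add_self_adjoint [simp]:
  "A \<in> self_adjoint_ops \<Longrightarrow> B \<in> self_adjoint_ops \<Longrightarrow> A + B \<in> self_adjoint_ops"
  by (simp add: self_adjoint_iff cinner_simps blinfun.bilinear_simps)

lemma diff_self_adjoint [simp]:
  "A \<in> self_adjoint_ops \<Longrightarrow> B \<in> self_adjoint_ops \<Longrightarrow> A - B \<in> self_adjoint_ops"
  by (simp add: self_adjoint_iff cinner_simps blinfun.bilinear_simps)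

lemma scaleR_self_adjoint [simp]: "A \<in> self_adjoint_ops \<Longrightarrow> r *\<^sub>R A \<in> self_adjoint_ops"
  by (simp add: self_adjoint_iff cinner_simps blinfun.bilinear_simps)

section \<open>Self-adjoint operators of rank one and two\<close>

definition rank1 :: "'a \<Rightarrow> 'a \<Rightarrow> ('a::complex_hilbert_space \<Rightarrow>\<^sub>L 'a)" where
  "rank1 x y = Blinfun (\<lambda>v. cinner v y *\<^sub>C x)"

lemma rank1_apply [simp]: "rank1 x y v = cinner v y *\<^sub>C x"
proof -
  have "bounded_linear (\<lambda>v. cinner v y *\<^sub>C x)"
  proof (rule bounded_linear_intro)
    show "norm (cinner v y *\<^sub>C x) \<le> norm v * (norm y * norm x)" for v
      using mult_right_mono[OF cmod_cinner_le[of v y], of "norm x"]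
      by (simp add: norm_scaleC mult.assoc)
  qed (simp_all add: cinner_simps scaleC_add_left scaleR_scaleC scaleC_scaleC)
  then show ?thesis by (simp add: rank1_def bounded_linear_Blinfun_apply)
qed

definition ray :: "'a \<Rightarrow> ('a::complex_hilbert_space \<Rightarrow>\<^sub>L 'a)" where
  "ray x = rank1 x x"

lemma ray_apply [simp]: "ray x v = cinner v x *\<^sub>C x"
  by (simp add: ray_def)

lemma ray_self_adjoint [simp]: "ray x \<in> self_adjoint_ops"
proof -
  have "cinner (ray x u) v = cinner u (ray x v)" for u v
    by (simp add: cinner_simps cinner_commute[of x v])
  then show ?thesis by (simp add: self_adjoint_iff)
qed

text \<open>The factor \<i> makes the skew-adjoint \<open>rank1 x y - rank1 y x\<close>
  self-adjoint. For orthonormal \<open>x\<close>, \<open>y\<close> this is, up to sign, the second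
  Pauli matrix on their span.\<close>

definition skew2 :: "'a \<Rightarrow> 'a \<Rightarrow> ('a::complex_hilbert_space \<Rightarrow>\<^sub>L 'a)" where
  "skew2 x y = rank1 (\<i> *\<^sub>C x) y - rank1 (\<i> *\<^sub>C y) x"

lemma skew2_apply: "skew2 x y v = \<i> *\<^sub>C (cinner v y *\<^sub>C x - cinner v x *\<^sub>C y)"
  by (simp add: skew2_def blinfun.bilinear_simps scaleC_scaleC
      complex_vector.scale_right_diff_distrib mult.commute)

lemma skew2_self_adjoint [simp]: "skew2 x y \<in> self_adjoint_ops"
proof -
  have "cinner (skew2 x y u) v = cinner u (skew2 x y v)" for u v
    by (simp add: skew2_apply cinner_simps cinner_commute[of x v] cinner_commute[of y v])
      (simp add: algebra_simps)
  then show ?thesis by (simp add: self_adjoint_iff)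
qed

section \<open>The numerical range of a commutator\<close>

definition comm_range :: "('a::complex_hilbert_space \<Rightarrow>\<^sub>L 'a) \<Rightarrow> ('a \<Rightarrow>\<^sub>L 'a) \<Rightarrow> real set" where
  "comm_range A B = {Im (cinner (B v) (A v)) | v. norm v = 1}"

lemma cinner_commutator:
  assumes "A \<in> self_adjoint_ops" "B \<in> self_adjoint_ops"
  shows "cinner (commutator A B v) v = 2 * \<i> * complex_of_real (Im (cinner (B v) (A v)))"
proof -
  have "cinner (commutator A B v) v = cinner (B v) (A v) - cinner (A v) (B v)"
    using assms by (simp add: commutator_def blinfun.bilinear_simps cinner_simps self_adjoint_cinner)
  also have "cinner (A v) (B v) = cnj (cinner (B v) (A v))" by (rule cinner_commute)
  finally show ?thesis by (simp add: complex_eq_iff)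
qed

lemma numerical_range_commutator:
  assumes "A \<in> self_adjoint_ops" "B \<in> self_adjoint_ops"
  shows "numerical_range (commutator A B) = (\<lambda>r. 2 * \<i> * complex_of_real r) ` comm_range A B"
  unfolding numerical_range_def comm_range_def using cinner_commutator[OF assms] by auto

lemma numerical_range_commutator_eq_iff:
  assumes "A \<in> self_adjoint_ops" "B \<in> self_adjoint_ops"
    and "C \<in> self_adjoint_ops" "D \<in> self_adjoint_ops"
  shows "numerical_range (commutator A B) = numerical_range (commutator C D)
    \<longleftrightarrow> comm_range A B = comm_range C D"
proof -
  have "inj (\<lambda>r. 2 * \<i> * complex_of_real r)" by (auto simp: inj_on_def)
  then show ?thesis by (simp add: numerical_range_commutator assms inj_image_eq_iff)
qed

lemma comm_range_commute: "comm_range B A = uminus ` comm_range A B"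
proof -
  have "Im (cinner (A v) (B v)) = - Im (cinner (B v) (A v))" for v
    by (subst cinner_commute) simp
  then show ?thesis by (auto simp: comm_range_def)
qed

lemma comm_range_affine_left:
  assumes "B \<in> self_adjoint_ops"
  shows "comm_range (a *\<^sub>R A + d *\<^sub>R id_blinfun) B = (*) a ` comm_range A B"
proof -
  have "Im (cinner (B v) ((a *\<^sub>R A + d *\<^sub>R id_blinfun) v)) = a * Im (cinner (B v) (A v))" for v
    using self_adjoint_cinner_self(2)[OF assms, of v]
    by (simp add: blinfun.bilinear_simps cinner_simps)
  then show ?thesis by (auto simp: comm_range_def)
qed

lemma comm_range_affine_right:
  assumes "A \<in> self_adjoint_ops"
  shows "comm_range A (b *\<^sub>R B + d *\<^sub>R id_blinfun) = (*) b ` comm_range A B"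
  by (subst (1 2) comm_range_commute) (simp add: comm_range_affine_left assms image_image)

definition sym_range :: "('a::complex_hilbert_space \<Rightarrow>\<^sub>L 'a) \<Rightarrow> ('a \<Rightarrow>\<^sub>L 'a) \<Rightarrow> bool" where
  "sym_range A B \<longleftrightarrow> (\<forall>r\<in>comm_range A B. - r \<in> comm_range A B)"

lemma sym_range_iff: "sym_range A B \<longleftrightarrow> uminus ` comm_range A B = comm_range A B"
proof
  assume *: "sym_range A B"
  show "uminus ` comm_range A B = comm_range A B"
  proof
    show "uminus ` comm_range A B \<subseteq> comm_range A B" using * by (auto simp: sym_range_def)
    show "comm_range A B \<subseteq> uminus ` comm_range A B"
      using * by (metis sym_range_def image_eqI minus_minus subsetI)
  qed
qed (auto simp: sym_range_def)

lemma sym_range_commute: "sym_range A B \<longleftrightarrow> sym_range B A"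
  unfolding sym_range_iff by (subst (1 2) comm_range_commute) (auto simp: image_image)

text \<open>Commutation as it can be read off the numerical range. Inclusion rather than equality,
  because the set is empty in the zero space.\<close>

definition com :: "('a::complex_hilbert_space \<Rightarrow>\<^sub>L 'a) \<Rightarrow> ('a \<Rightarrow>\<^sub>L 'a) \<Rightarrow> bool" where
  "com A B \<longleftrightarrow> comm_range A B \<subseteq> {0}"

lemma com_iff_Im: "com A B \<longleftrightarrow> (\<forall>v. Im (cinner (B v) (A v)) = 0)"
proof
  assume *: "com A B"
  show "\<forall>v. Im (cinner (B v) (A v)) = 0"
  proof
    fix v
    show "Im (cinner (B v) (A v)) = 0"
    proof (cases "v = 0")
      case False
      then obtain r where r: "r > 0" "norm (r *\<^sub>R v) = 1" by (rule normalize_vec)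
      then have "Im (cinner (B (r *\<^sub>R v)) (A (r *\<^sub>R v))) = 0"
        using * unfolding com_def comm_range_def by blast
      then show ?thesis using r by (simp add: blinfun.bilinear_simps cinner_simps)
    qed (simp add: blinfun.bilinear_simps)
  qed
qed (auto simp: com_def comm_range_def)

lemma com_commute: "com A B \<longleftrightarrow> com B A"
  unfolding com_iff_Im by (metis cinner_commute cnj.simps(2) neg_equal_0_iff_equal)

text \<open>Complex polarisation: the quadratic form of the commutator \<open>T\<close> vanishes,
  and its values at \<open>u + v\<close> and \<open>u + \<i> *\<^sub>C v\<close> determine both the
  sum and the difference of the mixed terms.\<close>

lemma com_imp_commute:
  assumes "A \<in> self_adjoint_ops" "B \<in> self_adjoint_ops" "com A B"
  shows "A (B v) = B (A v)"
proof -
  define T where "T = commutator A B"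
  have T0: "cinner (T v) v = 0" for v
    using assms cinner_commutator[OF assms(1,2), of v] by (simp add: T_def com_iff_Im)
  have lin: "T (c *\<^sub>C x) = c *\<^sub>C T x" for c x
    using assms by (simp add: T_def commutator_def blinfun.bilinear_simps self_adjoint_scaleC
        complex_vector.scale_right_diff_distrib)
  have "cinner (T u) v = 0" for u v
  proof -
    have "cinner (T u) v + cinner (T v) u = 0"
      using T0[of "u + v"] T0[of u] T0[of v] by (simp add: blinfun.bilinear_simps cinner_simps add.commute)
    moreover have "cinner (T u) v - cinner (T v) u = 0"
      using T0[of "u + \<i> *\<^sub>C v"] T0[of u] T0[of v]
      by (simp add: blinfun.bilinear_simps cinner_simps lin)
    ultimately show ?thesis by (simp add: complex_eq_iff)
  qed
  then have "T v = 0" by (metis cinner_self_eq_0_iff)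
  then show ?thesis by (simp add: T_def commutator_def blinfun.bilinear_simps)
qed

lemma commute_imp_com:
  assumes "A \<in> self_adjoint_ops" "B \<in> self_adjoint_ops" "\<And>v. A (B v) = B (A v)"
  shows "com A B"
proof -
  have "commutator A B = 0"
    by (rule blinfun_eqI) (simp add: commutator_def blinfun.bilinear_simps assms(3))
  then show ?thesis
    using cinner_commutator[OF assms(1,2)] by (simp add: com_iff_Im)
qed

section \<open>Commutators with asymmetric numerical range\<close>

text \<open>First-order condition at a minimum. With k \<ge> c, the choice t = -b/k lets the linear
  term win and gives the value at most -b^2/k.\<close>

lemma linear_coeff_zero:
  assumes "\<And>t::real. 0 \<le> 2 * t * b + t\<^sup>2 * c"
  shows "b = 0"
proof (rule ccontr)
  assume b: "b \<noteq> 0"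
  define k where "k = \<bar>c\<bar> + 1"
  have k: "k > 0" "c \<le> k" by (auto simp: k_def)
  have "0 \<le> 2 * (- b / k) * b + (- b / k)\<^sup>2 * c" by (rule assms)
  also have "\<dots> \<le> 2 * (- b / k) * b + (- b / k)\<^sup>2 * k"
    using k by (intro add_left_mono mult_left_mono) auto
  also have "\<dots> = - (b\<^sup>2 / k)" using k by (simp add: power2_eq_square field_simps)
  also have "\<dots> < 0" using b k by simp
  finally show False by simp
qed

text \<open>The quadratic form of a real symmetric matrix with diagonal \<open>d\<close> and
  off-diagonal entries \<open>m\<close>; \<open>det3\<close> is the determinant of that matrix. Real
  matrices suffice, as the phases of the orthonormal vectors used below are chosen accordingly; the
  form then splits over the real and imaginary parts of the coordinates.\<close>

definition form3 :: "real \<Rightarrow> real \<Rightarrow> real \<Rightarrow> real \<Rightarrow> real \<Rightarrow> real \<Rightarrow> real \<Rightarrow> real \<Rightarrow> real \<Rightarrow> real" where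
  "form3 d\<^sub>1 d\<^sub>2 d\<^sub>3 m\<^sub>1\<^sub>2 m\<^sub>1\<^sub>3 m\<^sub>2\<^sub>3 a b c =
     d\<^sub>1 * a\<^sup>2 + d\<^sub>2 * b\<^sup>2 + d\<^sub>3 * c\<^sup>2 + 2 * m\<^sub>1\<^sub>2 * a * b + 2 * m\<^sub>1\<^sub>3 * a * c + 2 * m\<^sub>2\<^sub>3 * b * c"

definition det3 :: "real \<Rightarrow> real \<Rightarrow> real \<Rightarrow> real \<Rightarrow> real \<Rightarrow> real \<Rightarrow> real" where
  "det3 d\<^sub>1 d\<^sub>2 d\<^sub>3 m\<^sub>1\<^sub>2 m\<^sub>1\<^sub>3 m\<^sub>2\<^sub>3 =
     d\<^sub>1 * d\<^sub>2 * d\<^sub>3 + 2 * m\<^sub>1\<^sub>2 * m\<^sub>1\<^sub>3 * m\<^sub>2\<^sub>3 - d\<^sub>1 * m\<^sub>2\<^sub>3\<^sup>2 - d\<^sub>2 * m\<^sub>1\<^sub>3\<^sup>2 - d\<^sub>3 * m\<^sub>1\<^sub>2\<^sup>2"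

text \<open>A maximiser on the sphere is an eigenvector for the maximum. The three stationarity
  equations come from perturbing one coordinate at a time.\<close>

lemma det3_maximum:
  assumes le: "\<And>a b c. form3 d\<^sub>1 d\<^sub>2 d\<^sub>3 m\<^sub>1\<^sub>2 m\<^sub>1\<^sub>3 m\<^sub>2\<^sub>3 a b c \<le> l * (a\<^sup>2 + b\<^sup>2 + c\<^sup>2)"
    and eq: "form3 d\<^sub>1 d\<^sub>2 d\<^sub>3 m\<^sub>1\<^sub>2 m\<^sub>1\<^sub>3 m\<^sub>2\<^sub>3 a b c = l * (a\<^sup>2 + b\<^sup>2 + c\<^sup>2)"
    and nz: "a\<^sup>2 + b\<^sup>2 + c\<^sup>2 = 1"
  shows "det3 (d\<^sub>1 - l) (d\<^sub>2 - l) (d\<^sub>3 - l) m\<^sub>1\<^sub>2 m\<^sub>1\<^sub>3 m\<^sub>2\<^sub>3 = 0"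
proof -
  let ?D = "det3 (d\<^sub>1 - l) (d\<^sub>2 - l) (d\<^sub>3 - l) m\<^sub>1\<^sub>2 m\<^sub>1\<^sub>3 m\<^sub>2\<^sub>3"
  have "l * a - (d\<^sub>1 * a + m\<^sub>1\<^sub>2 * b + m\<^sub>1\<^sub>3 * c) = 0"
  proof (rule linear_coeff_zero[of _ "l - d\<^sub>1"])
    show "0 \<le> 2 * t * (l * a - (d\<^sub>1 * a + m\<^sub>1\<^sub>2 * b + m\<^sub>1\<^sub>3 * c)) + t\<^sup>2 * (l - d\<^sub>1)" for t
      using le[of "a + t" b c] eq by (simp add: form3_def power2_eq_square algebra_simps)
  qed
  moreover have "l * b - (m\<^sub>1\<^sub>2 * a + d\<^sub>2 * b + m\<^sub>2\<^sub>3 * c) = 0"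
  proof (rule linear_coeff_zero[of _ "l - d\<^sub>2"])
    show "0 \<le> 2 * t * (l * b - (m\<^sub>1\<^sub>2 * a + d\<^sub>2 * b + m\<^sub>2\<^sub>3 * c)) + t\<^sup>2 * (l - d\<^sub>2)" for t
      using le[of a "b + t" c] eq by (simp add: form3_def power2_eq_square algebra_simps)
  qed
  moreover have "l * c - (m\<^sub>1\<^sub>3 * a + m\<^sub>2\<^sub>3 * b + d\<^sub>3 * c) = 0"
  proof (rule linear_coeff_zero[of _ "l - d\<^sub>3"])
    show "0 \<le> 2 * t * (l * c - (m\<^sub>1\<^sub>3 * a + m\<^sub>2\<^sub>3 * b + d\<^sub>3 * c)) + t\<^sup>2 * (l - d\<^sub>3)" for t
      using le[of a b "c + t"] eq by (simp add: form3_def power2_eq_square algebra_simps)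
  qed
  \<comment> \<open>Cramer's rule: multiplying the equations by the adjugate matrix leaves the
    determinant times each coordinate.\<close>
  ultimately have "?D * a = 0 \<and> ?D * b = 0 \<and> ?D * c = 0"
    unfolding det3_def by (intro conjI; algebra)
  moreover have "a \<noteq> 0 \<or> b \<noteq> 0 \<or> c \<noteq> 0" using nz by auto
  ultimately show ?thesis by auto
qed

lemma form3_uminus: "form3 (-d\<^sub>1) (-d\<^sub>2) (-d\<^sub>3) (-m\<^sub>1\<^sub>2) (-m\<^sub>1\<^sub>3) (-m\<^sub>2\<^sub>3) a b c = - form3 d\<^sub>1 d\<^sub>2 d\<^sub>3 m\<^sub>1\<^sub>2 m\<^sub>1\<^sub>3 m\<^sub>2\<^sub>3 a b c"
  by (simp add: form3_def)

lemma form3_maximum_exists: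
  obtains a b c l where "a\<^sup>2 + b\<^sup>2 + c\<^sup>2 = 1" "form3 d\<^sub>1 d\<^sub>2 d\<^sub>3 m\<^sub>1\<^sub>2 m\<^sub>1\<^sub>3 m\<^sub>2\<^sub>3 a b c = l"
    "\<And>a b c. form3 d\<^sub>1 d\<^sub>2 d\<^sub>3 m\<^sub>1\<^sub>2 m\<^sub>1\<^sub>3 m\<^sub>2\<^sub>3 a b c \<le> l * (a\<^sup>2 + b\<^sup>2 + c\<^sup>2)"
proof -
  let ?q = "form3 d\<^sub>1 d\<^sub>2 d\<^sub>3 m\<^sub>1\<^sub>2 m\<^sub>1\<^sub>3 m\<^sub>2\<^sub>3"
  let ?S = "sphere (0 :: real \<times> real \<times> real) 1"
  have S: "(a, b, c) \<in> ?S \<longleftrightarrow> a\<^sup>2 + b\<^sup>2 + c\<^sup>2 = 1" for a b c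
    by (simp add: dist_norm norm_prod_def add.assoc)
  have ne: "?S \<noteq> {}" using S[of 1 0 0] by auto
  have "continuous_on ?S (\<lambda>p. ?q (fst p) (fst (snd p)) (snd (snd p)))"
    unfolding form3_def by (intro continuous_intros)
  from continuous_attains_sup[OF compact_sphere ne this]
  obtain p where p: "p \<in> ?S"
    "\<And>p'. p' \<in> ?S \<Longrightarrow> ?q (fst p') (fst (snd p')) (snd (snd p')) \<le> ?q (fst p) (fst (snd p)) (snd (snd p))"
    by blast
  obtain a b c where [simp]: "p = (a, b, c)" by (cases p)
  show thesis
  proof (rule that[of a b c])
    show "a\<^sup>2 + b\<^sup>2 + c\<^sup>2 = 1" using p(1) S by simp
    show "?q x y z \<le> ?q a b c * (x\<^sup>2 + y\<^sup>2 + z\<^sup>2)" for x y z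
    proof (cases "x\<^sup>2 + y\<^sup>2 + z\<^sup>2 = 0")
      case True
      then have "x = 0" "y = 0" "z = 0" by (auto simp: add_nonneg_eq_0_iff)
      then show ?thesis by (simp add: form3_def)
    next
      case False
      define n where "n = sqrt (x\<^sup>2 + y\<^sup>2 + z\<^sup>2)"
      have n: "n\<^sup>2 = x\<^sup>2 + y\<^sup>2 + z\<^sup>2" "n \<noteq> 0" using False by (auto simp: n_def)
      have "(x/n)\<^sup>2 + (y/n)\<^sup>2 + (z/n)\<^sup>2 = 1"
        using n False by (simp add: power_divide add_divide_distrib[symmetric])
      then have "?q (x/n) (y/n) (z/n) \<le> ?q a b c" using p(2)[of "(x/n, y/n, z/n)"] S by simp
      moreover have "?q (x/n) (y/n) (z/n) = ?q x y z / n\<^sup>2"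
        using n(2) by (simp add: form3_def power2_eq_square field_simps)
      moreover have "n\<^sup>2 > 0" using n(2) by simp
      ultimately show ?thesis by (simp add: n(1)[symmetric] pos_divide_le_eq)
    qed
  qed simp
qed

lemma bessel3:
  fixes v :: "'a::complex_hilbert_space"
  assumes "norm e\<^sub>1 = 1" "norm e\<^sub>2 = 1" "norm e\<^sub>3 = 1"
    and "cinner e\<^sub>1 e\<^sub>2 = 0" "cinner e\<^sub>1 e\<^sub>3 = 0" "cinner e\<^sub>2 e\<^sub>3 = 0"
  shows "(cmod (cinner v e\<^sub>1))\<^sup>2 + (cmod (cinner v e\<^sub>2))\<^sup>2 + (cmod (cinner v e\<^sub>3))\<^sup>2 \<le> (norm v)\<^sup>2"
proof -
  have o: "cinner e\<^sub>1 e\<^sub>1 = 1" "cinner e\<^sub>2 e\<^sub>2 = 1" "cinner e\<^sub>3 e\<^sub>3 = 1"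
    "cinner e\<^sub>2 e\<^sub>1 = 0" "cinner e\<^sub>3 e\<^sub>1 = 0" "cinner e\<^sub>3 e\<^sub>2 = 0"
    using assms by (simp_all add: norm_eq_1_cinner cinner_eq_0_commute)
  define w where "w = v - cinner v e\<^sub>1 *\<^sub>C e\<^sub>1 - cinner v e\<^sub>2 *\<^sub>C e\<^sub>2 - cinner v e\<^sub>3 *\<^sub>C e\<^sub>3"
  have "cinner w w = cinner v v - cinner v e\<^sub>1 * cnj (cinner v e\<^sub>1)
      - cinner v e\<^sub>2 * cnj (cinner v e\<^sub>2) - cinner v e\<^sub>3 * cnj (cinner v e\<^sub>3)"
    using assms(4-6) by (simp add: w_def cinner_simps o cinner_commute[of e\<^sub>1 v]
        cinner_commute[of e\<^sub>2 v] cinner_commute[of e\<^sub>3 v])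
  then have "complex_of_real ((norm w)\<^sup>2) = complex_of_real ((norm v)\<^sup>2 - (cmod (cinner v e\<^sub>1))\<^sup>2
      - (cmod (cinner v e\<^sub>2))\<^sup>2 - (cmod (cinner v e\<^sub>3))\<^sup>2)"
    unfolding cinner_self of_real_diff complex_norm_square by simp
  then have "(norm w)\<^sup>2 = (norm v)\<^sup>2 - (cmod (cinner v e\<^sub>1))\<^sup>2
      - (cmod (cinner v e\<^sub>2))\<^sup>2 - (cmod (cinner v e\<^sub>3))\<^sup>2"
    by (simp only: of_real_eq_iff)
  then show ?thesis using zero_le_power2[of "norm w"] by linarith
qed

text \<open>
  If the set of values were symmetric, both a maximum and its negative would be eigenvalues; as the
  trace vanishes, so would the third one.
\<close>

lemma form3_not_symmetric:
  fixes e\<^sub>1 e\<^sub>2 e\<^sub>3 :: "'a::complex_hilbert_space"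
  assumes unit: "norm e\<^sub>1 = 1" "norm e\<^sub>2 = 1" "norm e\<^sub>3 = 1"
    and orth: "cinner e\<^sub>1 e\<^sub>2 = 0" "cinner e\<^sub>1 e\<^sub>3 = 0" "cinner e\<^sub>2 e\<^sub>3 = 0"
    and trace: "d\<^sub>1 + d\<^sub>2 + d\<^sub>3 = 0"
    and det: "det3 d\<^sub>1 d\<^sub>2 d\<^sub>3 m\<^sub>1\<^sub>2 m\<^sub>1\<^sub>3 m\<^sub>2\<^sub>3 \<noteq> 0"
    and q: "\<And>v. q v = form3 d\<^sub>1 d\<^sub>2 d\<^sub>3 m\<^sub>1\<^sub>2 m\<^sub>1\<^sub>3 m\<^sub>2\<^sub>3 (Re (cinner v e\<^sub>1)) (Re (cinner v e\<^sub>2)) (Re (cinner v e\<^sub>3))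
      + form3 d\<^sub>1 d\<^sub>2 d\<^sub>3 m\<^sub>1\<^sub>2 m\<^sub>1\<^sub>3 m\<^sub>2\<^sub>3 (Im (cinner v e\<^sub>1)) (Im (cinner v e\<^sub>2)) (Im (cinner v e\<^sub>3))"
  shows "\<not> (\<forall>r\<in>{q v | v. norm v = 1}. - r \<in> {q v | v. norm v = 1})"
proof
  let ?W = "{q v | v. norm v = 1}"
  let ?f = "form3 d\<^sub>1 d\<^sub>2 d\<^sub>3 m\<^sub>1\<^sub>2 m\<^sub>1\<^sub>3 m\<^sub>2\<^sub>3"
  assume sym: "\<forall>r\<in>?W. - r \<in> ?W"
  have o: "cinner e\<^sub>1 e\<^sub>1 = 1" "cinner e\<^sub>2 e\<^sub>2 = 1" "cinner e\<^sub>3 e\<^sub>3 = 1"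
    "cinner e\<^sub>2 e\<^sub>1 = 0" "cinner e\<^sub>3 e\<^sub>1 = 0" "cinner e\<^sub>3 e\<^sub>2 = 0"
    using unit orth by (simp_all add: norm_eq_1_cinner cinner_eq_0_commute)
  obtain a b c l where l: "a\<^sup>2 + b\<^sup>2 + c\<^sup>2 = 1" "?f a b c = l"
    "\<And>a b c. ?f a b c \<le> l * (a\<^sup>2 + b\<^sup>2 + c\<^sup>2)"
    by (rule form3_maximum_exists[of d\<^sub>1 d\<^sub>2 d\<^sub>3 m\<^sub>1\<^sub>2 m\<^sub>1\<^sub>3 m\<^sub>2\<^sub>3]) blast
  obtain a' b' c' k where k: "a'\<^sup>2 + b'\<^sup>2 + c'\<^sup>2 = 1" "- ?f a' b' c' = k"
    "\<And>a b c. - ?f a b c \<le> k * (a\<^sup>2 + b\<^sup>2 + c\<^sup>2)"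
    by (rule form3_maximum_exists[of "-d\<^sub>1" "-d\<^sub>2" "-d\<^sub>3" "-m\<^sub>1\<^sub>2" "-m\<^sub>1\<^sub>3" "-m\<^sub>2\<^sub>3", unfolded form3_uminus]) blast
  have real_in: "?f x y z \<in> ?W" if "x\<^sup>2 + y\<^sup>2 + z\<^sup>2 = 1" for x y z
  proof -
    let ?v = "complex_of_real x *\<^sub>C e\<^sub>1 + complex_of_real y *\<^sub>C e\<^sub>2 + complex_of_real z *\<^sub>C e\<^sub>3"
    have c: "cinner ?v e\<^sub>1 = x" "cinner ?v e\<^sub>2 = y" "cinner ?v e\<^sub>3 = z"
      by (simp_all add: cinner_simps o orth)
    have "cinner ?v ?v = complex_of_real (x\<^sup>2 + y\<^sup>2 + z\<^sup>2)"
      by (simp add: cinner_simps o orth power2_eq_square)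
    then have "norm ?v = 1" using that by (simp add: norm_eq_1_cinner)
    moreover have "q ?v = ?f x y z" unfolding q c by (simp add: form3_def)
    ultimately show ?thesis by (metis (mono_tags, lifting) mem_Collect_eq)
  qed
  \<comment> \<open>With trace zero the diagonal entries are not all negative, nor all positive.
    Nonnegativity matters because a unit vector need not lie in the span of the three vectors, so
    Bessel gives only an inequality.\<close>
  have nonneg: "0 \<le> l" "0 \<le> k"
    using l(3)[of 1 0 0] l(3)[of 0 1 0] l(3)[of 0 0 1] k(3)[of 1 0 0] k(3)[of 0 1 0] k(3)[of 0 0 1] trace
    by (simp_all add: form3_def)
  have bess: "((Re (cinner v e\<^sub>1))\<^sup>2 + (Re (cinner v e\<^sub>2))\<^sup>2 + (Re (cinner v e\<^sub>3))\<^sup>2)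
      + ((Im (cinner v e\<^sub>1))\<^sup>2 + (Im (cinner v e\<^sub>2))\<^sup>2 + (Im (cinner v e\<^sub>3))\<^sup>2) \<le> 1"
    if "norm v = 1" for v
    using bessel3[OF unit orth, of v] that by (simp add: cmod_power2)
  have upper: "r \<le> l" if r: "r \<in> ?W" for r
  proof -
    obtain v where v: "r = q v" "norm v = 1" using r by blast
    have "r \<le> l * (((Re (cinner v e\<^sub>1))\<^sup>2 + (Re (cinner v e\<^sub>2))\<^sup>2 + (Re (cinner v e\<^sub>3))\<^sup>2)
      + ((Im (cinner v e\<^sub>1))\<^sup>2 + (Im (cinner v e\<^sub>2))\<^sup>2 + (Im (cinner v e\<^sub>3))\<^sup>2))"
      unfolding v q distrib_left[of l "_ + _ + _"] by (intro add_mono l(3))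
    also have "\<dots> \<le> l * 1" by (intro mult_left_mono bess v nonneg)
    finally show ?thesis by simp
  qed
  have lower: "- r \<le> k" if r: "r \<in> ?W" for r
  proof -
    obtain v where v: "r = q v" "norm v = 1" using r by blast
    have "- r \<le> k * (((Re (cinner v e\<^sub>1))\<^sup>2 + (Re (cinner v e\<^sub>2))\<^sup>2 + (Re (cinner v e\<^sub>3))\<^sup>2)
      + ((Im (cinner v e\<^sub>1))\<^sup>2 + (Im (cinner v e\<^sub>2))\<^sup>2 + (Im (cinner v e\<^sub>3))\<^sup>2))"
      unfolding v q distrib_left[of k "_ + _ + _"] minus_add_distrib by (intro add_mono k(3))
    also have "\<dots> \<le> k * 1" by (intro mult_left_mono bess v nonneg)
    finally show ?thesis by simp
  qed
  have "l \<in> ?W" "- k \<in> ?W" using real_in[OF l(1)] real_in[OF k(1)] l(2) k(2) by auto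
  then have "- l \<in> ?W" "k \<in> ?W" using sym by force+
  then have kl: "k = l" using upper[of k] lower[of "-l"] by simp
  have "det3 (d\<^sub>1 - l) (d\<^sub>2 - l) (d\<^sub>3 - l) m\<^sub>1\<^sub>2 m\<^sub>1\<^sub>3 m\<^sub>2\<^sub>3 = 0"
    by (rule det3_maximum[OF l(3)]) (use l in auto)
  moreover have "det3 (- d\<^sub>1 - k) (- d\<^sub>2 - k) (- d\<^sub>3 - k) (- m\<^sub>1\<^sub>2) (- m\<^sub>1\<^sub>3) (- m\<^sub>2\<^sub>3) = 0"
    by (rule det3_maximum[of "-d\<^sub>1" "-d\<^sub>2" "-d\<^sub>3" "-m\<^sub>1\<^sub>2" "-m\<^sub>1\<^sub>3" "-m\<^sub>2\<^sub>3", unfolded form3_uminus, OF k(3)])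
      (use k in auto)
  \<comment> \<open>For the matrix M, det(M - l) - det(-M - l) = 2 det M + 2 l^2 tr M: the terms odd
    in l cancel.\<close>
  ultimately have "2 * det3 d\<^sub>1 d\<^sub>2 d\<^sub>3 m\<^sub>1\<^sub>2 m\<^sub>1\<^sub>3 m\<^sub>2\<^sub>3 = 0"
    using trace unfolding kl det3_def by algebra
  with det show False by simp
qed

text \<open>The last assumption says that \<open>x\<close>, \<open>A x\<close>,
  \<open>A (A x)\<close> are independent. Gram-Schmidt turns them into \<open>x\<close>,
  \<open>f\<close>, \<open>h\<close>, with \<open>A x = b *\<^sub>R f\<close> and \<open>A y =
  (b\<^sup>2) *\<^sub>R x + \<alpha> *\<^sub>R f + c *\<^sub>R h\<close>. The resulting traceless
  form has determinant -b^2 c^2 / 4.\<close>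

lemma skew2_asymmetric:
  assumes A: "A \<in> self_adjoint_ops" and x: "norm x = 1" "cinner (A x) x = 0"
    and y: "A x \<noteq> 0" and k: "residual (A x) (residual x (A (A x))) \<noteq> 0"
  shows "\<not> sym_range A (skew2 x (A x))"
proof -
  define y where "y = A x"
  define b where "b = norm y"
  define f where "f = (1 / b) *\<^sub>R y"
  define w where "w = residual y (residual x (A y))"
  define c where "c = norm w"
  define h where "h = (1 / c) *\<^sub>R w"
  have b: "b > 0" and c: "c > 0" using assms by (auto simp: b_def c_def y_def w_def)
  have yf: "y = b *\<^sub>R f" and wh: "w = c *\<^sub>R h" using b c by (auto simp: f_def h_def)
  have xx: "cinner x x = 1" using x by (simp add: norm_eq_1_cinner)
  have yx: "cinner y x = 0" "cinner x y = 0" using x by (simp_all add: y_def cinner_eq_0_commute[of x])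
  have yy: "cinner y y = b\<^sup>2" by (simp add: b_def cinner_self)
  have rx: "cinner (residual x (A y)) x = 0" by simp
  have wx: "cinner w x = 0" unfolding w_def residual_def[of y] by (simp add: cinner_simps yx)
  have wy: "cinner w y = 0" by (simp add: w_def)
  have units: "norm x = 1" "norm f = 1" "norm h = 1"
    using x b c by (simp_all add: f_def h_def b_def c_def)
  have orth: "cinner x f = 0" "cinner x h = 0" "cinner f h = 0"
    using wx wy by (simp_all add: f_def h_def cinner_simps yx cinner_eq_0_commute[of _ w])
  have Ayx: "cinner (A y) x = b\<^sup>2"
    using yy by (simp add: self_adjoint_cinner[OF A] flip: y_def)
  define \<alpha> where "\<alpha> = Re (cinner (A y) y) / b"
  have Ayy: "cinner (A y) y = complex_of_real (\<alpha> * b)"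
    using self_adjoint_cinner_self(1)[OF A, of y] b by (simp add: \<alpha>_def)
  have "A y = (b\<^sup>2) *\<^sub>R x + residual x (A y)"
    using residual_decomp[of "A y" x] by (simp add: Ayx xx scaleR_scaleC)
  also have "residual x (A y) = (cinner (residual x (A y)) y / cinner y y) *\<^sub>C y + w"
    unfolding w_def by (rule residual_decomp)
  also have "cinner (residual x (A y)) y = complex_of_real (\<alpha> * b)"
    by (simp add: residual_def cinner_simps yx Ayy)
  also have "complex_of_real (\<alpha> * b) / cinner y y = complex_of_real (\<alpha> / b)"
    using b by (simp add: yy power2_eq_square)
  finally have Ay: "A y = (b\<^sup>2) *\<^sub>R x + \<alpha> *\<^sub>R f + c *\<^sub>R h"
    using b by (simp add: wh scaleR_scaleC yf scaleC_scaleC add.assoc)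
  have "\<not> (\<forall>r\<in>{Im (cinner (skew2 x y v) (A v)) | v. norm v = 1}.
      - r \<in> {Im (cinner (skew2 x y v) (A v)) | v. norm v = 1})"
  proof (rule form3_not_symmetric[OF units orth, of "- b\<^sup>2" "b\<^sup>2" 0 "- \<alpha> / 2" "- c / 2" 0])
    show "det3 (- b\<^sup>2) (b\<^sup>2) 0 (- \<alpha> / 2) (- c / 2) 0 \<noteq> 0"
      using b c by (simp add: det3_def)
    show "Im (cinner (skew2 x y v) (A v)) =
      form3 (- b\<^sup>2) (b\<^sup>2) 0 (- \<alpha> / 2) (- c / 2) 0 (Re (cinner v x)) (Re (cinner v f)) (Re (cinner v h))
      + form3 (- b\<^sup>2) (b\<^sup>2) 0 (- \<alpha> / 2) (- c / 2) 0 (Im (cinner v x)) (Im (cinner v f)) (Im (cinner v h))" for v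
    proof -
      have "cinner x (A v) = cinner y v" "cinner y (A v) = cinner (A y) v"
        by (simp_all add: self_adjoint_cinner[OF A] y_def)
      then have "cinner (skew2 x y v) (A v)
          = \<i> * (cinner v y * cinner y v - cinner v x * cinner (A y) v)"
        by (simp add: skew2_apply cinner_simps)
      also have "cinner v y = b * cinner v f" by (simp add: yf cinner_simps)
      also have "cinner y v = b * cnj (cinner v f)"
        by (simp add: yf cinner_simps cinner_commute[of f v])
      also have "cinner (A y) v = complex_of_real (b\<^sup>2) * cnj (cinner v x) + complex_of_real \<alpha> * cnj (cinner v f) + complex_of_real c * cnj (cinner v h)"
        by (simp add: Ay cinner_simps cinner_commute[of f v] cinner_commute[of x v] cinner_commute[of h v])
      also note E = calculation
      show ?thesis unfolding E by (simp add: form3_def power2_eq_square algebra_simps)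
    qed
  qed simp
  then show ?thesis by (simp add: sym_range_def comm_range_def y_def)
qed

text \<open>This makes rank-two operators with a common vector \<open>e\<close> neighbours in the
  asymmetry relation. On \<open>e\<close>, \<open>f\<close>, \<open>k\<close> the determinant is -d
  (r q / 2)^2 with d = r Im p.\<close>

lemma skew2_skew2_asymmetric:
  assumes e: "norm e = 1" and g: "cinner g e = 0" and h: "cinner h e = 0"
    and im: "Im (cinner h g) \<noteq> 0" and res: "residual g h \<noteq> 0"
  shows "\<not> sym_range (skew2 e g) (skew2 e h)"
proof -
  define r where "r = norm g"
  define f where "f = (1 / r) *\<^sub>R g"
  define q where "q = norm (residual g h)"
  \<comment> \<open>The phase makes the coefficient of \<open>k\<close> in \<open>h\<close> equal to
    \<i> q, so that the mixed entry of the form is real.\<close>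
  define k where "k = (- \<i> / complex_of_real q) *\<^sub>C residual g h"
  define p where "p = cinner h f"
  have "g \<noteq> 0" using im by auto
  then have r: "r > 0" and q: "q > 0" using res by (auto simp: r_def q_def)
  have gf: "g = r *\<^sub>R f" using r by (simp add: f_def)
  have rk: "residual g h = (\<i> * q) *\<^sub>C k"
    using q by (simp add: k_def scaleC_scaleC)
  have units: "norm e = 1" "norm f = 1" "norm k = 1"
    using e r q by (simp_all add: f_def k_def norm_scaleC norm_divide r_def q_def)
  have ee: "cinner e e = 1" using e by (simp add: norm_eq_1_cinner)
  have eg: "cinner e g = 0" "cinner e h = 0" using g h by (simp_all add: cinner_eq_0_commute[of e])
  have "cinner e (residual g h) = 0" by (simp add: residual_def cinner_simps eg)
  then have orth: "cinner e f = 0" "cinner e k = 0" "cinner f k = 0"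
    using eg by (simp_all add: f_def k_def cinner_simps)
  have "h = (cinner h g / cinner g g) *\<^sub>C g + residual g h" by (rule residual_decomp)
  also have "cinner h g = p * r" by (simp add: p_def gf cinner_simps)
  also have "cinner g g = r\<^sup>2" by (simp add: r_def cinner_self)
  also note rk
  finally have hf: "h = p *\<^sub>C f + (\<i> * q) *\<^sub>C k"
    using r by (simp add: gf scaleR_scaleC scaleC_scaleC power2_eq_square)
  have imp: "Im p \<noteq> 0" using im r by (simp add: p_def gf cinner_simps)
  let ?d = "r * Im p" and ?m = "- r * q / 2"
  have "\<not> (\<forall>s\<in>{Im (cinner (skew2 e h v) (skew2 e g v)) | v. norm v = 1}.
      - s \<in> {Im (cinner (skew2 e h v) (skew2 e g v)) | v. norm v = 1})"
  proof (rule form3_not_symmetric[OF units orth, of ?d "- ?d" 0 0 0 ?m])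
    show "det3 ?d (- ?d) 0 0 0 ?m \<noteq> 0" using imp r q by (simp add: det3_def)
    show "Im (cinner (skew2 e h v) (skew2 e g v)) =
      form3 ?d (- ?d) 0 0 0 ?m (Re (cinner v e)) (Re (cinner v f)) (Re (cinner v k))
      + form3 ?d (- ?d) 0 0 0 ?m (Im (cinner v e)) (Im (cinner v f)) (Im (cinner v k))" for v
    proof -
      have "cinner (skew2 e h v) (skew2 e g v)
         = cinner v h * cnj (cinner v g) + cinner v e * cnj (cinner v e) * cinner h g"
        by (simp add: skew2_apply cinner_simps ee eg g h algebra_simps)
      also have "cinner v h = cnj p * cinner v f - \<i> * q * cinner v k"
        by (simp add: hf cinner_simps)
      also have "cinner v g = r * cinner v f" by (simp add: gf cinner_simps)
      also have "cinner h g = r * p" by (simp add: gf cinner_simps p_def)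
      also note E = calculation
      show ?thesis unfolding E by (simp add: form3_def power2_eq_square algebra_simps)
    qed
  qed simp
  then show ?thesis by (simp add: sym_range_def comm_range_def)
qed

section \<open>Real combinations of a projection and the identity\<close>

abbreviation "\<D> \<equiv> projection_identity_combinations"

lemma projection_identity_self_adjoint: "A \<in> \<D> \<Longrightarrow> A \<in> self_adjoint_ops"
  by (auto simp: projection_identity_combinations_def projection_def)

text \<open>Conjugation by the symmetry \<open>2P - I\<close> maps the commutator to its negative.\<close>

lemma projection_identity_sym_range:
  assumes "A \<in> \<D>" and B: "B \<in> self_adjoint_ops"
  shows "sym_range A B"
proof -
  obtain \<alpha> P \<delta> where A: "A = \<alpha> *\<^sub>R P + \<delta> *\<^sub>R id_blinfun" and P: "projection P"
    using assms by (auto simp: projection_identity_combinations_def)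
  have Psa: "P \<in> self_adjoint_ops" using P by (simp add: projection_def)
  have PP: "P (P v) = P v" for v
    using P by (metis projection_def blinfun_apply_blinfun_compose)
  have "- r \<in> comm_range P B" if r: "r \<in> comm_range P B" for r
  proof -
    obtain v where v: "norm v = 1" "r = Im (cinner (B v) (P v))"
      using r by (auto simp: comm_range_def)
    define w where "w = 2 *\<^sub>R P v - v"
    have Pvv: "cinner (P v) v = cinner (P v) (P v)" "cinner v (P v) = cinner (P v) (P v)"
      by (simp_all add: self_adjoint_cinner[OF Psa] PP)
    have "cinner w w = cinner v v" by (simp add: w_def cinner_simps Pvv)
    then have "norm w = 1" using v by (simp add: norm_eq_1_cinner)
    moreover have "P w = P v" by (simp add: w_def blinfun.bilinear_simps PP scaleR_2)
    then have "cinner (B w) (P w) = 2 * cinner (B (P v)) (P v) - cinner (B v) (P v)"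
      by (simp add: w_def blinfun.bilinear_simps cinner_simps)
    then have "Im (cinner (B w) (P w)) = - r"
      using self_adjoint_cinner_self(2)[OF B, of "P v"] v by simp
    ultimately show ?thesis unfolding comm_range_def by (metis (mono_tags, lifting) mem_Collect_eq)
  qed
  then show ?thesis
    unfolding A sym_range_def comm_range_affine_left[OF B] by force
qed

lemma eigen_all_imp_scalar:
  assumes A: "A \<in> self_adjoint_ops" and eig: "\<And>x. \<exists>c. A x = c *\<^sub>C x"
  obtains d where "A = d *\<^sub>R id_blinfun"
proof (cases "\<exists>x::'a. x \<noteq> 0")
  case False
  then have "A = 0 *\<^sub>R id_blinfun" by (intro blinfun_eqI) metis
  then show ?thesis by (rule that)
next
  case True
  then obtain x0 :: 'a where x0: "x0 \<noteq> 0" by blast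
  obtain c where c: "A x0 = c *\<^sub>C x0" using eig by blast
  have all: "A y = c *\<^sub>C y" for y
  proof -
    obtain c1 where c1: "A y = c1 *\<^sub>C y" using eig by blast
    obtain c2 where c2: "A (x0 + y) = c2 *\<^sub>C (x0 + y)" using eig by blast
    then have *: "(c2 - c) *\<^sub>C x0 = (c1 - c2) *\<^sub>C y"
      by (simp add: blinfun.bilinear_simps c c1 scaleC_add_right
          complex_vector.scale_left_diff_distrib algebra_simps)
    show ?thesis
    proof (cases "c1 = c2")
      case True
      then have "c2 = c" using * x0 by simp
      then show ?thesis using c1 True by simp
    next
      case False
      then have "y = ((c2 - c) / (c1 - c2)) *\<^sub>C x0"
        using arg_cong[OF *, of "\<lambda>z. (1 / (c1 - c2)) *\<^sub>C z"] by (simp add: scaleC_scaleC)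
      then show ?thesis by (metis self_adjoint_scaleC[OF A] c scaleC_scaleC mult.commute)
    qed
  qed
  have "cinner (A x0) x0 = c * cinner x0 x0" by (simp add: c cinner_simps)
  then have "Im c = 0"
    using self_adjoint_cinner_self(2)[OF A, of x0] x0 by (simp add: cinner_self)
  then have "A = Re c *\<^sub>R id_blinfun"
    by (intro blinfun_eqI) (simp add: all blinfun.bilinear_simps scaleR_scaleC complex_eq_iff)
  then show ?thesis by (rule that)
qed

lemma scalar_projection_identity: "d *\<^sub>R id_blinfun \<in> \<D>"
proof -
  have "projection (0 :: 'a \<Rightarrow>\<^sub>L 'a)"
    by (simp add: projection_def self_adjoint_iff)
  then show ?thesis unfolding projection_identity_combinations_def
    by (intro CollectI exI[of _ 0] exI[of _ "0 :: 'a \<Rightarrow>\<^sub>L 'a"] exI[of _ d]) simp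
qed

text \<open>Completing the square gives B^2 = k I for B = A - (a/2) I. If k \<le> 0, positivity of
  B^2 forces B = 0; otherwise (I + B / sqrt k) / 2 is a projection.\<close>

lemma quadratic_imp_projection_identity:
  assumes A: "A \<in> self_adjoint_ops" and q: "\<And>v. A (A v) = a *\<^sub>R A v + b *\<^sub>R v"
  shows "A \<in> \<D>"
proof -
  define k where "k = b + a\<^sup>2 / 4"
  define B where "B = A - (a / 2) *\<^sub>R id_blinfun"
  have B: "B \<in> self_adjoint_ops" using A by (simp add: B_def)
  have AB: "A = B + (a / 2) *\<^sub>R id_blinfun" by (simp add: B_def)
  have BB: "B (B v) = k *\<^sub>R v" for v
  proof -
    have "B (B v) = A (A v) - a *\<^sub>R A v + (a\<^sup>2 / 4) *\<^sub>R v"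
      by (simp add: B_def blinfun.bilinear_simps algebra_simps power2_eq_square
          flip: scaleR_left_distrib[of "a/2" "a/2"]) 
    then show ?thesis by (simp add: q k_def algebra_simps)
  qed
  have norm: "cinner (B v) (B v) = k * (norm v)\<^sup>2" for v
    by (subst self_adjoint_cinner[OF B]) (simp add: BB cinner_simps cinner_self)
  show ?thesis
  proof (cases "k \<le> 0")
    case True
    have "B v = 0" for v
    proof -
      have "(norm (B v))\<^sup>2 = k * (norm v)\<^sup>2"
        using arg_cong[OF norm[of v], of Re] by (simp add: norm_sq_cinner)
      also have "\<dots> \<le> 0" using True by (simp add: mult_nonpos_nonneg)
      finally show ?thesis by simp
    qed
    then have "A = (a / 2) *\<^sub>R id_blinfun" by (simp add: AB blinfun_eqI)
    then show ?thesis by (simp add: scalar_projection_identity)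
  next
    case False
    define s where "s = sqrt k"
    have s: "s > 0" "s * s = k" using False by (auto simp: s_def)
    define P where "P = (1/2) *\<^sub>R id_blinfun + (1 / (2 * s)) *\<^sub>R B"
    have "P (P v) = P v" for v
      using s by (simp add: P_def blinfun.bilinear_simps BB algebra_simps flip: s(2) scaleR_left_distrib)
    then have "P o\<^sub>L P = P" by (intro blinfun_eqI) simp
    then have "projection P" using B by (simp add: projection_def P_def)
    moreover have "A = (2 * s) *\<^sub>R P + (a / 2 - s) *\<^sub>R id_blinfun"
      using s by (simp add: AB P_def algebra_simps)
    ultimately show ?thesis unfolding projection_identity_combinations_def by blast
  qed
qed

text \<open>
  If every vector generates a subspace of dimension at most 2, there are at most two eigenvalues:
  the sum of three eigenvectors for distinct eigenvalues generates a subspace of dimension 3.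
\<close>

lemma local_quadratic_imp_projection_identity:
  assumes A: "A \<in> self_adjoint_ops"
    and loc: "\<And>x. \<exists>\<mu> \<nu>. \<mu> \<noteq> \<nu> \<and> A (A x) = (\<mu> + \<nu>) *\<^sub>R A x - (\<mu> * \<nu>) *\<^sub>R x"
  shows "A \<in> \<D>"
proof (cases "\<forall>x. \<exists>c. A x = c *\<^sub>C x")
  case True
  then show ?thesis
    using eigen_all_imp_scalar[OF A] scalar_projection_identity by metis
next
  case False
  then obtain x where x: "\<And>c. A x \<noteq> c *\<^sub>C x" by blast
  obtain \<mu> \<nu> where \<mu>\<nu>: "\<mu> \<noteq> \<nu>" "A (A x) = (\<mu> + \<nu>) *\<^sub>R A x - (\<mu> * \<nu>) *\<^sub>R x" using loc by blast
  \<comment> \<open>Since (A - \<mu>)(A - \<nu>) x = 0, each factor applied to \<open>x\<close>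
    yields an eigenvector; neither vanishes, as \<open>x\<close> is no eigenvector.\<close>
  define u1 u2 where "u1 = A x - \<nu> *\<^sub>R x" and "u2 = A x - \<mu> *\<^sub>R x"
  have u: "A u1 = \<mu> *\<^sub>R u1" "A u2 = \<nu> *\<^sub>R u2" "u1 \<noteq> 0" "u2 \<noteq> 0"
    using x[of "complex_of_real \<nu>"] x[of "complex_of_real \<mu>"]
    by (simp_all add: u1_def u2_def blinfun.bilinear_simps \<mu>\<nu> algebra_simps flip: scaleR_scaleC)
  have orth: "cinner u v = 0" if "A u = a *\<^sub>R u" "A v = b *\<^sub>R v" "a \<noteq> b" for u v a b
    using self_adjoint_cinner[OF A, of u v] that by (simp add: cinner_simps)
  have eigv: "w = 0 \<or> l = \<mu> \<or> l = \<nu>" if w: "A w = l *\<^sub>R w" for w l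
  proof (rule ccontr)
    assume "\<not> ?thesis"
    then have l: "w \<noteq> 0" "l \<noteq> \<mu>" "l \<noteq> \<nu>" by auto
    obtain a b where ab: "A (A (u1 + u2 + w)) = (a + b) *\<^sub>R A (u1 + u2 + w) - (a * b) *\<^sub>R (u1 + u2 + w)"
      using loc by blast
    have z: "((\<mu> - a) * (\<mu> - b)) *\<^sub>R u1 + ((\<nu> - a) * (\<nu> - b)) *\<^sub>R u2 + ((l - a) * (l - b)) *\<^sub>R w = 0"
      using ab by (simp add: blinfun.bilinear_simps u w algebra_simps)
    have o: "cinner u1 u2 = 0" "cinner u1 w = 0" "cinner u2 u1 = 0" "cinner u2 w = 0"
      "cinner w u1 = 0" "cinner w u2 = 0"
      using orth[OF u(1) u(2)] orth[OF u(2) u(1)] orth[OF u(1) w] orth[OF w u(1)]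
        orth[OF u(2) w] orth[OF w u(2)] \<mu>\<nu>(1) l by auto
    \<comment> \<open>The three summands are orthogonal and nonzero, so three distinct numbers would
      be roots of one quadratic.\<close>
    have "(\<mu> - a) * (\<mu> - b) = 0" "(\<nu> - a) * (\<nu> - b) = 0" "(l - a) * (l - b) = 0"
      using arg_cong[OF z, of "\<lambda>t. cinner t u1"] arg_cong[OF z, of "\<lambda>t. cinner t u2"]
        arg_cong[OF z, of "\<lambda>t. cinner t w"] u(3,4) l(1)
      by (simp_all add: cinner_simps o flip: of_real_diff)
    then show False using l \<mu>\<nu>(1) by auto
  qed
  have "A (A y) = (\<mu> + \<nu>) *\<^sub>R A y + (- (\<mu> * \<nu>)) *\<^sub>R y" for y
  proof -
    define Q where "Q v = A (A v) - (\<mu> + \<nu>) *\<^sub>R A v + (\<mu> * \<nu>) *\<^sub>R v" for v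
    obtain a b where ab: "a \<noteq> b" "A (A y) = (a + b) *\<^sub>R A y - (a * b) *\<^sub>R y" using loc by blast
    \<comment> \<open>Eigenvectors with y1 - y2 = (a - b) y. Since a \<noteq> b, they recover
      \<open>y\<close>, and it suffices that \<open>Q\<close> kills eigenvectors.\<close>
    define y1 y2 where "y1 = A y - b *\<^sub>R y" and "y2 = A y - a *\<^sub>R y"
    have e: "A y1 = a *\<^sub>R y1" "A y2 = b *\<^sub>R y2"
      by (simp_all add: y1_def y2_def blinfun.bilinear_simps ab algebra_simps)
    have Qe: "Q w = ((l - \<mu>) * (l - \<nu>)) *\<^sub>R w" if "A w = l *\<^sub>R w" for w l
      by (simp add: Q_def that blinfun.bilinear_simps algebra_simps)
    have Q0: "Q y1 = 0" "Q y2 = 0" using Qe[OF e(1)] Qe[OF e(2)] eigv[OF e(1)] eigv[OF e(2)] by auto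
    have "(a - b) *\<^sub>R Q y = Q (y1 - y2)"
      by (simp add: Q_def y1_def y2_def blinfun.bilinear_simps algebra_simps)
    also have "\<dots> = Q y1 - Q y2"
      by (simp add: Q_def blinfun.bilinear_simps algebra_simps)
    finally have "Q y = 0" using Q0 ab(1) by simp
    then show ?thesis by (simp add: Q_def algebra_simps)
  qed
  then show ?thesis by (rule quadratic_imp_projection_identity[OF A])
qed

text \<open>Independence of \<open>x\<close>, \<open>A x\<close>, \<open>A (A x)\<close> written
  with residuals. The mean is normalised to zero, which a scalar shift of \<open>A\<close> achieves
  without changing commutators.\<close>

definition cyclic3 :: "('a::complex_hilbert_space \<Rightarrow>\<^sub>L 'a) \<Rightarrow> 'a \<Rightarrow> bool" where
  "cyclic3 A x \<longleftrightarrow> norm x = 1 \<and> cinner (A x) x = 0 \<and> A x \<noteq> 0 \<and> residual (A x) (residual x (A (A x))) \<noteq> 0"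

text \<open>If no vector is cyclic in this sense, the span of \<open>x\<close> and
  \<open>A x\<close> is invariant for every \<open>x\<close>, and the characteristic polynomial of
  \<open>A\<close> there supplies the local quadratic relation.\<close>

lemma cyclic3_exists:
  assumes A: "A \<in> self_adjoint_ops" and nD: "A \<notin> \<D>"
  obtains x m where "cyclic3 (A - m *\<^sub>R id_blinfun) x"
proof (rule ccontr)
  assume "\<not> thesis"
  then have no: "\<not> cyclic3 (A - m *\<^sub>R id_blinfun) x" for x m using that by blast
  have unit: "\<exists>\<mu> \<nu>. \<mu> \<noteq> \<nu> \<and> A (A x) = (\<mu> + \<nu>) *\<^sub>R A x - (\<mu> * \<nu>) *\<^sub>R x" if x: "norm x = 1" for x
  proof -
    define m where "m = Re (cinner (A x) x)"
    define C where "C = A - m *\<^sub>R id_blinfun"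
    have C: "C \<in> self_adjoint_ops" using A by (simp add: C_def)
    have AC: "A v = C v + m *\<^sub>R v" for v by (simp add: C_def blinfun.bilinear_simps)
    have xx: "cinner x x = 1" using x by (simp add: norm_eq_1_cinner)
    have Cx: "cinner (C x) x = 0"
      using self_adjoint_cinner_self(1)[OF A, of x]
      by (simp add: C_def blinfun.bilinear_simps cinner_simps xx m_def)
    show ?thesis
    proof (cases "C x = 0")
      case True
      then have "A x = m *\<^sub>R x" by (simp add: AC)
      \<comment> \<open>An eigenvector satisfies any quadratic with root \<open>m\<close>; the
        second root only has to differ from \<open>m\<close>.\<close>
      then have "A (A x) = (m + (m + 1)) *\<^sub>R A x - (m * (m + 1)) *\<^sub>R x"
        using scaleR_left_distrib[of "m * m" "m * m" x]
        by (simp add: blinfun.bilinear_simps algebra_simps)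
      then show ?thesis by (intro exI[of _ m] exI[of _ "m + 1"]) auto
    next
      case False
      define y where "y = C x"
      define b where "b = (norm y)\<^sup>2"
      define a where "a = Re (cinner (C y) y) / b"
      have b: "b > 0" using False by (simp add: b_def y_def)
      have yx: "cinner y x = 0" "cinner x y = 0" using Cx by (simp_all add: y_def cinner_eq_0_commute[of x])
      have Cyx: "cinner (C y) x = b" by (simp add: self_adjoint_cinner[OF C] b_def cinner_self flip: y_def)
      have res: "residual y (residual x (C y)) = 0"
        using no[of m x] x Cx False by (simp add: cyclic3_def C_def[symmetric] y_def)
      have "C y = b *\<^sub>R x + residual x (C y)"
        using residual_decomp[of "C y" x] by (simp add: Cyx xx scaleR_scaleC)
      also have "residual x (C y) = (cinner (residual x (C y)) y / cinner y y) *\<^sub>C y"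
        using residual_decomp[of "residual x (C y)" y] res by simp
      also have "cinner (residual x (C y)) y = cinner (C y) y"
        by (simp add: residual_def cinner_simps yx)
      also have "cinner (C y) y / cinner y y = complex_of_real a"
        using self_adjoint_cinner_self(1)[OF C, of y] by (simp add: a_def b_def cinner_self)
      finally have Cy: "C y = b *\<^sub>R x + a *\<^sub>R y" by (simp add: scaleR_scaleC)
      \<comment> \<open>On the span of \<open>x\<close> and \<open>y\<close> the operator
        \<open>C\<close> has characteristic polynomial t^2 - a t - b; \<open>s\<close> is the root
        of its discriminant, positive because b > 0. Adding \<open>m\<close> returns to
        \<open>A\<close>.\<close>
      define s where "s = sqrt (a\<^sup>2 + 4 * b)"
      have s: "s > 0" "s\<^sup>2 = a\<^sup>2 + 4 * b" using b by (auto simp: s_def add_nonneg_pos)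
      let ?\<mu> = "m + (a + s) / 2" and ?\<nu> = "m + (a - s) / 2"
      have e: "?\<mu> + ?\<nu> = 2 * m + a" "?\<mu> * ?\<nu> = m\<^sup>2 + m * a - b"
        using s by (simp_all add: field_simps power2_eq_square)
      have "A (A x) = (?\<mu> + ?\<nu>) *\<^sub>R A x - (?\<mu> * ?\<nu>) *\<^sub>R x"
        using scaleR_left_distrib[of m m y] scaleR_left_distrib[of "m * m" "m * m" x]
        unfolding e AC by (simp add: blinfun.bilinear_simps Cy algebra_simps power2_eq_square scaleR_2 flip: y_def)
      then show ?thesis using s by (intro exI[of _ ?\<mu>] exI[of _ ?\<nu>]) auto
    qed
  qed
  have "\<exists>\<mu> \<nu>. \<mu> \<noteq> \<nu> \<and> A (A x) = (\<mu> + \<nu>) *\<^sub>R A x - (\<mu> * \<nu>) *\<^sub>R x" for x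
  proof (cases "x = 0")
    case True
    then show ?thesis by (intro exI[of _ 0] exI[of _ 1]) (simp add: blinfun.bilinear_simps)
  next
    case False
    then obtain r where r: "r > 0" "norm (r *\<^sub>R x) = 1" by (rule normalize_vec)
    obtain \<mu> \<nu> where *: "\<mu> \<noteq> \<nu>"
      "A (A (r *\<^sub>R x)) = (\<mu> + \<nu>) *\<^sub>R A (r *\<^sub>R x) - (\<mu> * \<nu>) *\<^sub>R (r *\<^sub>R x)"
      using unit[OF r(2)] by blast
    then have "r *\<^sub>R A (A x) = r *\<^sub>R ((\<mu> + \<nu>) *\<^sub>R A x - (\<mu> * \<nu>) *\<^sub>R x)"
      by (simp add: blinfun.bilinear_simps algebra_simps)
    then show ?thesis using r(1) *(1) by auto
  qed
  then have "A \<in> \<D>" by (rule local_quadratic_imp_projection_identity[OF A])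
  with nD show False by simp
qed

lemma not_projection_identity_asymmetric:
  assumes A: "A \<in> self_adjoint_ops" and nD: "A \<notin> \<D>"
  obtains x y where "norm x = 1" "cinner y x = 0" "y \<noteq> 0" "\<not> sym_range A (skew2 x y)"
proof -
  obtain x m where x: "cyclic3 (A - m *\<^sub>R id_blinfun) x" by (rule cyclic3_exists[OF assms])
  let ?C = "A - m *\<^sub>R id_blinfun"
  have "\<not> sym_range ?C (skew2 x (?C x))"
    by (rule skew2_asymmetric) (use x A in \<open>auto simp: cyclic3_def\<close>)
  moreover have "comm_range ?C (skew2 x (?C x)) = comm_range A (skew2 x (?C x))"
    using comm_range_affine_left[of "skew2 x (?C x)" 1 A "- m"] by simp
  ultimately have "\<not> sym_range A (skew2 x (?C x))" by (simp add: sym_range_def)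
  with x that[of x "?C x"] show thesis by (simp add: cyclic3_def)
qed

lemma projection_identity_iff_sym_range:
  assumes "A \<in> self_adjoint_ops"
  shows "A \<in> \<D> \<longleftrightarrow> (\<forall>B\<in>self_adjoint_ops. sym_range A B)"
  using assms projection_identity_sym_range not_projection_identity_asymmetric skew2_self_adjoint
  by metis

section \<open>Commutators with rank-one projections\<close>

lemma scaleC_scaleR: "c *\<^sub>C (r *\<^sub>R (x::'a::complex_hilbert_space)) = r *\<^sub>R (c *\<^sub>C x)"
  by (simp add: scaleR_scaleC scaleC_scaleC mult.commute)

definition variance :: "('a::complex_hilbert_space \<Rightarrow>\<^sub>L 'a) \<Rightarrow> 'a \<Rightarrow> real" where
  "variance A x = (norm (A x))\<^sup>2 - (Re (cinner (A x) x))\<^sup>2"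

lemma variance_residual:
  assumes "A \<in> self_adjoint_ops" "norm x = 1"
  shows "variance A x = (norm (A x - cinner (A x) x *\<^sub>C x))\<^sup>2"
proof -
  have xx: "cinner x x = 1" using assms by (simp add: norm_eq_1_cinner)
  define m where "m = Re (cinner (A x) x)"
  have m: "cinner (A x) x = m" "cinner x (A x) = m"
    using self_adjoint_cinner_self(1)[OF assms(1), of x] self_adjoint_cinner[OF assms(1), of x x]
    by (simp_all add: m_def)
  have "complex_of_real ((norm (A x - m *\<^sub>C x))\<^sup>2) = complex_of_real ((norm (A x))\<^sup>2 - m\<^sup>2)"
    unfolding cinner_self[symmetric] of_real_diff
    by (simp add: cinner_simps m xx power2_eq_square)
  then show ?thesis unfolding variance_def m by (simp only: of_real_eq_iff Re_complex_of_real)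
qed

lemma bessel2:
  fixes v :: "'a::complex_hilbert_space"
  assumes "norm e\<^sub>1 = 1" "norm e\<^sub>2 = 1" "cinner e\<^sub>1 e\<^sub>2 = 0"
  shows "(cmod (cinner v e\<^sub>1))\<^sup>2 + (cmod (cinner v e\<^sub>2))\<^sup>2 \<le> (norm v)\<^sup>2"
proof -
  have o: "cinner e\<^sub>1 e\<^sub>1 = 1" "cinner e\<^sub>2 e\<^sub>2 = 1" "cinner e\<^sub>2 e\<^sub>1 = 0"
    using assms by (simp_all add: norm_eq_1_cinner cinner_eq_0_commute)
  define w where "w = v - cinner v e\<^sub>1 *\<^sub>C e\<^sub>1 - cinner v e\<^sub>2 *\<^sub>C e\<^sub>2"
  have "cinner w w = cinner v v - cinner v e\<^sub>1 * cnj (cinner v e\<^sub>1)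
      - cinner v e\<^sub>2 * cnj (cinner v e\<^sub>2)"
    using assms(3) by (simp add: w_def cinner_simps o cinner_commute[of e\<^sub>1 v] cinner_commute[of e\<^sub>2 v])
  then have "complex_of_real ((norm w)\<^sup>2) = complex_of_real ((norm v)\<^sup>2 - (cmod (cinner v e\<^sub>1))\<^sup>2
      - (cmod (cinner v e\<^sub>2))\<^sup>2)"
    unfolding cinner_self of_real_diff complex_norm_square by simp
  then have "(norm w)\<^sup>2 = (norm v)\<^sup>2 - (cmod (cinner v e\<^sub>1))\<^sup>2 - (cmod (cinner v e\<^sub>2))\<^sup>2"
    by (simp only: of_real_eq_iff)
  then show ?thesis using zero_le_power2[of "norm w"] by linarith
qed

text \<open>Only the part \<open>w\<close> of \<open>A x\<close> orthogonal to \<open>x\<close>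
  contributes, through Im (<v, x> <w, v>). The bound combines 2 a b \<le> a^2 + b^2 with Bessel's
  inequality.\<close>

lemma comm_range_ray:
  assumes A: "A \<in> self_adjoint_ops" and x: "norm x = 1"
  shows "sqrt (variance A x) / 2 \<in> comm_range A (ray x)"
    and "r \<in> comm_range A (ray x) \<Longrightarrow> \<bar>r\<bar> \<le> sqrt (variance A x) / 2"
proof -
  define w where "w = A x - cinner (A x) x *\<^sub>C x"
  have xx: "cinner x x = 1" using x by (simp add: norm_eq_1_cinner)
  have sq: "sqrt (variance A x) = norm w" by (simp add: variance_residual[OF A x] w_def)
  have "cinner w x = 0" by (simp add: w_def cinner_simps xx)
  then have wx: "cinner w x = 0" "cinner x w = 0" by (simp_all add: cinner_eq_0_commute[of x])
  have Im: "Im (cinner (ray x v) (A v)) = Im (cinner v x * cinner w v)" for v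
  proof -
    define m where "m = Re (cinner (A x) x)"
    have Axw: "A x = complex_of_real m *\<^sub>C x + w"
      using self_adjoint_cinner_self(1)[OF A, of x] by (simp add: w_def m_def)
    have "cinner (ray x v) (A v) = cinner v x * cinner (A x) v"
      by (simp add: cinner_simps self_adjoint_cinner[OF A])
    also have "\<dots> = m * (cinner v x * cnj (cinner v x)) + cinner v x * cinner w v"
      by (simp add: Axw cinner_simps cinner_commute[of x v] algebra_simps)
    finally show ?thesis by simp
  qed
  show "sqrt (variance A x) / 2 \<in> comm_range A (ray x)"
  proof (cases "w = 0")
    case True
    then have "Im (cinner (ray x x) (A x)) = 0" by (simp only: Im) simp
    then show ?thesis using x True unfolding sq comm_range_def by force
  next
    case False
    define s where "s = norm w"
    define h where "h = (1 / s) *\<^sub>R w"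
    have s: "s > 0" using False by (simp add: s_def)
    have ws: "w = s *\<^sub>R h" using s by (simp add: h_def)
    have "norm h = 1" using s by (simp add: h_def s_def)
    then have hh: "cinner h h = 1" by (simp add: norm_eq_1_cinner)
    have hx: "cinner h x = 0" "cinner x h = 0" using wx by (simp_all add: h_def cinner_simps)
    \<comment> \<open>Equal weights on \<open>x\<close> and \<open>h\<close> give equality in the
      bound; the phase makes the product purely imaginary.\<close>
    define v where "v = (1 / sqrt 2) *\<^sub>R (x - \<i> *\<^sub>C h)"
    have rt: "complex_of_real (sqrt 2) * complex_of_real (sqrt 2) = 2"
      by (simp flip: of_real_mult)
    have "cinner v v = 1"
      by (simp add: v_def cinner_simps xx hh hx rt field_simps)
    then have "norm v = 1" by (simp add: norm_eq_1_cinner)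
    moreover have "cinner v x * cinner w v = \<i> * complex_of_real (s / 2)"
      by (simp add: v_def ws cinner_simps xx hh hx rt field_simps)
    then have "Im (cinner (ray x v) (A v)) = s / 2" by (simp only: Im) simp
    ultimately show ?thesis unfolding sq comm_range_def s_def by (metis (mono_tags, lifting) mem_Collect_eq)
  qed
  show "\<bar>r\<bar> \<le> sqrt (variance A x) / 2" if r: "r \<in> comm_range A (ray x)"
  proof -
    obtain v where v: "norm v = 1" "r = Im (cinner v x * cinner w v)"
      using r Im by (auto simp: comm_range_def)
    show ?thesis
    proof (cases "w = 0")
      case True
      then show ?thesis using v by (simp add: sq)
    next
      case False
      define s where "s = norm w"
      define h where "h = (1 / s) *\<^sub>R w"
      have s: "s > 0" using False by (simp add: s_def)
      have ws: "w = s *\<^sub>R h" using s by (simp add: h_def)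
      have h: "norm h = 1" using s by (simp add: h_def s_def)
      have hx: "cinner x h = 0" using wx by (simp add: h_def cinner_simps)
      have "\<bar>r\<bar> \<le> cmod (cinner v x * cinner w v)" unfolding v by (rule abs_Im_le_cmod)
      also have "\<dots> = s * (cmod (cinner v x) * cmod (cinner v h))"
        using s by (simp add: ws cinner_simps norm_mult cinner_commute[of h v])
      also have "cmod (cinner v x) * cmod (cinner v h) \<le> 1 / 2"
        using bessel2[OF x h hx, of v] v(1) zero_le_power2[of "cmod (cinner v x) - cmod (cinner v h)"]
        by (simp add: power2_diff)
      finally show ?thesis using s by (simp add: sq s_def)
    qed
  qed
qed

lemma variance_nonneg: "A \<in> self_adjoint_ops \<Longrightarrow> norm x = 1 \<Longrightarrow> 0 \<le> variance A x"
  by (simp add: variance_residual)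

text \<open>The largest moduli of the two sets are compared. The sign of \<open>c\<close> is lost
  here, which is why signs have to be recovered separately at the end.\<close>

lemma variance_scale:
  assumes A: "A \<in> self_adjoint_ops" "norm x = 1" and B: "B \<in> self_adjoint_ops" "norm y = 1"
    and eq: "comm_range A (ray x) = (*) c ` comm_range B (ray y)"
  shows "variance A x = c\<^sup>2 * variance B y"
proof -
  have "c * (sqrt (variance B y) / 2) \<in> comm_range A (ray x)"
    using comm_range_ray(1)[OF B] eq by blast
  then have "\<bar>c * (sqrt (variance B y) / 2)\<bar> \<le> sqrt (variance A x) / 2"
    by (rule comm_range_ray(2)[OF A])
  then have 1: "\<bar>c\<bar> * sqrt (variance B y) \<le> sqrt (variance A x)"
    by (simp add: abs_mult variance_nonneg[OF B])
  obtain r where r: "r \<in> comm_range B (ray y)" "sqrt (variance A x) / 2 = c * r"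
    using comm_range_ray(1)[OF A] unfolding eq by blast
  have "\<bar>c * r\<bar> \<le> \<bar>c\<bar> * (sqrt (variance B y) / 2)"
    unfolding abs_mult by (intro mult_left_mono comm_range_ray(2)[OF B r(1)]) simp
  then have "sqrt (variance A x) \<le> \<bar>c\<bar> * sqrt (variance B y)"
    using r(2) by linarith
  with 1 have "sqrt (variance A x) = \<bar>c\<bar> * sqrt (variance B y)" by simp
  then have "(sqrt (variance A x))\<^sup>2 = (\<bar>c\<bar> * sqrt (variance B y))\<^sup>2" by simp
  then show ?thesis
    using variance_nonneg[OF A] variance_nonneg[OF B] by (simp add: power_mult_distrib)
qed

lemma com_ray_iff:
  assumes A: "A \<in> self_adjoint_ops" and x: "norm x = 1"
  shows "com A (ray x) \<longleftrightarrow> variance A x = 0"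
    and "com A (ray x) \<longleftrightarrow> A x = cinner (A x) x *\<^sub>C x"
proof -
  show *: "com A (ray x) \<longleftrightarrow> variance A x = 0"
    using comm_range_ray[OF assms] by (auto simp: com_def)
  show "com A (ray x) \<longleftrightarrow> A x = cinner (A x) x *\<^sub>C x"
    unfolding * variance_residual[OF assms] by simp
qed

lemma com_ray_eigen:
  assumes "A \<in> self_adjoint_ops" "norm x = 1" "A x = c *\<^sub>C x"
  shows "com A (ray x)"
proof -
  have "cinner x x = 1" using assms by (simp add: norm_eq_1_cinner)
  then show ?thesis using assms by (simp add: com_ray_iff(2) cinner_simps)
qed

lemma variance_ray:
  assumes "norm y = 1"
  shows "variance (ray y) x = (cmod (cinner x y))\<^sup>2 - ((cmod (cinner x y))\<^sup>2)\<^sup>2"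
proof -
  have "cinner (ray y x) x = complex_of_real ((cmod (cinner x y))\<^sup>2)"
    unfolding complex_norm_square by (simp add: cinner_simps cinner_commute[of y x])
  then have "Re (cinner (ray y x) x) = (cmod (cinner x y))\<^sup>2"
    by (simp only: Re_complex_of_real)
  then show ?thesis using assms by (simp add: variance_def norm_scaleC)
qed

lemma com_affine_right:
  assumes "S \<in> self_adjoint_ops" "a \<noteq> 0"
  shows "com S (a *\<^sub>R A + d *\<^sub>R id_blinfun) \<longleftrightarrow> com S A"
  using assms(2) unfolding com_def comm_range_affine_right[OF assms(1)] by auto

lemma com_id: "S \<in> self_adjoint_ops \<Longrightarrow> com S (d *\<^sub>R id_blinfun)"
  by (simp add: com_iff_Im self_adjoint_cinner_self blinfun.bilinear_simps cinner_simps)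

lemma com_diff: "com S A \<Longrightarrow> com S B \<Longrightarrow> com S (A - B)"
  by (simp add: com_iff_Im blinfun.bilinear_simps cinner_simps)

section \<open>Recognising rank-one projections by commutation\<close>

lemma projection_apply: "projection E \<Longrightarrow> E (E v) = E v"
  by (metis projection_def blinfun_apply_blinfun_compose)

lemma projection_self_adjoint [simp]: "projection E \<Longrightarrow> E \<in> self_adjoint_ops"
  by (simp add: projection_def)

lemma projectionI: "E \<in> self_adjoint_ops \<Longrightarrow> (\<And>v. E (E v) = E v) \<Longrightarrow> projection E"
  by (auto simp: projection_def intro: blinfun_eqI)

lemma projection_compl: "projection E \<Longrightarrow> projection (id_blinfun - E)"
  by (rule projectionI) (simp_all add: blinfun.bilinear_simps projection_apply)

lemma com_compl: "S \<in> self_adjoint_ops \<Longrightarrow> com S (id_blinfun - E) \<longleftrightarrow> com S E"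
  using com_affine_right[of S "-1" E 1] by (simp add: algebra_simps)

lemma projection_ray: "norm x = 1 \<Longrightarrow> projection (ray x)"
  by (rule projectionI) (simp_all add: cinner_simps norm_eq_1_cinner)

lemma projection_in_D: "projection E \<Longrightarrow> a *\<^sub>R E + d *\<^sub>R id_blinfun \<in> \<D>"
  by (auto simp: projection_identity_combinations_def)

lemma projection_in_D': "projection E \<Longrightarrow> E \<in> \<D>"
  using projection_in_D[of E 1 0] by simp

lemma projection_eigen:
  assumes E: "projection E" and c: "E v = c *\<^sub>C v"
  shows "E v = 0 \<or> E v = v"
proof -
  have "c *\<^sub>C (c *\<^sub>C v) = c *\<^sub>C v"
    using projection_apply[OF E, of v] E by (simp add: c self_adjoint_scaleC)
  then have "(c * c - c) *\<^sub>C v = 0"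
    by (simp add: scaleC_scaleC complex_vector.scale_left_diff_distrib)
  then have "c * (c - 1) = 0 \<or> v = 0" by (simp add: algebra_simps)
  then show ?thesis using c by auto
qed

lemma D_com_projection:
  assumes "Q \<in> \<D>"
  obtains E where "projection E" "\<And>S. S \<in> self_adjoint_ops \<Longrightarrow> com S Q \<longleftrightarrow> com S E"
proof -
  obtain \<alpha> P \<delta> where Q: "Q = \<alpha> *\<^sub>R P + \<delta> *\<^sub>R id_blinfun" and P: "projection P"
    using assms by (auto simp: projection_identity_combinations_def)
  show thesis
  proof (cases "\<alpha> = 0")
    case True
    have "projection (0 :: 'a \<Rightarrow>\<^sub>L 'a)" by (rule projectionI) (simp_all add: self_adjoint_iff)
    moreover have "com S Q \<longleftrightarrow> com S 0" if "S \<in> self_adjoint_ops" for S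
      using com_id[OF that, of \<delta>] com_id[OF that, of 0] by (simp add: Q True)
    ultimately show ?thesis by (rule that)
  next
    case False
    then show ?thesis using that[OF P] com_affine_right[of _ \<alpha> P \<delta>] Q by auto
  qed
qed

section \<open>Commutation tests by superpositions\<close>

definition mid :: "'a \<Rightarrow> 'a \<Rightarrow> 'a::complex_hilbert_space" where
  "mid p q = (1 / sqrt 2) *\<^sub>R (p + q)"

lemma sqrt2_sq: "complex_of_real (sqrt 2) * complex_of_real (sqrt 2) = 2"
  by (simp flip: of_real_mult)

lemma norm_mid:
  assumes "norm p = 1" "norm q = 1" "cinner p q = 0"
  shows "norm (mid p q) = 1"
proof -
  have "cinner p p = 1" "cinner q q = 1" "cinner q p = 0"
    using assms by (simp_all add: norm_eq_1_cinner cinner_eq_0_commute)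
  then have "cinner (mid p q) (mid p q) = 1"
    by (simp add: mid_def cinner_simps assms sqrt2_sq field_simps)
  then show ?thesis by (simp add: norm_eq_1_cinner)
qed

text \<open>A superposition of eigenvectors for the distinct eigenvalues 1 and 0 is not an
  eigenvector. All later witnesses of non-commutation have this shape.\<close>

lemma not_com_mid:
  assumes B: "B \<in> self_adjoint_ops" and pq: "norm p = 1" "norm q = 1" "cinner p q = 0"
    and Bp: "B p = p" "B q = 0"
  shows "\<not> com B (ray (mid p q))"
proof
  assume "com B (ray (mid p q))"
  then have eq: "B (mid p q) = cinner (B (mid p q)) (mid p q) *\<^sub>C mid p q"
    by (simp add: com_ray_iff(2)[OF B norm_mid[OF pq]])
  have o: "cinner p p = 1" "cinner q q = 1" "cinner q p = 0"
    using pq by (simp_all add: norm_eq_1_cinner cinner_eq_0_commute)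
  have Bm: "B (mid p q) = (1 / sqrt 2) *\<^sub>R p"
    by (simp add: mid_def blinfun.bilinear_simps Bp)
  have "cinner (B (mid p q)) (mid p q) = 1 / 2"
    by (simp only: Bm) (simp add: mid_def cinner_simps o pq sqrt2_sq field_simps)
  with eq have "cinner (B (mid p q)) q = 1 / 2 * cinner (mid p q) q"
    by (metis cinner_scaleC_left)
  then show False by (simp only: Bm) (simp add: mid_def cinner_simps o pq)
qed

definition scalar_op :: "('a::complex_hilbert_space \<Rightarrow>\<^sub>L 'a) \<Rightarrow> bool" where
  "scalar_op A \<longleftrightarrow> (\<forall>S\<in>self_adjoint_ops. com S A)"

text \<open>Membership of \<open>R\<close> in the bicommutant of \<open>A\<close> and
  \<open>Q\<close>. Like its neighbours, the notion uses only commutation with self-adjoint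
  operators, so a surjective map preserving commutation preserves it.\<close>

definition bicom :: "('a::complex_hilbert_space \<Rightarrow>\<^sub>L 'a) \<Rightarrow> ('a \<Rightarrow>\<^sub>L 'a) \<Rightarrow> ('a \<Rightarrow>\<^sub>L 'a) \<Rightarrow> bool" where
  "bicom A Q R \<longleftrightarrow> (\<forall>S\<in>self_adjoint_ops. com S A \<and> com S Q \<longrightarrow> com S R)"

text \<open>For projections other than 0 and \<open>I\<close> this amounts to equality up to
  complement.\<close>

definition same_com :: "('a::complex_hilbert_space \<Rightarrow>\<^sub>L 'a) \<Rightarrow> ('a \<Rightarrow>\<^sub>L 'a) \<Rightarrow> bool" where
  "same_com Q R \<longleftrightarrow> (\<forall>S\<in>self_adjoint_ops. com S Q \<longleftrightarrow> com S R)"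

text \<open>
  Two commuting projections \<open>A\<close>, \<open>Q\<close> generate a Boolean algebra, which has at most three atoms if
  \<open>A\<close> has rank one. With at most three atoms any two elements that are neither trivial nor equal up
  to complement generate it, with four atoms they need not.
\<close>

definition ray_like :: "('a::complex_hilbert_space \<Rightarrow>\<^sub>L 'a) \<Rightarrow> bool" where
  "ray_like A \<longleftrightarrow> A \<in> \<D> \<and> \<not> scalar_op A \<and>
    (\<forall>Q\<in>\<D>. com A Q \<longrightarrow> (\<forall>R\<in>\<D>. \<not> scalar_op R \<longrightarrow> bicom A Q R \<longrightarrow> \<not> same_com Q R \<longrightarrow> bicom Q R A))"

text \<open>The sum of a vector not killed by \<open>F\<close> and a vector not fixed by
  \<open>F\<close> would be neither killed nor fixed.\<close>

lemma dichotomy_uniform: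
  assumes "\<And>u v. u \<in> V \<Longrightarrow> v \<in> V \<Longrightarrow> u + v \<in> V"
    and "\<And>u. u \<in> V \<Longrightarrow> F u = 0 \<or> F u = u"
    and add: "\<And>u v. F (u + v) = F u + (F v :: 'a::real_vector)"
  shows "(\<forall>u\<in>V. F u = 0) \<or> (\<forall>u\<in>V. F u = u)"
proof (rule ccontr)
  assume "\<not> ?thesis"
  then obtain u v where uv: "u \<in> V" "v \<in> V" "F u \<noteq> 0" "F v \<noteq> v" by blast
  then have "F u = u" "F v = 0" "F (u + v) = 0 \<or> F (u + v) = u + v" using assms(1,2) by blast+
  then show False using uv add[of u v] by auto
qed

text \<open>The space splits into the range of \<open>E\<close>, the line of \<open>x\<close> and
  the rest \<open>N\<close>, and \<open>F\<close> is 0 or 1 on each piece. As \<open>F\<close>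
  vanishes on the first, it is 0, \<open>I - E - ray x\<close>, \<open>ray x\<close> or
  \<open>I - E\<close>. The outer two are excluded by \<open>ns\<close> and \<open>nsc\<close>; the
  inner two let \<open>ray x\<close> be recovered from \<open>E\<close> and
  \<open>F\<close>.\<close>

lemma bicom_ray:
  assumes x: "norm x = 1" and E: "projection E" and F: "projection F"
    and Ex: "E x = 0" and bi: "bicom (ray x) E F" and ns: "\<not> scalar_op F"
    and nsc: "\<not> same_com E F" and EF: "\<And>u. E u = u \<Longrightarrow> F u = 0"
  shows "bicom E F (ray x)"
proof -
  have xx: "cinner x x = 1" using x by (simp add: norm_eq_1_cinner)
  \<comment> \<open>The ray of a common eigenvector of \<open>ray x\<close> and \<open>E\<close>
    commutes with both, hence with \<open>F\<close>; thus the vector is an eigenvector of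
    \<open>F\<close>, too.\<close>
  have dich: "F u = 0 \<or> F u = u" if u: "ray x u = c *\<^sub>C u" "E u = d *\<^sub>C u" for u c d
  proof (cases "u = 0")
    case False
    then obtain r where r: "r > 0" "norm (r *\<^sub>R u) = 1" by (rule normalize_vec)
    have "com (ray x) (ray (r *\<^sub>R u))"
      by (rule com_ray_eigen[of _ _ c])
        (use r u in \<open>simp_all add: blinfun.bilinear_simps scaleC_scaleR del: ray_apply\<close>)
    moreover have "com E (ray (r *\<^sub>R u))"
      by (rule com_ray_eigen[of _ _ d])
        (use r u E in \<open>simp_all add: blinfun.bilinear_simps scaleC_scaleR\<close>)
    ultimately have "com (ray (r *\<^sub>R u)) (ray x)" "com (ray (r *\<^sub>R u)) E"
      by (simp_all only: com_commute[of "ray (r *\<^sub>R u)"])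
    then have "com F (ray (r *\<^sub>R u))"
      using bi unfolding bicom_def com_commute[of F] by simp
    then obtain k where "F (r *\<^sub>R u) = k *\<^sub>C (r *\<^sub>R u)"
      using com_ray_iff(2)[OF projection_self_adjoint[OF F] r(2)] by blast
    from projection_eigen[OF F this] show ?thesis
      using r(1) by (auto simp: blinfun.bilinear_simps)
  qed (simp add: blinfun.bilinear_simps)
  have Fx: "F x = 0 \<or> F x = x" by (rule dich[of x 1 0]) (simp_all add: xx Ex)
  define N where "N = {u. E u = 0 \<and> cinner u x = 0}"
  have N: "(\<forall>u\<in>N. F u = 0) \<or> (\<forall>u\<in>N. F u = u)"
  proof (rule dichotomy_uniform)
    show "F u = 0 \<or> F u = u" if "u \<in> N" for u
      by (rule dich[of u 0 0]) (use that in \<open>simp_all add: N_def\<close>)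
  qed (auto simp: N_def blinfun.bilinear_simps cinner_simps)
  define n where "n v = v - E v - cinner v x *\<^sub>C x" for v
  have nN: "n v \<in> N" for v
  proof -
    have "E (n v) = 0"
      using E by (simp add: n_def blinfun.bilinear_simps projection_apply self_adjoint_scaleC Ex)
    moreover have "cinner (n v) x = 0"
      using E by (simp add: n_def cinner_simps xx self_adjoint_cinner Ex)
    ultimately show ?thesis by (simp add: N_def)
  qed
  have Fv: "F v = cinner v x *\<^sub>C F x + F (n v)" for v
  proof -
    have "F v = F (E v + cinner v x *\<^sub>C x + n v)" by (simp add: n_def)
    also have "\<dots> = F (E v) + cinner v x *\<^sub>C F x + F (n v)"
      using F by (simp add: blinfun.bilinear_simps self_adjoint_scaleC)
    also have "F (E v) = 0" by (rule EF) (simp add: projection_apply[OF E])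
    finally show ?thesis by simp
  qed
  show ?thesis
  proof (cases "F x = 0")
    case True
    show ?thesis
    proof (cases "\<forall>u\<in>N. F u = 0")
      case 1: True
      have "F v = 0" for v using Fv[of v] True 1 nN[of v] by simp
      then have "F = 0 *\<^sub>R id_blinfun" by (intro blinfun_eqI) simp
      then show ?thesis using ns com_id[of _ 0] unfolding scalar_op_def by metis
    next
      case False
      then have "F (n v) = n v" for v using N nN by blast
      then have "F v = n v" for v using Fv[of v] True by simp
      then have "ray x = (id_blinfun - E) - F"
        by (intro blinfun_eqI) (simp add: n_def blinfun.bilinear_simps)
      then show ?thesis unfolding bicom_def by (simp add: com_diff com_compl)
    qed
  next
    case False
    then have Fx: "F x = x" using Fx by simp
    show ?thesis
    proof (cases "\<forall>u\<in>N. F u = 0")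
      case True
      have "F v = cinner v x *\<^sub>C x" for v using Fv[of v] True Fx nN[of v] by simp
      then have "ray x = F" by (intro blinfun_eqI) simp
      then show ?thesis unfolding bicom_def by simp
    next
      case False
      then have "F (n v) = n v" for v using N nN by blast
      then have "F v = v - E v" for v using Fv[of v] Fx by (simp add: n_def)
      then have "F = id_blinfun - E"
        by (intro blinfun_eqI) (simp add: blinfun.bilinear_simps)
      then show ?thesis using nsc unfolding same_com_def by (simp add: com_compl)
    qed
  qed
qed

lemma projection_orthonormal_pair:
  assumes E: "projection E" "E \<noteq> 0" and nray: "\<And>x. norm x = 1 \<Longrightarrow> E \<noteq> ray x"
  obtains u v where "norm u = 1" "norm v = 1" "cinner u v = 0" "E u = u" "E v = v"
proof -
  obtain y where y: "E y \<noteq> 0" using E(2) by (metis blinfun_eqI blinfun.zero_left)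
  then obtain r where r: "r > 0" "norm (r *\<^sub>R E y) = 1" by (rule normalize_vec)
  define u where "u = r *\<^sub>R E y"
  have u: "norm u = 1" "E u = u"
    using r by (simp_all add: u_def blinfun.bilinear_simps projection_apply[OF E(1)])
  have uu: "cinner u u = 1" using u by (simp add: norm_eq_1_cinner)
  obtain z where z: "E z \<noteq> ray u z" using nray[OF u(1)] by (metis blinfun_eqI)
  define w where "w = E z - cinner z u *\<^sub>C u"
  have w: "w \<noteq> 0" "E w = w"
    using z u E(1) by (simp_all add: w_def blinfun.bilinear_simps projection_apply self_adjoint_scaleC)
  have "cinner w u = 0"
    using E(1) u uu by (simp add: w_def cinner_simps self_adjoint_cinner)
  then have wu: "cinner u w = 0" by (simp add: cinner_eq_0_commute[of u])
  obtain s where s: "s > 0" "norm (s *\<^sub>R w) = 1" using w(1) by (rule normalize_vec)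
  show thesis
    by (rule that[of u "s *\<^sub>R w"]) (use u s w wu in \<open>simp_all add: blinfun.bilinear_simps cinner_simps\<close>)
qed

locale dim_at_least_3 =
  fixes dummy :: "'a::complex_hilbert_space itself"
  assumes dim_ge_3: "\<exists>S :: 'a set. card S = 3 \<and> complex_vector.independent S"
begin

text \<open>The form in which the dimension enters all later arguments: the span of two vectors
  cannot contain three independent ones.\<close>

lemma ex_unit_orthogonal:
  fixes x y :: 'a
  obtains w where "norm w = 1" "cinner w x = 0" "cinner w y = 0"
proof -
  obtain S :: "'a set" where S: "card S = 3" "complex_vector.independent S" using dim_ge_3 by blast
  have "\<not> S \<subseteq> complex_vector.span {x, y}"
  proof
    assume "S \<subseteq> complex_vector.span {x, y}"
    then have "card S \<le> card {x, y}"
      using complex_vector.independent_span_bound[of "{x, y}" S] S by blast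
    also have "\<dots> \<le> 2" by (simp add: card_insert_if)
    finally show False using S by simp
  qed
  then obtain s where s: "s \<notin> complex_vector.span {x, y}" by blast
  define r where "r = residual x s"
  define y' where "y' = residual x y"
  define w where "w = residual y' r"
  have x: "x \<in> complex_vector.span {x, y}" and y: "y \<in> complex_vector.span {x, y}"
    by (auto intro: complex_vector.span_base)
  have "y' \<in> complex_vector.span {x, y}"
    unfolding y'_def residual_def
    by (intro complex_vector.span_diff complex_vector.span_scale x y)
  then have "w \<noteq> 0"
    using s x residual_decomp[of s x] residual_decomp[of r y'] unfolding w_def r_def
    by (metis add.right_neutral complex_vector.span_add complex_vector.span_scale)
  have wx: "cinner w x = 0"
    unfolding w_def residual_def[of y'] by (simp add: cinner_simps r_def y'_def)
  have "cinner w y' = 0" by (simp add: w_def)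
  then have wy: "cinner w y = 0"
    using residual_decomp[of y x] wx by (metis y'_def cinner_add_right cinner_scaleC_right mult_zero_right add.right_neutral)
  obtain t where "t > 0" "norm (t *\<^sub>R w) = 1" using \<open>w \<noteq> 0\<close> by (rule normalize_vec)
  then show thesis using wx wy that[of "t *\<^sub>R w"] by (simp add: cinner_simps)
qed

lemma ray_not_scalar:
  fixes x :: 'a
  assumes "norm x = 1"
  shows "\<not> scalar_op (ray x)"
proof -
  obtain w where w: "norm w = 1" "cinner w x = 0" by (rule ex_unit_orthogonal[of x x])
  have "\<not> com (ray x) (ray (mid x w))"
    by (rule not_com_mid)
      (use assms w in \<open>simp_all add: norm_eq_1_cinner cinner_eq_0_commute[of x]\<close>)
  then show ?thesis unfolding scalar_op_def by (metis com_commute ray_self_adjoint)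
qed

text \<open>Commutants do not change when \<open>Q\<close> and \<open>R\<close> are replaced by
  projections or by complements of these. This normalises the situation to \<open>E x = 0\<close>
  and \<open>F = 0\<close> on the range of \<open>E\<close>, where \<open>bicom_ray\<close>
  applies.\<close>

lemma ray_like_ray:
  fixes x :: 'a
  assumes x: "norm x = 1" and a: "a \<noteq> 0"
  shows "ray_like (a *\<^sub>R ray x + d *\<^sub>R id_blinfun)" (is "ray_like ?A")
proof -
  have comA: "com S ?A \<longleftrightarrow> com S (ray x)" if "S \<in> self_adjoint_ops" for S
    using com_affine_right[OF that a] .
  have A: "?A \<in> self_adjoint_ops" by simp
  have "bicom Q R ?A"
    if Q: "Q \<in> \<D>" and R: "R \<in> \<D>" and AQ: "com ?A Q" and ns: "\<not> scalar_op R"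
      and bi: "bicom ?A Q R" and nsc: "\<not> same_com Q R" for Q R
  proof -
    obtain E0 where E0: "projection E0" "\<And>S. S \<in> self_adjoint_ops \<Longrightarrow> com S Q \<longleftrightarrow> com S E0"
      using Q by (rule D_com_projection) blast
    have "com E0 (ray x)"
      using AQ E0 A comA[OF projection_self_adjoint[OF E0(1)]] by (simp add: com_commute[of E0])
    then obtain c where "E0 x = c *\<^sub>C x"
      using com_ray_iff(2)[OF projection_self_adjoint[OF E0(1)] x] by blast
    then have "E0 x = 0 \<or> E0 x = x" by (rule projection_eigen[OF E0(1)])
    then obtain E where E: "projection E" "\<And>S. S \<in> self_adjoint_ops \<Longrightarrow> com S Q \<longleftrightarrow> com S E"
      and Ex: "E x = 0"
    proof
      assume "E0 x = x"
      then show thesis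
        by (intro that[of "id_blinfun - E0"]) (simp_all add: E0 projection_compl com_compl blinfun.bilinear_simps)
    qed (use E0 that in blast)
    obtain F0 where F0: "projection F0" "\<And>S. S \<in> self_adjoint_ops \<Longrightarrow> com S R \<longleftrightarrow> com S F0"
      using R by (rule D_com_projection) blast
    \<comment> \<open>Every vector in the range of \<open>E\<close> is a common eigenvector of
      \<open>ray x\<close> and \<open>E\<close>, hence an eigenvector of \<open>F0\<close>;
      additivity makes the eigenvalue uniform.\<close>
    have "(\<forall>u\<in>{u. E u = u}. F0 u = 0) \<or> (\<forall>u\<in>{u. E u = u}. F0 u = u)"
    proof (rule dichotomy_uniform)
      show "F0 u = 0 \<or> F0 u = u" if "u \<in> {u. E u = u}" for u
      proof (cases "u = 0")
        case False
        have Eu: "E u = u" using that by simp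
        obtain r where r: "r > 0" "norm (r *\<^sub>R u) = 1" using False by (rule normalize_vec)
        have "cinner u x = cinner u (E x)"
          using Eu self_adjoint_cinner[OF projection_self_adjoint[OF E(1)], of u x] by simp
        then have "cinner u x = 0" by (simp add: Ex)
        then have "com (ray x) (ray (r *\<^sub>R u))"
          by (intro com_ray_eigen[of _ _ 0]) (use r in \<open>simp_all add: cinner_simps\<close>)
        moreover have "com E (ray (r *\<^sub>R u))"
          by (rule com_ray_eigen[of _ _ 1]) (use r Eu E in \<open>simp_all add: blinfun.bilinear_simps\<close>)
        ultimately have "com (ray (r *\<^sub>R u)) (ray x)" "com (ray (r *\<^sub>R u)) E"
          by (simp_all only: com_commute[of "ray (r *\<^sub>R u)"])
        then have "com F0 (ray (r *\<^sub>R u))"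
          using bi E(2) F0(2) comA unfolding bicom_def com_commute[of F0] by simp
        then obtain k where "F0 (r *\<^sub>R u) = k *\<^sub>C (r *\<^sub>R u)"
          using com_ray_iff(2)[OF projection_self_adjoint[OF F0(1)] r(2)] by blast
        from projection_eigen[OF F0(1) this] show ?thesis
          using r(1) by (auto simp: blinfun.bilinear_simps)
      qed (simp add: blinfun.bilinear_simps)
    qed (auto simp: blinfun.bilinear_simps)
    then obtain F where F: "projection F" "\<And>S. S \<in> self_adjoint_ops \<Longrightarrow> com S R \<longleftrightarrow> com S F"
      and EF: "\<And>u. E u = u \<Longrightarrow> F u = 0"
    proof
      assume "\<forall>u\<in>{u. E u = u}. F0 u = u"
      then show thesis
        by (intro that[of "id_blinfun - F0"]) (simp_all add: F0 projection_compl com_compl blinfun.bilinear_simps)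
    qed (use F0 that in blast)
    have "bicom E F (ray x)"
      by (rule bicom_ray[OF x E(1) F(1) Ex _ _ _ EF])
        (use bi ns nsc E(2) F(2) comA in \<open>auto simp: bicom_def scalar_op_def same_com_def\<close>)
    then show ?thesis using E(2) F(2) comA by (auto simp: bicom_def)
  qed
  moreover have "\<not> scalar_op ?A" using ray_not_scalar[OF x] comA by (auto simp: scalar_op_def)
  moreover have "?A \<in> \<D>" by (rule projection_in_D[OF projection_ray[OF x]])
  ultimately show ?thesis by (auto simp: ray_like_def)
qed

text \<open>Otherwise both \<open>E\<close> and its complement have rank at least two, with
  \<open>u1\<close>, \<open>u2\<close> in the range and \<open>u3\<close>, \<open>u4\<close> in the
  kernel of \<open>E\<close>. Then \<open>ray u1\<close> is the product of \<open>E\<close> and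
  \<open>Q = ray u1 + ray u3\<close>, but \<open>E\<close> is not determined by \<open>Q\<close> and
  \<open>ray u1\<close>.\<close>

lemma ray_like_imp_ray:
  fixes A :: "'a \<Rightarrow>\<^sub>L 'a"
  assumes "ray_like A"
  shows "\<exists>x a d. norm x = 1 \<and> a \<noteq> 0 \<and> A = a *\<^sub>R ray x + d *\<^sub>R id_blinfun"
proof (rule ccontr)
  assume "\<nexists>x a d. norm x = 1 \<and> a \<noteq> 0 \<and> A = a *\<^sub>R ray x + d *\<^sub>R id_blinfun"
  then have no: "norm x = 1 \<Longrightarrow> a \<noteq> 0 \<Longrightarrow> A \<noteq> a *\<^sub>R ray x + d *\<^sub>R id_blinfun" for x a d
    by iprover
  have "A \<in> \<D>" and nsA: "\<not> scalar_op A" using assms unfolding ray_like_def by iprover+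
  then obtain a E d where A: "A = a *\<^sub>R E + d *\<^sub>R id_blinfun" and E: "projection E"
    by (auto simp: projection_identity_combinations_def)
  have a: "a \<noteq> 0" using nsA by (auto simp: A scalar_op_def com_id)
  have comA: "com S A \<longleftrightarrow> com S E" if "S \<in> self_adjoint_ops" for S
    unfolding A by (rule com_affine_right[OF that a])
  have E0: "E \<noteq> 0"
    using nsA com_id[of _ 0] comA by (auto simp: scalar_op_def)
  have E1: "id_blinfun - E \<noteq> 0"
  proof
    assume "id_blinfun - E = 0"
    then have "E = 1 *\<^sub>R id_blinfun" by simp
    then show False using nsA com_id[of _ 1] comA by (metis scalar_op_def)
  qed
  have nE: "E \<noteq> ray x" if "norm x = 1" for x using no[OF that a] A by blast
  have nE': "id_blinfun - E \<noteq> ray x" if x: "norm x = 1" for x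
  proof
    assume "id_blinfun - E = ray x"
    then have E: "E = id_blinfun - ray x" by (simp add: algebra_simps)
    have "A = (- a) *\<^sub>R ray x + (a + d) *\<^sub>R id_blinfun" by (simp add: A E algebra_simps)
    then show False using no[OF x] a by (metis neg_equal_0_iff_equal)
  qed
  obtain u1 u2 where u: "norm u1 = 1" "norm u2 = 1" "cinner u1 u2 = 0" "E u1 = u1" "E u2 = u2"
    by (rule projection_orthonormal_pair[OF E E0 nE])
  obtain u3 u4 where v: "norm u3 = 1" "norm u4 = 1" "cinner u3 u4 = 0"
    "(id_blinfun - E) u3 = u3" "(id_blinfun - E) u4 = u4"
    by (rule projection_orthonormal_pair[OF projection_compl[OF E] E1 nE'])
  have Ev: "E u3 = 0" "E u4 = 0" using v(4,5) by (simp_all add: blinfun.bilinear_simps)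
  have cross: "cinner p q = 0" "cinner q p = 0" if "E p = p" "E q = 0" for p q
    using self_adjoint_cinner[OF projection_self_adjoint[OF E], of p q] that
    by (simp_all add: cinner_eq_0_commute[of q])
  have o: "cinner u1 u1 = 1" "cinner u2 u2 = 1" "cinner u3 u3 = 1" "cinner u4 u4 = 1"
    "cinner u2 u1 = 0" "cinner u4 u3 = 0" 
    using u v by (simp_all add: norm_eq_1_cinner cinner_eq_0_commute)
  note o = o u(3) v(3) cross[OF u(4) Ev(1)] cross[OF u(4) Ev(2)] cross[OF u(5) Ev(1)] cross[OF u(5) Ev(2)]
  define Q where "Q = ray u1 + ray u3"
  have Q: "projection Q"
    by (rule projectionI) (simp_all add: Q_def blinfun.bilinear_simps cinner_simps o)
  have R: "projection (ray u1)" by (rule projection_ray[OF u(1)])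
  have "com E Q"
  proof (rule commute_imp_com)
    show "E (Q z) = Q (E z)" for z
      using E u Ev by (simp add: Q_def blinfun.bilinear_simps self_adjoint_scaleC self_adjoint_cinner)
  qed (use E Q in simp_all)
  then have AQ: "com A Q" using comA[of Q] Q by (simp add: com_commute)
  have nsR: "\<not> scalar_op (ray u1)" by (rule ray_not_scalar[OF u(1)])
  have bi: "bicom A Q (ray u1)"
    unfolding bicom_def
  proof (intro ballI impI)
    fix S :: "'a \<Rightarrow>\<^sub>L 'a" assume S: "S \<in> self_adjoint_ops" "com S A \<and> com S Q"
    then have c: "S (E z) = E (S z)" "S (Q z) = Q (S z)" for z
      using com_imp_commute[of S] E Q comA by simp_all
    have "S u1 = S (E (Q u1))" by (simp add: Q_def blinfun.bilinear_simps o u)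
    also have "\<dots> = E (Q (S u1))" by (simp add: c)
    also have "\<dots> = cinner (S u1) u1 *\<^sub>C u1"
      using E by (simp add: Q_def blinfun.bilinear_simps self_adjoint_scaleC u Ev)
    finally show "com S (ray u1)" by (rule com_ray_eigen[OF S(1) u(1)])
  qed
  \<comment> \<open>The first superposition separates \<open>Q\<close> from \<open>ray u1\<close>.
    The second one, of \<open>u2\<close> and \<open>u4\<close>, is killed by both \<open>Q\<close>
    and \<open>ray u1\<close> but is no eigenvector of \<open>E\<close>.\<close>
  have "\<not> com Q (ray (mid u3 u4))"
    by (rule not_com_mid) (use Q v in \<open>simp_all add: Q_def blinfun.bilinear_simps o\<close>)
  moreover have "com (ray u1) (ray (mid u3 u4))"
    by (rule com_ray_eigen[of _ _ 0]) (use v in \<open>simp_all add: norm_mid, simp add: mid_def cinner_simps o\<close>)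
  ultimately have nsc: "\<not> same_com Q (ray u1)"
    unfolding same_com_def by (metis com_commute ray_self_adjoint)
  have m24: "norm (mid u2 u4) = 1" by (rule norm_mid) (use u v o in simp_all)
  have "\<not> com E (ray (mid u2 u4))"
    by (rule not_com_mid) (use E u v Ev o in simp_all)
  moreover have "com (ray u1) (ray (mid u2 u4))"
    by (rule com_ray_eigen[of _ _ 0]) (simp_all add: m24, simp add: mid_def cinner_simps o)
  moreover have "com Q (ray (mid u2 u4))"
    by (rule com_ray_eigen[of _ _ 0])
      (use Q in \<open>simp_all add: m24\<close>, simp add: Q_def blinfun.bilinear_simps mid_def cinner_simps o)
  ultimately have "\<not> bicom Q (ray u1) A"
    unfolding bicom_def using comA[of "ray (mid u2 u4)"] by (metis com_commute ray_self_adjoint)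
  then show False
    using assms AQ nsR bi nsc projection_in_D'[OF Q] projection_in_D'[OF R]
    unfolding ray_like_def by blast
qed

end

section \<open>Wigner's theorem\<close>

lemma cauchy_schwarz_equality:
  fixes x y :: "'a::complex_hilbert_space"
  assumes "cmod (cinner x y) = norm x * norm y" "y \<noteq> 0"
  shows "x = (cinner x y / cinner y y) *\<^sub>C y"
proof -
  define r where "r = residual y x"
  define c where "c = cinner x y / cinner y y"
  have x: "x = c *\<^sub>C y + r" using residual_decomp[of x y] by (simp add: c_def r_def)
  have "cinner (c *\<^sub>C y) r = 0" by (simp add: r_def cinner_simps)
  then have "(norm x)\<^sup>2 = (norm (c *\<^sub>C y))\<^sup>2 + (norm r)\<^sup>2"
    by (subst x) (rule norm_add_orth)
  moreover have "norm (c *\<^sub>C y) = norm x"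
    using assms by (simp add: norm_scaleC c_def norm_divide cinner_self power2_eq_square norm_mult)
  ultimately have "r = 0" by simp
  then show ?thesis using x by (simp add: c_def)
qed

text \<open>Phases are fixed by comparison with one vector \<open>e\<close>: on its orthogonal
  complement, \<open>e + y\<close> has an image representative of the form
  \<open>e' + \<tau> y\<close>. The map \<tau> preserves both |<y, z>| and |1 + <y, z>|, hence the
  real inner product, and is therefore real-linear; only its behaviour under \<i> remains to be
  settled.\<close>

lemma wigner_aux:
  fixes T :: "'a::complex_hilbert_space \<Rightarrow> 'a" and e :: 'a
  assumes norm_T: "\<And>x. norm (T x) = norm x"
    and cmod_T: "\<And>x y. cmod (cinner (T x) (T y)) = cmod (cinner x y)"
    and e: "norm e = 1"
  obtains U g where "g = (\<lambda>c. c) \<or> g = cnj"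
    and "\<And>x y. U (x + y) = U x + U y" "\<And>c x. U (c *\<^sub>C x) = g c *\<^sub>C U x"
    and "\<And>x y. cinner (U x) (U y) = g (cinner x y)"
    and "\<And>x. x \<noteq> 0 \<Longrightarrow> \<exists>c. U x = c *\<^sub>C T x"
proof -
  have ee: "cinner e e = 1" using e by (simp add: norm_eq_1_cinner)
  define e' where "e' = T e"
  have e': "norm e' = 1" by (simp add: e'_def norm_T e)
  then have ee': "cinner e' e' = 1" by (simp add: norm_eq_1_cinner)
  \<comment> \<open>Dividing by the product with \<open>e'\<close> makes the component along
    \<open>e'\<close> equal to 1.\<close>
  define \<sigma> where "\<sigma> y = (1 / cinner (T (e + y)) e') *\<^sub>C T (e + y)" for y
  define \<tau> where "\<tau> y = \<sigma> y - e'" for y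
  define V where "V = {y. cinner y e = 0}"
  have V: "cinner y e = 0" "cinner e y = 0" if "y \<in> V" for y
    using that by (simp_all add: V_def cinner_eq_0_commute[of e])
  have V_add: "y + z \<in> V" and V_diff: "y - z \<in> V" and V_scaleC: "c *\<^sub>C y \<in> V" and V_scaleR: "r *\<^sub>R y \<in> V"
    if "y \<in> V" "z \<in> V" for y z c r
    using that by (simp_all add: V_def cinner_simps)
  have cS: "cmod (cinner (T (e + y)) e') = 1" if "y \<in> V" for y
    using cmod_T[of "e + y" e] V[OF that] by (simp add: e'_def cinner_simps ee)
  have \<sigma>e: "cinner (\<sigma> y) e' = 1" if "y \<in> V" for y
    using cS[OF that] by (auto simp: \<sigma>_def cinner_simps)
  have \<tau>e: "cinner (\<tau> y) e' = 0" "cinner e' (\<tau> y) = 0" if "y \<in> V" for y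
    using \<sigma>e[OF that] by (simp_all add: \<tau>_def cinner_simps ee' cinner_commute[of e' "\<sigma> y"])
  have \<sigma>\<sigma>: "cmod (cinner (\<sigma> y) (\<sigma> z)) = cmod (1 + cinner y z)" if "y \<in> V" "z \<in> V" for y z
    using cmod_T[of "e + y" "e + z"] V[OF that(1)] V[OF that(2)] cS[OF that(1)] cS[OF that(2)]
    by (simp add: \<sigma>_def cinner_simps norm_mult norm_divide ee)
  have \<tau>\<tau>: "cmod (1 + cinner (\<tau> y) (\<tau> z)) = cmod (1 + cinner y z)" if "y \<in> V" "z \<in> V" for y z
  proof -
    have "cinner (\<sigma> y) (\<sigma> z) = cinner (e' + \<tau> y) (e' + \<tau> z)" by (simp add: \<tau>_def)
    also have "\<dots> = 1 + cinner (\<tau> y) (\<tau> z)"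
      using \<tau>e that by (simp add: cinner_simps ee')
    finally show ?thesis using \<sigma>\<sigma>[OF that] by simp
  qed
  have norm_\<tau>: "norm (\<tau> y) = norm y" if "y \<in> V" for y
  proof -
    have "1 + cinner (\<tau> y) (\<tau> y) = complex_of_real (1 + (norm (\<tau> y))\<^sup>2)"
      "1 + cinner y y = complex_of_real (1 + (norm y)\<^sup>2)" by (simp_all add: cinner_self)
    then have "\<bar>1 + (norm (\<tau> y))\<^sup>2\<bar> = \<bar>1 + (norm y)\<^sup>2\<bar>"
      using \<tau>\<tau>[OF that that] by (simp only: norm_of_real)
    then have "(norm (\<tau> y))\<^sup>2 = (norm y)\<^sup>2" using zero_le_power2[of "norm y"] zero_le_power2[of "norm (\<tau> y)"] by linarith
    then show ?thesis by (simp add: power2_eq_iff_nonneg)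
  qed
  have \<tau>T: "cmod (cinner (\<tau> y) (T z)) = cmod (cinner y z)" if "y \<in> V" "z \<in> V" for y z
  proof -
    have "cinner (T z) e' = 0" using cmod_T[of z e] V[OF that(2)] by (simp add: e'_def)
    then have "cinner e' (T z) = 0" by (simp add: cinner_eq_0_commute[of e'])
    then have "cmod (cinner (\<tau> y) (T z)) = cmod (cinner (\<sigma> y) (T z))" by (simp add: \<tau>_def cinner_simps)
    also have "\<dots> = cmod (cinner (e + y) z)"
      using cS[OF that(1)] by (simp add: \<sigma>_def cinner_simps norm_divide cmod_T)
    finally show ?thesis using V[OF that(2)] by (simp add: cinner_simps)
  qed
  have \<tau>par: "\<exists>c. cmod c = 1 \<and> \<tau> y = c *\<^sub>C T y" if y: "y \<in> V" for y
  proof (cases "y = 0")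
    case True
    then show ?thesis using norm_\<tau>[OF y] norm_T[of y] by (intro exI[of _ 1]) simp
  next
    case False
    then have "T y \<noteq> 0" using norm_T[of y] by auto
    then have *: "\<tau> y = (cinner (\<tau> y) (T y) / cinner (T y) (T y)) *\<^sub>C T y"
      using \<tau>T[OF y y] by (intro cauchy_schwarz_equality) (simp_all add: norm_\<tau>[OF y] norm_T cinner_self power2_eq_square norm_mult)
    moreover have "cmod (cinner (\<tau> y) (T y) / cinner (T y) (T y)) = 1"
      using \<tau>T[OF y y] False by (simp add: norm_divide cinner_self norm_T)
    ultimately show ?thesis by blast
  qed
  have cmod_\<tau>: "cmod (cinner (\<tau> y) (\<tau> z)) = cmod (cinner y z)" if yz: "y \<in> V" "z \<in> V" for y z
  proof -
    obtain c where "cmod c = 1" "\<tau> z = c *\<^sub>C T z" using \<tau>par[OF yz(2)] by blast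
    then show ?thesis using \<tau>T[OF yz] by (simp add: cinner_simps norm_mult)
  qed
  have inner_\<tau>: "inner (\<tau> y) (\<tau> z) = inner y z" if yz: "y \<in> V" "z \<in> V" for y z
  proof -
    have "(cmod (1 + w))\<^sup>2 = 1 + 2 * Re w + (cmod w)\<^sup>2" for w
      unfolding cmod_power2 by (simp add: power2_eq_square algebra_simps)
    from this[of "cinner (\<tau> y) (\<tau> z)"] this[of "cinner y z"]
    show ?thesis using \<tau>\<tau>[OF yz] cmod_\<tau>[OF yz] by (simp add: inner_Re_cinner)
  qed
  have \<tau>_add: "\<tau> (y + z) = \<tau> y + \<tau> z" if "y \<in> V" "z \<in> V" for y z
  proof -
    \<comment> \<open>Expanded, the squared norm of the defect contains only preserved products, so
      it equals that of (y + z) - y - z.\<close>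
    have "inner (\<tau> (y + z) - \<tau> y - \<tau> z) (\<tau> (y + z) - \<tau> y - \<tau> z) = 0"
      using that V_add by (simp add: inner_diff_left inner_diff_right inner_add_left inner_add_right inner_\<tau>)
    then have "\<tau> (y + z) - \<tau> y - \<tau> z = 0" by (simp only: inner_eq_zero_iff)
    then show ?thesis by (simp add: algebra_simps)
  qed
  have \<tau>_scaleR: "\<tau> (r *\<^sub>R y) = r *\<^sub>R \<tau> y" if "y \<in> V" for y r
  proof -
    have "inner (\<tau> (r *\<^sub>R y) - r *\<^sub>R \<tau> y) (\<tau> (r *\<^sub>R y) - r *\<^sub>R \<tau> y) = 0"
      using that V_scaleR[OF that that] by (simp add: inner_diff_left inner_diff_right inner_\<tau>)
    then show ?thesis by simp
  qed
  have \<tau>_i: "\<tau> (\<i> *\<^sub>C y) = \<i> *\<^sub>C \<tau> y \<or> \<tau> (\<i> *\<^sub>C y) = (- \<i>) *\<^sub>C \<tau> y" if y: "y \<in> V" for y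
  proof (cases "y = 0")
    case True
    then have "\<tau> y = 0" using norm_\<tau>[OF y] by simp
    then show ?thesis using True by simp
  next
    case False
    have iy: "\<i> *\<^sub>C y \<in> V" by (rule V_scaleC[OF y y])
    let ?c = "cinner (\<tau> (\<i> *\<^sub>C y)) (\<tau> y)"
    have ny: "\<tau> y \<noteq> 0" using norm_\<tau>[OF y] False by auto
    have "Re ?c = 0" using inner_\<tau>[OF iy y] by (simp add: inner_Re_cinner cinner_simps cinner_self)
    moreover have cm: "cmod ?c = (norm y)\<^sup>2"
      using cmod_\<tau>[OF iy y] by (simp add: cinner_simps norm_mult cinner_self norm_power)
    ultimately have "Im ?c = (norm y)\<^sup>2 \<or> Im ?c = - (norm y)\<^sup>2"
      by (simp add: cmod_eq_Im abs_eq_iff')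
    then have "?c = \<i> * (norm y)\<^sup>2 \<or> ?c = - \<i> * (norm y)\<^sup>2"
      using \<open>Re ?c = 0\<close> by (simp add: complex_eq_iff)
    moreover have "\<tau> (\<i> *\<^sub>C y) = (?c / cinner (\<tau> y) (\<tau> y)) *\<^sub>C \<tau> y"
      by (rule cauchy_schwarz_equality)
        (use cm ny in \<open>simp_all add: norm_\<tau>[OF iy] norm_\<tau>[OF y] norm_scaleC power2_eq_square\<close>)
    moreover have "cinner (\<tau> y) (\<tau> y) = (norm y)\<^sup>2" by (simp add: cinner_self norm_\<tau>[OF y])
    ultimately show ?thesis using False by auto
  qed
  \<comment> \<open>If the sign varied, the sum of a vector of each kind would be of neither
    kind.\<close>
  have "(\<forall>y\<in>V. \<tau> (\<i> *\<^sub>C y) = \<i> *\<^sub>C \<tau> y) \<or> (\<forall>y\<in>V. \<tau> (\<i> *\<^sub>C y) = (- \<i>) *\<^sub>C \<tau> y)"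
  proof (rule ccontr)
    assume "\<not> ?thesis"
    then obtain u v where uv: "u \<in> V" "v \<in> V" "\<tau> (\<i> *\<^sub>C u) \<noteq> \<i> *\<^sub>C \<tau> u" "\<tau> (\<i> *\<^sub>C v) \<noteq> (- \<i>) *\<^sub>C \<tau> v"
      by blast
    have "\<tau> (\<i> *\<^sub>C (u + v)) = \<tau> (\<i> *\<^sub>C u) + \<tau> (\<i> *\<^sub>C v)"
      using uv V_scaleC by (simp add: scaleC_add_right \<tau>_add)
    moreover have "\<tau> (u + v) = \<tau> u + \<tau> v" using uv by (simp add: \<tau>_add)
    ultimately show False
      using uv(3,4) \<tau>_i[OF uv(1)] \<tau>_i[OF uv(2)] \<tau>_i[OF V_add[OF uv(1,2)]]
      by (auto simp: scaleC_add_right)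
  qed
  then obtain g where g: "g = (\<lambda>c. c) \<or> g = cnj" and gi: "\<And>y. y \<in> V \<Longrightarrow> \<tau> (\<i> *\<^sub>C y) = g \<i> *\<^sub>C \<tau> y"
    by (metis complex_cnj_i)
  have g_simps: "g (a + b) = g a + g b" "g (a * b) = g a * g b" "g (complex_of_real r) = complex_of_real r"
    "g (cnj a) = cnj (g a)" "g 0 = 0" "g 1 = 1" for a b r
    using g by auto
  have \<tau>_scaleC: "\<tau> (c *\<^sub>C y) = g c *\<^sub>C \<tau> y" if y: "y \<in> V" for c y
  proof -
    have c: "c = complex_of_real (Re c) + complex_of_real (Im c) * \<i>" by (simp add: complex_eq_iff)
    have iy: "\<i> *\<^sub>C y \<in> V" by (rule V_scaleC[OF y y])
    have "c *\<^sub>C y = Re c *\<^sub>R y + Im c *\<^sub>R (\<i> *\<^sub>C y)"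
      by (subst c) (simp add: scaleC_add_left scaleR_scaleC scaleC_scaleC)
    then have "\<tau> (c *\<^sub>C y) = Re c *\<^sub>R \<tau> y + Im c *\<^sub>R (g \<i> *\<^sub>C \<tau> y)"
      using y iy V_scaleR by (simp add: \<tau>_add \<tau>_scaleR gi)
    also have "\<dots> = g (complex_of_real (Re c) + complex_of_real (Im c) * \<i>) *\<^sub>C \<tau> y"
      by (simp add: g_simps scaleC_add_left scaleR_scaleC scaleC_scaleC)
    finally show ?thesis using c by simp
  qed
  have cinner_\<tau>: "cinner (\<tau> y) (\<tau> z) = g (cinner y z)" if yz: "y \<in> V" "z \<in> V" for y z
  proof -
    have iz: "\<i> *\<^sub>C z \<in> V" by (rule V_scaleC[OF yz(2) yz(2)])
    have re: "Re (cinner (\<tau> y) (\<tau> z)) = Re (cinner y z)"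
      using inner_\<tau>[OF yz] by (simp add: inner_Re_cinner)
    have "Re (cinner (\<tau> y) (\<tau> (\<i> *\<^sub>C z))) = Re (cinner y (\<i> *\<^sub>C z))"
      using inner_\<tau>[OF yz(1) iz] by (simp add: inner_Re_cinner)
    then have "Re (cnj (g \<i>) * cinner (\<tau> y) (\<tau> z)) = Im (cinner y z)"
      by (simp add: gi[OF yz(2)] cinner_simps)
    with re show ?thesis using g by (auto simp: complex_eq_iff)
  qed
  define p where "p x = x - cinner x e *\<^sub>C e" for x
  have pV: "p x \<in> V" for x by (simp add: p_def V_def cinner_simps ee)
  have dec: "x = cinner x e *\<^sub>C e + p x" for x by (simp add: p_def)
  define U where "U x = g (cinner x e) *\<^sub>C e' + \<tau> (p x)" for x
  show thesis
  proof (rule that[of g U])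
    show "g = (\<lambda>c. c) \<or> g = cnj" by (rule g)
    show "U (x + y) = U x + U y" for x y
    proof -
      have "p (x + y) = p x + p y" by (simp add: p_def cinner_simps scaleC_add_left)
      then show ?thesis by (simp add: U_def \<tau>_add pV cinner_simps g_simps scaleC_add_left)
    qed
    show "U (c *\<^sub>C x) = g c *\<^sub>C U x" for c x
    proof -
      have "p (c *\<^sub>C x) = c *\<^sub>C p x"
        by (simp add: p_def cinner_simps scaleC_scaleC complex_vector.scale_right_diff_distrib)
      then show ?thesis by (simp add: U_def \<tau>_scaleC pV cinner_simps g_simps scaleC_add_right scaleC_scaleC)
    qed
    show "cinner (U x) (U y) = g (cinner x y)" for x y
    proof -
      have "cinner x y = cinner (cinner x e *\<^sub>C e + p x) (cinner y e *\<^sub>C e + p y)"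
        by (simp add: p_def)
      also have "\<dots> = cinner x e * cnj (cinner y e) + cinner (p x) (p y)"
        by (simp add: cinner_simps ee V pV)
      finally show ?thesis
        by (simp add: U_def cinner_simps ee' \<tau>e pV cinner_\<tau> g_simps)
    qed
    show "\<exists>c. U x = c *\<^sub>C T x" if "x \<noteq> 0" for x
    proof (cases "cinner x e = 0")
      case True
      then have "p x = x" "x \<in> V" by (simp_all add: p_def V_def)
      then show ?thesis using \<tau>par[of x] True by (auto simp: U_def g_simps)
    next
      case False
      define a where "a = cinner x e"
      have a: "a \<noteq> 0" using False by (simp add: a_def)
      \<comment> \<open>Off the complement of \<open>e\<close>, \<open>x\<close> is a multiple of
        some \<open>e + y\<close>, to which the normalisation of \<sigma> applies.\<close>
      define y where "y = (1 / a) *\<^sub>C p x"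
      have y: "y \<in> V" unfolding y_def by (rule V_scaleC[OF pV pV])
      have py: "p x = a *\<^sub>C y" using a by (simp add: y_def scaleC_scaleC)
      have x: "x = a *\<^sub>C (e + y)" using dec[of x] by (simp add: py a_def[symmetric] scaleC_add_right)
      have "U x = g a *\<^sub>C (e' + \<tau> y)"
        by (simp add: U_def py \<tau>_scaleC[OF y] a_def[symmetric] scaleC_add_right)
      then have "U x = g a *\<^sub>C \<sigma> y" by (simp add: \<tau>_def)
      moreover have "\<exists>d. T (e + y) = d *\<^sub>C T x"
      proof -
        have "cmod (cinner (T (e + y)) (T x)) = norm (T (e + y)) * norm (T x)"
          using cmod_T[of "e + y" x] by (simp add: norm_T x cinner_scaleC_right norm_mult norm_scaleC
              cinner_self norm_power power2_eq_square)
        moreover have "T x \<noteq> 0" using norm_T[of x] \<open>x \<noteq> 0\<close> by auto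
        ultimately show ?thesis using cauchy_schwarz_equality by blast
      qed
      ultimately show ?thesis by (metis \<sigma>_def scaleC_scaleC)
    qed
  qed
qed

lemma wigner:
  fixes T :: "'a::complex_hilbert_space \<Rightarrow> 'a" and e :: 'a
  assumes norm_T: "\<And>x. norm x = 1 \<Longrightarrow> norm (T x) = 1"
    and cmod_T: "\<And>x y. norm x = 1 \<Longrightarrow> norm y = 1 \<Longrightarrow> cmod (cinner (T x) (T y)) = cmod (cinner x y)"
    and surj_T: "\<And>u. norm u = 1 \<Longrightarrow> \<exists>x. norm x = 1 \<and> cmod (cinner u (T x)) = 1"
    and e: "norm e = 1"
  obtains U g where "g = (\<lambda>c. c) \<or> g = cnj"
    and "\<And>x y. U (x + y) = U x + U y" "\<And>c x. U (c *\<^sub>C x) = g c *\<^sub>C U x"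
    and "\<And>x y. cinner (U x) (U y) = g (cinner x y)" "surj U"
    and "\<And>x. norm x = 1 \<Longrightarrow> \<exists>c. U x = c *\<^sub>C T x"
proof -
  \<comment> \<open>The images of unit vectors are all that is given; the positively homogeneous
    extension meets the hypotheses of \<open>wigner_aux\<close>.\<close>
  define T' where "T' x = norm x *\<^sub>R T ((1 / norm x) *\<^sub>R x)" for x
  have unit: "norm ((1 / norm x) *\<^sub>R x) = 1" if "x \<noteq> 0" for x :: 'a using that by simp
  have norm_T': "norm (T' x) = norm x" for x
    using norm_T[OF unit] by (cases "x = 0") (simp_all add: T'_def)
  have cmod_T': "cmod (cinner (T' x) (T' y)) = cmod (cinner x y)" for x y
  proof (cases "x = 0 \<or> y = 0")
    case False
    then show ?thesis
      using cmod_T[OF unit unit, of x y] by (simp add: T'_def cinner_simps norm_mult norm_divide)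
  qed (auto simp: T'_def)
  obtain U g where g: "g = (\<lambda>c. c) \<or> g = cnj"
    and U: "\<And>x y. U (x + y) = U x + U y" "\<And>c x. U (c *\<^sub>C x) = g c *\<^sub>C U x"
      "\<And>x y. cinner (U x) (U y) = g (cinner x y)"
    and par: "\<And>x. x \<noteq> 0 \<Longrightarrow> \<exists>c. U x = c *\<^sub>C T' x"
    by (rule wigner_aux[OF norm_T' cmod_T' e]) blast
  have par1: "\<exists>c. U x = c *\<^sub>C T x" if "norm x = 1" for x
  proof -
    have "T' x = T x" "x \<noteq> 0" using that by (auto simp: T'_def)
    then show ?thesis using par by metis
  qed
  have gg: "g (g c) = c" for c using g by auto
  have "\<exists>x. u = U x" for u
  proof (cases "u = 0")
    case True
    have "U 0 = 0" using U(1)[of 0 0] by simp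
    then show ?thesis using True by metis
  next
    case False
    then obtain r where r: "r > 0" "norm (r *\<^sub>R u) = 1" by (rule normalize_vec)
    obtain x where x: "norm x = 1" "cmod (cinner (r *\<^sub>R u) (T x)) = 1" using surj_T[OF r(2)] by blast
    have Tx: "norm (T x) = 1" by (rule norm_T[OF x(1)])
    obtain c where c: "r *\<^sub>R u = c *\<^sub>C T x"
      using cauchy_schwarz_equality[of "r *\<^sub>R u" "T x"] x r Tx by force
    obtain d where d: "U x = d *\<^sub>C T x" using par1[OF x(1)] by blast
    have "cinner (U x) (U x) = 1" using U(3)[of x x] x(1) g by (auto simp: norm_eq_1_cinner)
    then have "d \<noteq> 0" using d by auto
    \<comment> \<open>\<open>U\<close> may be conjugate-linear; as \<open>g\<close> is an
      involution, the preimage needs the scalar \<open>g (c / d)\<close>.\<close>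
    then have "U (g (c / d) *\<^sub>C x) = r *\<^sub>R u" by (simp add: U(2) gg d c scaleC_scaleC)
    then have "complex_of_real (1 / r) *\<^sub>C U (g (c / d) *\<^sub>C x) = u"
      using r(1) scaleR_scaleC[of "1 / r" "r *\<^sub>R u"] by simp
    then show ?thesis by (metis U(2) gg)
  qed
  then have "surj U" unfolding surj_def by blast
  show thesis by (rule that[OF g U \<open>surj U\<close> par1])
qed

section \<open>The induced map on rank-one projections\<close>

definition trans_prob :: "'a::complex_hilbert_space \<Rightarrow> 'a \<Rightarrow> real" where
  "trans_prob x y = (cmod (cinner x y))\<^sup>2"

lemma trans_prob_commute: "trans_prob x y = trans_prob y x"
  unfolding trans_prob_def by (subst cinner_commute) simp

lemma trans_prob_nonneg: "0 \<le> trans_prob x y"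
  by (simp add: trans_prob_def)

lemma trans_prob_self: "norm x = 1 \<Longrightarrow> trans_prob x x = 1"
  by (simp add: trans_prob_def cinner_self)

lemma trans_prob_eq_0_iff: "trans_prob x y = 0 \<longleftrightarrow> cinner x y = 0"
  by (simp add: trans_prob_def)

lemma trans_prob_mid:
  assumes "norm p = 1" "norm q = 1" "cinner p q = 0"
  shows "trans_prob (mid p q) p = 1 / 2" "trans_prob (mid p q) q = 1 / 2"
proof -
  have "cinner p p = 1" "cinner q q = 1" "cinner q p = 0"
    using assms by (simp_all add: norm_eq_1_cinner cinner_eq_0_commute)
  then show "trans_prob (mid p q) p = 1 / 2" "trans_prob (mid p q) q = 1 / 2"
    using assms by (simp_all add: trans_prob_def mid_def cinner_simps norm_divide power_divide)
qed

lemma trans_prob_1_parallel: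
  assumes "norm x = 1" "norm y = 1" "trans_prob x y = 1"
  obtains c where "cmod c = 1" "x = c *\<^sub>C y"
proof -
  have c1: "cmod (cinner x y) = 1"
    using assms(3) norm_ge_zero[of "cinner x y"] unfolding trans_prob_def power2_eq_1_iff by linarith
  moreover have "y \<noteq> 0" using assms(2) by auto
  then have "x = cinner x y *\<^sub>C y"
    using cauchy_schwarz_equality[of x y] assms(1,2) c1 by (simp add: cinner_self)
  ultimately show thesis by (rule that)
qed

lemma trans_prob_1_ray_eq:
  assumes "norm x = 1" "norm y = 1" "trans_prob x y = 1"
  shows "ray x = ray y"
proof -
  obtain c where c: "cmod c = 1" "x = c *\<^sub>C y" by (rule trans_prob_1_parallel[OF assms])
  have "cnj c * c = 1" using c(1) complex_norm_square[of c] by (simp add: mult.commute)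
  then show ?thesis
    by (intro blinfun_eqI) (simp add: c(2) cinner_simps scaleC_scaleC mult.commute mult.left_commute)
qed

lemma trans_prob_cong_left: "cmod c = 1 \<Longrightarrow> trans_prob (c *\<^sub>C x) y = trans_prob x y"
  by (simp add: trans_prob_def cinner_simps norm_mult)

lemma variance_ray': "norm y = 1 \<Longrightarrow> variance (ray y) x = trans_prob x y - (trans_prob x y)\<^sup>2"
  by (simp add: variance_ray trans_prob_def)

lemma variance_affine:
  assumes "A \<in> self_adjoint_ops" "norm x = 1"
  shows "variance (a *\<^sub>R A + d *\<^sub>R id_blinfun) x = a\<^sup>2 * variance A x"
  by (rule variance_scale) (use assms in \<open>simp_all add: comm_range_affine_left\<close>)

context dim_at_least_3
begin

text \<open>Commuting rays are equal or orthogonal. For orthogonal ones a third direction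
  \<open>w\<close> gives \<open>mid u w\<close>, an eigenvector of \<open>ray v\<close> but not of
  \<open>ray u\<close>; in dimension two, orthogonal rays are complementary and would have the same
  commutant.\<close>

lemma same_com_ray:
  fixes u v :: 'a
  assumes u: "norm u = 1" and v: "norm v = 1" and same: "same_com (ray u) (ray v)"
  shows "trans_prob u v = 1"
proof -
  have "com (ray u) (ray u)" by (simp add: com_iff_Im cinner_self)
  then have "com (ray u) (ray v)" using same by (simp add: same_com_def)
  then have "variance (ray u) v = 0" by (simp add: com_ray_iff(1) v)
  then have "trans_prob v u * (1 - trans_prob v u) = 0"
    by (simp add: variance_ray' u algebra_simps power2_eq_square)
  then have "trans_prob u v = 0 \<or> trans_prob u v = 1" by (auto simp: trans_prob_commute)
  moreover have "trans_prob u v \<noteq> 0"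
  proof
    assume "trans_prob u v = 0"
    then have uv: "cinner u v = 0" by (simp add: trans_prob_eq_0_iff)
    obtain w where w: "norm w = 1" "cinner w u = 0" "cinner w v = 0" by (rule ex_unit_orthogonal)
    then have uw: "cinner u w = 0" by (simp add: cinner_eq_0_commute)
    have "\<not> com (ray u) (ray (mid u w))"
      by (rule not_com_mid) (use u w uw in \<open>simp_all add: norm_eq_1_cinner\<close>)
    moreover have "com (ray v) (ray (mid u w))"
      by (rule com_ray_eigen[of _ _ 0])
        (use u w uw uv in \<open>simp_all add: norm_mid\<close>, simp add: mid_def cinner_simps)
    ultimately show False using same unfolding same_com_def by (metis com_commute ray_self_adjoint)
  qed
  ultimately show ?thesis by blast
qed

end

section \<open>Action of a preserver on rays\<close>

locale commutator_range_preserver = dim_at_least_3 dummy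
  for dummy :: "'a::complex_hilbert_space itself" +
  fixes \<Phi> :: "('a \<Rightarrow>\<^sub>L 'a) \<Rightarrow> ('a \<Rightarrow>\<^sub>L 'a)"
  assumes surjective: "\<Phi> ` self_adjoint_ops = self_adjoint_ops"
    and preserves: "A \<in> self_adjoint_ops \<Longrightarrow> B \<in> self_adjoint_ops \<Longrightarrow>
      comm_range A B = comm_range (\<Phi> A) (\<Phi> B)"
begin

lemma image_self_adjoint [simp]: "A \<in> self_adjoint_ops \<Longrightarrow> \<Phi> A \<in> self_adjoint_ops"
  using surjective by blast

lemma ball_image: "(\<forall>S\<in>self_adjoint_ops. P S) \<longleftrightarrow> (\<forall>S\<in>self_adjoint_ops. P (\<Phi> S))"
  using surjective by (metis (no_types, lifting) imageE image_self_adjoint)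

lemma com_image: "A \<in> self_adjoint_ops \<Longrightarrow> B \<in> self_adjoint_ops \<Longrightarrow> com (\<Phi> A) (\<Phi> B) \<longleftrightarrow> com A B"
  unfolding com_def by (metis preserves)

lemma projection_identity_image:
  assumes A: "A \<in> self_adjoint_ops"
  shows "\<Phi> A \<in> \<D> \<longleftrightarrow> A \<in> \<D>"
proof -
  have "\<Phi> A \<in> \<D> \<longleftrightarrow> (\<forall>B\<in>self_adjoint_ops. sym_range (\<Phi> A) (\<Phi> B))"
    unfolding projection_identity_iff_sym_range[OF image_self_adjoint[OF A]] by (rule ball_image)
  also have "\<dots> \<longleftrightarrow> (\<forall>B\<in>self_adjoint_ops. sym_range A B)"
    unfolding sym_range_def using preserves[OF A] by auto
  also have "\<dots> \<longleftrightarrow> A \<in> \<D>" by (rule projection_identity_iff_sym_range[OF A, symmetric])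
  finally show ?thesis .
qed

lemma ray_like_image:
  assumes A: "A \<in> self_adjoint_ops"
  shows "ray_like (\<Phi> A) \<longleftrightarrow> ray_like A"
proof -
  have sc: "scalar_op (\<Phi> B) \<longleftrightarrow> scalar_op B" if "B \<in> self_adjoint_ops" for B
    unfolding scalar_op_def by (subst ball_image) (simp add: com_image that)
  have bi: "bicom (\<Phi> B) (\<Phi> C) (\<Phi> E) \<longleftrightarrow> bicom B C E"
    if "B \<in> self_adjoint_ops" "C \<in> self_adjoint_ops" "E \<in> self_adjoint_ops" for B C E
    unfolding bicom_def by (subst ball_image) (simp add: com_image that)
  have sa: "same_com (\<Phi> B) (\<Phi> C) \<longleftrightarrow> same_com B C"
    if "B \<in> self_adjoint_ops" "C \<in> self_adjoint_ops" for B C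
    unfolding same_com_def by (subst ball_image) (simp add: com_image that)
  \<comment> \<open>As \<open>\<D>\<close> consists of self-adjoint operators, the quantifiers may
    run over all of these, where surjectivity allows the substitution of images.\<close>
  have rl: "ray_like B \<longleftrightarrow> B \<in> \<D> \<and> \<not> scalar_op B \<and>
    (\<forall>Q\<in>self_adjoint_ops. Q \<in> \<D> \<longrightarrow> com B Q \<longrightarrow> (\<forall>R\<in>self_adjoint_ops. R \<in> \<D> \<longrightarrow> \<not> scalar_op R \<longrightarrow>
       bicom B Q R \<longrightarrow> \<not> same_com Q R \<longrightarrow> bicom Q R B))" for B :: "'a \<Rightarrow>\<^sub>L 'a"
    unfolding ray_like_def using projection_identity_self_adjoint by blast
  show ?thesis
    unfolding rl[of "\<Phi> A"]
    apply (subst ball_image)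
    apply (subst (2) ball_image)
    unfolding rl[of A]
    using A by (simp add: sc bi sa projection_identity_image com_image)
qed

lemma ray_image_exists:
  assumes "norm x = 1"
  shows "\<exists>y a d. norm y = 1 \<and> a \<noteq> 0 \<and> \<Phi> (ray x) = a *\<^sub>R ray y + d *\<^sub>R id_blinfun"
proof -
  have "ray_like (ray x)" using ray_like_ray[OF assms, of 1 0] by simp
  then show ?thesis by (intro ray_like_imp_ray) (simp add: ray_like_image)
qed

text \<open>The choice depends on the operator and not on a vector, so unit vectors spanning the
  same line receive the very same image; \<open>img_eq\<close> rests on this.\<close>

definition ray_vec :: "('a \<Rightarrow>\<^sub>L 'a) \<Rightarrow> 'a" where
  "ray_vec B = (SOME y. norm y = 1 \<and> (\<exists>a d. a \<noteq> 0 \<and> B = a *\<^sub>R ray y + d *\<^sub>R id_blinfun))"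

definition img :: "'a \<Rightarrow> 'a" where
  "img x = ray_vec (\<Phi> (ray x))"

lemma img:
  assumes "norm x = 1"
  shows "norm (img x) = 1" "\<exists>a d. a \<noteq> 0 \<and> \<Phi> (ray x) = a *\<^sub>R ray (img x) + d *\<^sub>R id_blinfun"
proof -
  have "\<exists>y. norm y = 1 \<and> (\<exists>a d. a \<noteq> 0 \<and> \<Phi> (ray x) = a *\<^sub>R ray y + d *\<^sub>R id_blinfun)"
    using ray_image_exists[OF assms] by blast
  from someI_ex[OF this] show "norm (img x) = 1"
    "\<exists>a d. a \<noteq> 0 \<and> \<Phi> (ray x) = a *\<^sub>R ray (img x) + d *\<^sub>R id_blinfun"
    unfolding img_def ray_vec_def by blast+
qed

definition coef :: "'a \<Rightarrow> real" where
  "coef x = (SOME a. a \<noteq> 0 \<and> (\<exists>d. \<Phi> (ray x) = a *\<^sub>R ray (img x) + d *\<^sub>R id_blinfun))"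

lemma coef:
  assumes "norm x = 1"
  shows "coef x \<noteq> 0" "\<exists>d. \<Phi> (ray x) = coef x *\<^sub>R ray (img x) + d *\<^sub>R id_blinfun"
proof -
  have "\<exists>a. a \<noteq> 0 \<and> (\<exists>d. \<Phi> (ray x) = a *\<^sub>R ray (img x) + d *\<^sub>R id_blinfun)"
    using img(2)[OF assms] by blast
  from someI_ex[OF this] show "coef x \<noteq> 0" "\<exists>d. \<Phi> (ray x) = coef x *\<^sub>R ray (img x) + d *\<^sub>R id_blinfun"
    unfolding coef_def by blast+
qed

lemma variance_image:
  assumes A: "A \<in> self_adjoint_ops" and x: "norm x = 1"
  shows "variance A x = (coef x)\<^sup>2 * variance (\<Phi> A) (img x)"
proof -
  obtain d where d: "\<Phi> (ray x) = coef x *\<^sub>R ray (img x) + d *\<^sub>R id_blinfun" using coef(2)[OF x] by blast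
  have "comm_range A (ray x) = (*) (coef x) ` comm_range (\<Phi> A) (ray (img x))"
    using preserves[OF A ray_self_adjoint, of x] A unfolding d by (simp add: comm_range_affine_right)
  then show ?thesis
    by (intro variance_scale) (use A x img(1) in auto)
qed

lemma com_image_ray:
  assumes "S \<in> self_adjoint_ops" "norm x = 1"
  shows "com (\<Phi> S) (ray (img x)) \<longleftrightarrow> com S (ray x)"
  using variance_image[OF assms] assms img(1)[OF assms(2)] coef(1)[OF assms(2)]
  by (simp add: com_ray_iff(1))

text \<open>The variance of one ray at another is p - p^2. Each of the two rays contributes its own
  squared slope.\<close>

lemma trans_prob_image:
  assumes x: "norm x = 1" and y: "norm y = 1"
  shows "trans_prob x y - (trans_prob x y)\<^sup>2
    = (coef x)\<^sup>2 * (coef y)\<^sup>2 * (trans_prob (img x) (img y) - (trans_prob (img x) (img y))\<^sup>2)"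
proof -
  obtain d where d: "\<Phi> (ray y) = coef y *\<^sub>R ray (img y) + d *\<^sub>R id_blinfun" using coef(2)[OF y] by blast
  have "variance (ray y) x = (coef x)\<^sup>2 * ((coef y)\<^sup>2 * variance (ray (img y)) (img x))"
    unfolding variance_image[OF ray_self_adjoint x] d
    by (subst variance_affine) (simp_all add: img x)
  then show ?thesis by (simp add: variance_ray' y img mult.assoc)
qed

lemma img_eq: "norm x = 1 \<Longrightarrow> norm y = 1 \<Longrightarrow> trans_prob x y = 1 \<Longrightarrow> img x = img y"
  unfolding img_def using trans_prob_1_ray_eq by metis

lemma img_inj:
  assumes x: "norm x = 1" and y: "norm y = 1" and eq: "trans_prob (img x) (img y) = 1"
  shows "trans_prob x y = 1"
proof (rule same_com_ray[OF x y])
  have "ray (img x) = ray (img y)" by (intro trans_prob_1_ray_eq img x y eq)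
  then show "same_com (ray x) (ray y)"
    unfolding same_com_def using com_image_ray[OF _ x] com_image_ray[OF _ y] by metis
qed

lemma img_surj:
  assumes u: "norm u = 1"
  obtains x where "norm x = 1" "trans_prob u (img x) = 1"
proof -
  obtain A where A: "A \<in> self_adjoint_ops" "\<Phi> A = ray u" using surjective by (metis imageE ray_self_adjoint)
  have "ray_like (ray u)" using ray_like_ray[OF u, of 1 0] by simp
  then have "ray_like A" using ray_like_image[OF A(1)] A(2) by simp
  from ray_like_imp_ray[OF this] obtain x a d where x: "norm x = 1" "a \<noteq> 0"
    "A = a *\<^sub>R ray x + d *\<^sub>R id_blinfun" by blast
  have "com (\<Phi> S) (ray u) \<longleftrightarrow> com (\<Phi> S) (ray (img x))" if S: "S \<in> self_adjoint_ops" for S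
  proof -
    have "com (\<Phi> S) (ray u) \<longleftrightarrow> com S A" using com_image[OF S A(1)] A(2) by simp
    also have "\<dots> \<longleftrightarrow> com S (ray x)" unfolding x(3) by (rule com_affine_right[OF S x(2)])
    also have "\<dots> \<longleftrightarrow> com (\<Phi> S) (ray (img x))" using com_image_ray[OF S x(1)] by simp
    finally show ?thesis .
  qed
  then have "same_com (ray u) (ray (img x))" unfolding same_com_def by (subst ball_image) simp
  then show thesis using that[of x] same_com_ray u x(1) img(1) by blast
qed

lemma trans_prob_0_1:
  "(t::real) - t\<^sup>2 = 0 \<longleftrightarrow> t = 0 \<or> t = 1"
proof -
  have "t - t\<^sup>2 = t * (1 - t)" by (simp add: power2_eq_square algebra_simps)
  then show ?thesis by auto
qed

text \<open>Since the slopes are nonzero, p - p^2 vanishes on both sides together. This preserves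
  the alternative p = 0 or p = 1, and the case p = 1 is already preserved as equality of
  rays.\<close>

lemma img_orthogonal:
  assumes x: "norm x = 1" and y: "norm y = 1"
  shows "cinner (img x) (img y) = 0 \<longleftrightarrow> cinner x y = 0"
proof -
  have "trans_prob x y = 0 \<or> trans_prob x y = 1 \<longleftrightarrow>
      trans_prob (img x) (img y) = 0 \<or> trans_prob (img x) (img y) = 1"
    unfolding trans_prob_0_1[symmetric] using trans_prob_image[OF x y] coef(1)[OF x] coef(1)[OF y] by auto
  moreover have "trans_prob x y = 1 \<longleftrightarrow> trans_prob (img x) (img y) = 1"
    using img_inj[OF x y] img_eq[OF x y] trans_prob_self[OF img(1)[OF y]] by auto
  ultimately have "trans_prob (img x) (img y) = 0 \<longleftrightarrow> trans_prob x y = 0" by auto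
  then show ?thesis by (simp add: trans_prob_eq_0_iff)
qed

text \<open>The image of \<open>z\<close> stays in the span of the images of the triple. By
  surjectivity a nonzero residual \<open>r\<close> would be parallel to some \<open>img w\<close>;
  then \<open>w\<close> is orthogonal to the triple, hence to \<open>z\<close>, and \<open>r\<close>
  is orthogonal to \<open>img z\<close>, although <r, r> = <r, img z>.\<close>

lemma img_trans_prob_sum:
  assumes unit: "norm e\<^sub>1 = 1" "norm e\<^sub>2 = 1" "norm e\<^sub>3 = 1"
    and orth: "cinner e\<^sub>1 e\<^sub>2 = 0" "cinner e\<^sub>1 e\<^sub>3 = 0" "cinner e\<^sub>2 e\<^sub>3 = 0"
    and z: "norm z = 1" "z = a *\<^sub>C e\<^sub>1 + b *\<^sub>C e\<^sub>2 + c *\<^sub>C e\<^sub>3"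
  shows "trans_prob (img z) (img e\<^sub>1) + trans_prob (img z) (img e\<^sub>2) + trans_prob (img z) (img e\<^sub>3) = 1"
proof -
  let ?z = "img z" and ?e1 = "img e\<^sub>1" and ?e2 = "img e\<^sub>2" and ?e3 = "img e\<^sub>3"
  have o: "cinner ?e1 ?e2 = 0" "cinner ?e1 ?e3 = 0" "cinner ?e2 ?e3 = 0"
    using img_orthogonal unit orth by auto
  have o': "cinner ?e2 ?e1 = 0" "cinner ?e3 ?e1 = 0" "cinner ?e3 ?e2 = 0"
    using o by (simp_all add: cinner_eq_0_commute)
  have n: "cinner ?e1 ?e1 = 1" "cinner ?e2 ?e2 = 1" "cinner ?e3 ?e3 = 1" "cinner ?z ?z = 1"
    using img(1) unit z by (simp_all add: norm_eq_1_cinner)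
  define r where "r = ?z - cinner ?z ?e1 *\<^sub>C ?e1 - cinner ?z ?e2 *\<^sub>C ?e2 - cinner ?z ?e3 *\<^sub>C ?e3"
  have re: "cinner r ?e1 = 0" "cinner r ?e2 = 0" "cinner r ?e3 = 0"
    by (simp_all add: r_def cinner_simps n o o')
  have "r = 0"
  proof (rule ccontr)
    assume "r \<noteq> 0"
    then obtain s where s: "s > 0" "norm (s *\<^sub>R r) = 1" by (rule normalize_vec)
    obtain w where w: "norm w = 1" "trans_prob (s *\<^sub>R r) (img w) = 1" using img_surj[OF s(2)] by blast
    obtain k where k: "s *\<^sub>R r = k *\<^sub>C img w" "cmod k = 1"
      using trans_prob_1_parallel[OF s(2) img(1)[OF w(1)] w(2)] by blast
    have k0: "k \<noteq> 0" using k(2) by auto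
    have *: "cinner (img w) v = 0 \<longleftrightarrow> cinner r v = 0" for v
    proof -
      have "complex_of_real s * cinner r v = k * cinner (img w) v"
        using arg_cong[OF k(1), of "\<lambda>t. cinner t v"] by (simp add: cinner_simps)
      then show ?thesis using k0 s(1) by (metis mult_eq_0_iff of_real_eq_0_iff less_irrefl)
    qed
    have "cinner w e\<^sub>1 = 0" "cinner w e\<^sub>2 = 0" "cinner w e\<^sub>3 = 0"
      using re * img_orthogonal[OF w(1)] unit by simp_all
    then have "cinner w z = 0" by (simp add: z(2) cinner_simps)
    then have "cinner r ?z = 0" using * img_orthogonal[OF w(1) z(1)] by simp
    moreover have "cinner r r = cinner r ?z"
      by (subst (2) r_def) (simp add: cinner_simps re)
    ultimately show False using \<open>r \<noteq> 0\<close> by simp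
  qed
  then have "?z = cinner ?z ?e1 *\<^sub>C ?e1 + cinner ?z ?e2 *\<^sub>C ?e2 + cinner ?z ?e3 *\<^sub>C ?e3"
    by (simp add: r_def algebra_simps)
  then have "cinner ?z ?z = cinner (cinner ?z ?e1 *\<^sub>C ?e1 + cinner ?z ?e2 *\<^sub>C ?e2 + cinner ?z ?e3 *\<^sub>C ?e3)
      (cinner ?z ?e1 *\<^sub>C ?e1 + cinner ?z ?e2 *\<^sub>C ?e2 + cinner ?z ?e3 *\<^sub>C ?e3)" by metis
  also have "\<dots> = cinner ?z ?e1 * cnj (cinner ?z ?e1) + cinner ?z ?e2 * cnj (cinner ?z ?e2)
      + cinner ?z ?e3 * cnj (cinner ?z ?e3)"
    by (simp add: cinner_simps n o o')
  also have "\<dots> = complex_of_real (trans_prob ?z ?e1 + trans_prob ?z ?e2 + trans_prob ?z ?e3)"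
    unfolding trans_prob_def of_real_add complex_norm_square ..
  finally show ?thesis unfolding n by (metis of_real_eq_1_iff)
qed

lemma mid_combination: "mid x y = (1 / sqrt 2) *\<^sub>C x + (1 / sqrt 2) *\<^sub>C y + 0 *\<^sub>C w"
  unfolding mid_def scaleR_scaleC by (simp add: scaleC_add_right)

text \<open>At \<open>mid x y\<close> both probabilities are 1/2. Those of the images add up to 1
  and so share one value s = q - q^2, which gives equal squared slopes; s \<le> 1/4 gives the lower
  bound.\<close>

lemma coef_orthogonal:
  assumes x: "norm x = 1" and y: "norm y = 1" and xy: "cinner x y = 0"
  shows "(coef x)\<^sup>2 = (coef y)\<^sup>2" "1 \<le> (coef x)\<^sup>2 * (coef (mid x y))\<^sup>2"
proof -
  let ?z = "mid x y"
  have z: "norm ?z = 1" by (rule norm_mid[OF assms])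
  \<comment> \<open>Completes \<open>x\<close>, \<open>y\<close> to an orthonormal triple while
    contributing probability zero, also after the map.\<close>
  obtain w where w: "norm w = 1" "cinner w x = 0" "cinner w y = 0" by (rule ex_unit_orthogonal)
  have xw: "cinner x w = 0" "cinner y w = 0" using w by (simp_all add: cinner_eq_0_commute[of _ w])
  have "cinner ?z w = 0" by (simp add: mid_def cinner_simps xw)
  then have "trans_prob (img ?z) (img w) = 0"
    using img_orthogonal[OF z w(1)] by (simp add: trans_prob_eq_0_iff)
  then have "trans_prob (img ?z) (img x) + trans_prob (img ?z) (img y) = 1"
    using img_trans_prob_sum[OF x y w(1) xy xw z mid_combination[of x y w]] by simp
  then have ty: "trans_prob (img ?z) (img y) = 1 - trans_prob (img ?z) (img x)" by simp
  define s where "s = trans_prob (img ?z) (img x) - (trans_prob (img ?z) (img x))\<^sup>2"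
  have s: "s = trans_prob (img ?z) (img y) - (trans_prob (img ?z) (img y))\<^sup>2"
    unfolding ty s_def by (simp add: power2_eq_square algebra_simps)
  have 1: "1 / 4 = (coef ?z)\<^sup>2 * (coef x)\<^sup>2 * s"
    using trans_prob_image[OF z x] trans_prob_mid[OF assms] by (simp add: s_def power2_eq_square)
  have 2: "1 / 4 = (coef ?z)\<^sup>2 * (coef y)\<^sup>2 * s"
    using trans_prob_image[OF z y] trans_prob_mid[OF assms] unfolding s by (simp add: power2_eq_square)
  have "(coef ?z)\<^sup>2 * s * (coef x)\<^sup>2 = 1 / 4" "(coef ?z)\<^sup>2 * s * (coef y)\<^sup>2 = 1 / 4"
    using 1[symmetric] 2[symmetric] by (simp_all only: mult_ac)
  then show "(coef x)\<^sup>2 = (coef y)\<^sup>2" by (metis mult_left_cancel mult_zero_left zero_neq_numeral divide_eq_0_iff one_neq_zero)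
  have "s = 1 / 4 - (trans_prob (img ?z) (img x) - 1 / 2)\<^sup>2"
    by (simp add: s_def power2_eq_square algebra_simps)
  then have "s \<le> 1 / 4" by simp
  then have "(coef ?z)\<^sup>2 * (coef x)\<^sup>2 * s \<le> (coef ?z)\<^sup>2 * (coef x)\<^sup>2 * (1 / 4)"
    by (intro mult_left_mono) auto
  then have "1 \<le> (coef ?z)\<^sup>2 * (coef x)\<^sup>2" using 1 by linarith
  then show "1 \<le> (coef x)\<^sup>2 * (coef ?z)\<^sup>2" by (simp only: mult.commute)
qed

lemma coef_const:
  assumes x: "norm x = 1" and y: "norm y = 1"
  shows "(coef x)\<^sup>2 = (coef y)\<^sup>2"
proof -
  obtain w where w: "norm w = 1" "cinner w x = 0" "cinner w y = 0" by (rule ex_unit_orthogonal)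
  then show ?thesis using coef_orthogonal(1) x y by metis
qed

text \<open>The lower bound comes from the superposition of \<open>x\<close> and \<open>y\<close>.
  The upper bound is the same comparison backwards: \<open>z\<close> is a preimage of the
  superposition of the images, and its own p - p^2 is at most 1/4.\<close>

lemma coef_1:
  assumes x: "norm x = 1"
  shows "(coef x)\<^sup>2 = 1"
proof -
  define k where "k = (coef x)\<^sup>2"
  have k: "(coef y)\<^sup>2 = k" if "norm y = 1" for y unfolding k_def by (rule coef_const[OF that x])
  obtain y where y: "norm y = 1" "cinner y x = 0" by (rule ex_unit_orthogonal[of x x])
  then have xy: "cinner x y = 0" by (simp add: cinner_eq_0_commute)
  have "1 \<le> k * k"
    using coef_orthogonal(2)[OF x y(1) xy] k[OF x] k[OF norm_mid[OF x y(1) xy]] by simp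
  moreover have "k * k \<le> 1"
  proof -
    have im: "norm (img x) = 1" "norm (img y) = 1" "cinner (img x) (img y) = 0"
      using img x y xy img_orthogonal by auto
    obtain z where z: "norm z = 1" "trans_prob (mid (img x) (img y)) (img z) = 1"
      using img_surj[OF norm_mid[OF im]] by blast
    obtain c where c: "cmod c = 1" "mid (img x) (img y) = c *\<^sub>C img z"
      using trans_prob_1_parallel[OF norm_mid[OF im] img(1)[OF z(1)] z(2)] by blast
    have tz: "trans_prob (img z) (img x) = 1 / 2"
      using trans_prob_mid(1)[OF im] trans_prob_cong_left[OF c(1), of "img z" "img x"] unfolding c(2) by simp
    have "trans_prob z x - (trans_prob z x)\<^sup>2 = k * k * (1 / 2 - (1 / 2)\<^sup>2)"
      using trans_prob_image[OF z(1) x] unfolding tz k[OF z(1)] k[OF x] .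
    then have "k * k = 4 * (trans_prob z x - (trans_prob z x)\<^sup>2)"
      by (simp add: power2_eq_square)
    also have "\<dots> = 1 - (2 * trans_prob z x - 1)\<^sup>2"
      by (simp add: power2_eq_square algebra_simps)
    finally show ?thesis by simp
  qed
  ultimately have "k\<^sup>2 = 1" by (simp add: power2_eq_square)
  then show ?thesis unfolding power2_eq_1_iff k_def using zero_le_power2[of "coef x"] by linarith
qed

text \<open>Each probability is now kept or replaced by its complement. The pair \<open>x\<close>,
  \<open>y\<close> alone cannot decide, since exchanging t with s^2 = 1 - t preserves the sum. With
  \<open>y\<close> split evenly into \<open>p\<close> and \<open>q\<close> the probabilities are t,
  s^2/2, s^2/2, and a total of 1 permits the exchange for t only if t = 1/2.\<close>

lemma trans_prob_img:
  assumes x: "norm x = 1" and v: "norm v = 1"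
  shows "trans_prob (img v) (img x) = trans_prob v x"
proof -
  have flip: "trans_prob (img p) (img q) = trans_prob p q \<or> trans_prob (img p) (img q) = 1 - trans_prob p q"
    if "norm p = 1" "norm q = 1" for p q
  proof -
    let ?t = "trans_prob p q" and ?t' = "trans_prob (img p) (img q)"
    have "?t - ?t\<^sup>2 = ?t' - ?t'\<^sup>2" using trans_prob_image[OF that] coef_1 that by simp
    then have "(?t' - ?t) * (1 - ?t - ?t') = 0" by (simp add: power2_eq_square algebra_simps)
    then show ?thesis by auto
  qed
  show ?thesis
  proof (cases "trans_prob v x = 0 \<or> residual x v = 0")
    case True
    then show ?thesis
    proof
      assume "trans_prob v x = 0"
      then show ?thesis using img_orthogonal[OF v x] by (simp add: trans_prob_def)
    next
      assume "residual x v = 0"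
      then have "v = cinner v x *\<^sub>C x" using residual_decomp[of v x] x by (simp add: norm_eq_1_cinner)
      then have "norm v = cmod (cinner v x) * norm x" by (metis norm_scaleC)
      then have "trans_prob v x = 1" using x v by (simp add: trans_prob_def)
      then show ?thesis using img_eq[OF v x] trans_prob_self[OF img(1)[OF x]] by simp
    qed
  next
    case False
    define s where "s = norm (residual x v)"
    define y where "y = (1 / s) *\<^sub>R residual x v"
    have xx: "cinner x x = 1" using x by (simp add: norm_eq_1_cinner)
    have s: "s > 0" using False by (simp add: s_def)
    have ry: "residual x v = s *\<^sub>R y" using s by (simp add: y_def)
    have y: "norm y = 1" using s by (simp add: y_def s_def)
    have xy: "cinner x y = 0" by (simp add: y_def cinner_simps)
    obtain w where w: "norm w = 1" "cinner w x = 0" "cinner w y = 0" by (rule ex_unit_orthogonal)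
    have o: "cinner x x = 1" "cinner y y = 1" "cinner w w = 1" "cinner y x = 0" "cinner x w = 0" "cinner y w = 0"
      using w x y xy by (simp_all add: norm_eq_1_cinner cinner_eq_0_commute[of y x] cinner_eq_0_commute[of _ w])
    note o = o xy w(2,3)
    \<comment> \<open>The third direction \<open>w\<close> is used to write \<open>y\<close> as an
      equal superposition of two orthogonal unit vectors that are also orthogonal to
      \<open>x\<close>.\<close>
    define p where "p = mid y w"
    define q where "q = mid y (- w)"
    have p: "norm p = 1" unfolding p_def by (rule norm_mid) (use y w o in auto)
    have q: "norm q = 1" unfolding q_def by (rule norm_mid) (use y w o in \<open>auto simp: cinner_simps\<close>)
    have xp: "cinner x p = 0" and xq: "cinner x q = 0" and pq: "cinner p q = 0"
      by (simp_all add: p_def q_def mid_def cinner_simps o)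
    have two: "complex_of_real (1 / sqrt 2) * complex_of_real (1 / sqrt 2) = 1 / 2"
      using sqrt2_sq by (simp add: field_simps)
    have y2: "y = (1 / sqrt 2) *\<^sub>R p + (1 / sqrt 2) *\<^sub>R q"
    proof -
      have "(1 / sqrt 2) *\<^sub>R p + (1 / sqrt 2) *\<^sub>R q = ((1 / sqrt 2) * (1 / sqrt 2)) *\<^sub>R (2 *\<^sub>R y)"
        unfolding p_def q_def mid_def scaleR_2 by (simp add: algebra_simps)
      also have "(1 / sqrt 2) * (1 / sqrt 2) = (1 / 2 :: real)" by simp
      finally show ?thesis by simp
    qed
    have v_eq: "v = cinner v x *\<^sub>C x + complex_of_real (s / sqrt 2) *\<^sub>C p + complex_of_real (s / sqrt 2) *\<^sub>C q"
    proof -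
      have "v = cinner v x *\<^sub>C x + s *\<^sub>R y" using residual_decomp[of v x] by (simp add: xx ry)
      also have "s *\<^sub>R y = (s / sqrt 2) *\<^sub>R p + (s / sqrt 2) *\<^sub>R q" by (subst y2) (simp add: scaleR_add_right)
      finally show ?thesis by (simp only: scaleR_scaleC add.assoc)
    qed
    have qp: "cinner q p = 0" "cinner p x = 0" "cinner q x = 0" using xp xq pq by (simp_all add: cinner_eq_0_commute)
    have pp: "cinner p p = 1" "cinner q q = 1" using p q by (simp_all add: norm_eq_1_cinner)
    have vp: "cinner v p = complex_of_real (s / sqrt 2)" "cinner v q = complex_of_real (s / sqrt 2)"
      by (subst v_eq, simp add: cinner_simps xp xq pq qp pp)+
    have t: "trans_prob v p = s\<^sup>2 / 2" "trans_prob v q = s\<^sup>2 / 2"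
      unfolding trans_prob_def vp norm_of_real by (simp_all add: power_divide)
    have "cinner v v = cinner v x * cnj (cinner v x) + complex_of_real (s\<^sup>2)"
    proof -
      have v0: "v = cinner v x *\<^sub>C x + s *\<^sub>R y" using residual_decomp[of v x] by (simp add: xx ry)
      have "cinner v v = cinner (cinner v x *\<^sub>C x + s *\<^sub>R y) (cinner v x *\<^sub>C x + s *\<^sub>R y)"
        using v0 by metis
      also have "\<dots> = cinner v x * cnj (cinner v x) + complex_of_real (s\<^sup>2)"
        by (simp add: cinner_simps o power2_eq_square)
      finally show ?thesis .
    qed
    then have "complex_of_real (trans_prob v x + s\<^sup>2) = 1"
      using v unfolding trans_prob_def of_real_add complex_norm_square by (simp add: norm_eq_1_cinner)
    then have sum: "trans_prob v x + s\<^sup>2 = 1" by (metis of_real_eq_1_iff)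
    have sum': "trans_prob (img v) (img x) + trans_prob (img v) (img p) + trans_prob (img v) (img q) = 1"
      by (rule img_trans_prob_sum[OF x p q xp xq pq v v_eq])
    have nz: "trans_prob v x > 0" using trans_prob_nonneg[of v x] False by simp
    have "s\<^sup>2 > 0" using s by simp
    then show ?thesis
      using flip[OF v x] flip[OF v p] flip[OF v q] sum sum' nz unfolding t by linarith
  qed
qed

lemma implementing_isometry:
  obtains U g where "g = (\<lambda>c. c) \<or> g = cnj"
    and "\<And>x y. U (x + y) = U x + U y" "\<And>c x. U (c *\<^sub>C x) = g c *\<^sub>C U x"
    and "\<And>x y. cinner (U x) (U y) = g (cinner x y)" "surj U"
    and "\<And>A x. A \<in> self_adjoint_ops \<Longrightarrow> norm x = 1 \<Longrightarrow> variance (\<Phi> A) (U x) = variance A x"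
proof -
  obtain e :: 'a where e: "norm e = 1" using ex_unit_orthogonal[of 0 0] by blast
  have n: "norm (img x) = 1" if "norm x = 1" for x by (rule img(1)[OF that])
  have c: "cmod (cinner (img x) (img y)) = cmod (cinner x y)" if "norm x = 1" "norm y = 1" for x y
    using trans_prob_img[OF that(2,1)] by (simp add: trans_prob_def power2_eq_iff_nonneg)
  have s: "\<exists>x. norm x = 1 \<and> cmod (cinner u (img x)) = 1" if u: "norm u = 1" for u
  proof -
    obtain x where x: "norm x = 1" "trans_prob u (img x) = 1" by (rule img_surj[OF u])
    then have "cmod (cinner u (img x)) = 1"
      using norm_ge_zero[of "cinner u (img x)"] unfolding trans_prob_def power2_eq_1_iff by linarith
    with x show ?thesis by blast
  qed
  obtain U g where Ug: "g = (\<lambda>c. c) \<or> g = cnj"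
    "\<And>x y. U (x + y) = U x + U y" "\<And>c x. U (c *\<^sub>C x) = g c *\<^sub>C U x"
    "\<And>x y. cinner (U x) (U y) = g (cinner x y)" "surj U"
    and par: "\<And>x. norm x = 1 \<Longrightarrow> \<exists>c. U x = c *\<^sub>C img x"
    by (rule wigner[of img e]; (rule e | (rule n c s that, assumption+)))
  have "variance (\<Phi> A) (U x) = variance A x" if A: "A \<in> self_adjoint_ops" and x: "norm x = 1" for A x
  proof -
    have "cinner (U x) (U x) = 1" using Ug(1,4) x by (auto simp: norm_eq_1_cinner)
    then have Ux: "norm (U x) = 1" by (simp add: norm_eq_1_cinner)
    obtain c where c: "U x = c *\<^sub>C img x" using par[OF x] by blast
    then have c1: "cmod c = 1" using Ux img(1)[OF x] by (simp add: norm_scaleC)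
    then have "trans_prob (U x) (img x) = 1"
      unfolding c using trans_prob_cong_left[OF c1, of "img x" "img x"] trans_prob_self[OF img(1)[OF x]] by simp
    then have "ray (U x) = ray (img x)" by (rule trans_prob_1_ray_eq[OF Ux img(1)[OF x]])
    then have "variance (\<Phi> A) (U x) = 1\<^sup>2 * variance (\<Phi> A) (img x)"
      by (intro variance_scale) (use A Ux img(1)[OF x] in auto)
    then show ?thesis using variance_image[OF A x] coef_1[OF x] by simp
  qed
  then show thesis using that Ug by blast
qed

end

section \<open>Operators with equal variances\<close>

text \<open>The variance made homogeneous of degree four, so that polarisation may leave the unit
  sphere.\<close>

definition variance_form :: "('a::complex_hilbert_space \<Rightarrow>\<^sub>L 'a) \<Rightarrow> 'a \<Rightarrow> real" where
  "variance_form A x = (norm (A x))\<^sup>2 * (norm x)\<^sup>2 - (Re (cinner (A x) x))\<^sup>2"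

lemma variance_form_eq:
  fixes A B :: "'a::complex_hilbert_space \<Rightarrow>\<^sub>L 'a"
  assumes "\<And>x. norm x = 1 \<Longrightarrow> variance A x = variance B x"
  shows "variance_form A x = variance_form B x"
proof (cases "x = 0")
  case False
  then obtain r where r: "r > 0" "norm (r *\<^sub>R x) = 1" by (rule normalize_vec)
  have "variance C (r *\<^sub>R x) = (r\<^sup>2)\<^sup>2 * variance_form C x" for C :: "'a \<Rightarrow>\<^sub>L 'a"
  proof -
    have "variance C (r *\<^sub>R x) = r\<^sup>2 * (norm (C x))\<^sup>2 - (r\<^sup>2)\<^sup>2 * (Re (cinner (C x) x))\<^sup>2"
      by (simp add: variance_def blinfun.bilinear_simps cinner_simps power_mult_distrib power2_eq_square)
    also have "r\<^sup>2 * (norm (C x))\<^sup>2 = r\<^sup>2 * (norm (C x))\<^sup>2 * (norm (r *\<^sub>R x))\<^sup>2" unfolding r(2) by simp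
    also have "\<dots> = (r\<^sup>2)\<^sup>2 * ((norm (C x))\<^sup>2 * (norm x)\<^sup>2)"
      by (simp add: power_mult_distrib power2_eq_square)
    finally show ?thesis by (simp add: variance_form_def right_diff_distrib)
  qed
  then show ?thesis using assms[OF r(2)] r(1) by simp
qed (simp add: variance_form_def)

text \<open>Polarisation: this alternating sum isolates the coefficient of \<open>t\<^sup>2\<close> in \<open>variance_form A (u + t v)\<close>.\<close>

lemma variance_form_polar:
  assumes A: "A \<in> self_adjoint_ops" and uv: "cinner u v = 0"
  shows "variance_form A (u + v) + variance_form A (u - v)
      - variance_form A (u + \<i> *\<^sub>C v) - variance_form A (u - \<i> *\<^sub>C v) = - 8 * Re ((cinner (A v) u)\<^sup>2)"
proof -
  have vu: "cinner v u = 0" using uv by (simp add: cinner_eq_0_commute)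
  define n where "n = (norm u)\<^sup>2 + (norm v)\<^sup>2"
  define a where "a = Re (cinner (A u) u) + Re (cinner (A v) v)"
  define m where "m = cinner (A v) u"
  have Auv: "cinner (A u) v = cnj m"
    using self_adjoint_cinner[OF A, of u v] cinner_commute[of u "A v"] by (simp add: m_def)
  have n: "(norm (u + v))\<^sup>2 = n" "(norm (u - v))\<^sup>2 = n"
    "(norm (u + \<i> *\<^sub>C v))\<^sup>2 = n" "(norm (u - \<i> *\<^sub>C v))\<^sup>2 = n"
    unfolding n_def norm_sq_cinner by (simp_all add: cinner_simps uv vu)
  have q: "Re (cinner (A (u + v)) (u + v)) = a + 2 * Re m"
    "Re (cinner (A (u - v)) (u - v)) = a - 2 * Re m"
    "Re (cinner (A (u + \<i> *\<^sub>C v)) (u + \<i> *\<^sub>C v)) = a - 2 * Im m"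
    "Re (cinner (A (u - \<i> *\<^sub>C v)) (u - \<i> *\<^sub>C v)) = a + 2 * Im m"
    using A by (simp_all add: blinfun.bilinear_simps self_adjoint_scaleC cinner_simps Auv a_def flip: m_def)
  have p: "(norm (A (u + v)))\<^sup>2 + (norm (A (u - v)))\<^sup>2
      = (norm (A (u + \<i> *\<^sub>C v)))\<^sup>2 + (norm (A (u - \<i> *\<^sub>C v)))\<^sup>2"
    unfolding norm_sq_cinner using A
    by (simp add: blinfun.bilinear_simps self_adjoint_scaleC cinner_simps)
  have "variance_form A (u + v) + variance_form A (u - v)
      - variance_form A (u + \<i> *\<^sub>C v) - variance_form A (u - \<i> *\<^sub>C v)
    = n * ((norm (A (u + v)))\<^sup>2 + (norm (A (u - v)))\<^sup>2
        - ((norm (A (u + \<i> *\<^sub>C v)))\<^sup>2 + (norm (A (u - \<i> *\<^sub>C v)))\<^sup>2))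
      - (a + 2 * Re m)\<^sup>2 - (a - 2 * Re m)\<^sup>2 + (a - 2 * Im m)\<^sup>2 + (a + 2 * Im m)\<^sup>2"
    unfolding variance_form_def n q by (simp add: algebra_simps)
  also have "\<dots> = - 8 * Re (m\<^sup>2)" unfolding p by (simp add: power2_eq_square algebra_simps)
  finally show ?thesis by (simp add: m_def)
qed

section \<open>Self-adjoint operators sharing out the vectors as eigenvectors\<close>

definition eigenvector :: "('a::complex_hilbert_space \<Rightarrow>\<^sub>L 'a) \<Rightarrow> 'a \<Rightarrow> bool" where
  "eigenvector C v \<longleftrightarrow> (\<exists>c. C v = c *\<^sub>C v)"

lemma eigenvector_scale:
  assumes "C \<in> self_adjoint_ops" "eigenvector C v"
  shows "eigenvector C (k *\<^sub>C v)"
  using assms by (auto simp: eigenvector_def self_adjoint_scaleC scaleC_scaleC mult.commute)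

text \<open>Subtracting the two expressions for \<open>C x\<close> either makes \<open>x\<close> a
  multiple of \<open>y\<close> or forces equal eigenvalues, after which the coefficient of
  \<open>y\<close> vanishes.\<close>

lemma eigenvector_pencil:
  assumes C: "C \<in> self_adjoint_ops" and y: "eigenvector C y"
    and t: "eigenvector C (x + t *\<^sub>C y)" "eigenvector C (x + s *\<^sub>C y)" "t \<noteq> s"
  shows "eigenvector C x"
proof -
  obtain m where m: "C y = m *\<^sub>C y" using y by (auto simp: eigenvector_def)
  obtain l where "C (x + t *\<^sub>C y) = l *\<^sub>C (x + t *\<^sub>C y)" using t by (auto simp: eigenvector_def)
  then have l: "C x = l *\<^sub>C x + (l * t - t * m) *\<^sub>C y"
    using C by (simp add: blinfun.bilinear_simps self_adjoint_scaleC m scaleC_scaleC scaleC_add_right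
        complex_vector.scale_left_diff_distrib algebra_simps)
  obtain k where "C (x + s *\<^sub>C y) = k *\<^sub>C (x + s *\<^sub>C y)" using t by (auto simp: eigenvector_def)
  then have k: "C x = k *\<^sub>C x + (k * s - s * m) *\<^sub>C y"
    using C by (simp add: blinfun.bilinear_simps self_adjoint_scaleC m scaleC_scaleC scaleC_add_right
        complex_vector.scale_left_diff_distrib algebra_simps)
  have e: "(l - k) *\<^sub>C x = ((k * s - s * m) - (l * t - t * m)) *\<^sub>C y"
    using l k by (simp add: complex_vector.scale_left_diff_distrib algebra_simps)
  show ?thesis
  proof (cases "l = k")
    case False
    then have "x = (((k * s - s * m) - (l * t - t * m)) / (l - k)) *\<^sub>C y"
      using arg_cong[OF e, of "\<lambda>z. (1 / (l - k)) *\<^sub>C z"] by (simp add: scaleC_scaleC)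
    then show ?thesis using eigenvector_scale[OF C y] by metis
  next
    case True
    then have "((s - t) * (l - m)) *\<^sub>C y = 0" using e by (simp add: algebra_simps)
    then have "l = m \<or> y = 0" using t(3) by auto
    then have "C x = l *\<^sub>C x" using l by auto
    then show ?thesis by (auto simp: eigenvector_def)
  qed
qed

text \<open>Pigeonhole on \<open>x + t *\<^sub>C y\<close> for t = 1, 2, 3: by the pencil argument
  each operator accepts at most one of these vectors. For \<open>D\<close> the roles of
  \<open>x\<close> and \<open>y\<close> are exchanged, which requires t \<noteq> 0.\<close>

lemma eigenvector_dichotomy:
  assumes C: "C \<in> self_adjoint_ops" and D: "D \<in> self_adjoint_ops"
    and CD: "\<And>v. eigenvector C v \<or> eigenvector D v"
  shows "(\<forall>v. eigenvector C v) \<or> (\<forall>v. eigenvector D v)"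
proof (rule ccontr)
  assume "\<not> ?thesis"
  then obtain x y where xy: "\<not> eigenvector C x" "\<not> eigenvector D y" by blast
  then have e: "eigenvector D x" "eigenvector C y" using CD by blast+
  have C1: "\<not> (eigenvector C (x + t *\<^sub>C y) \<and> eigenvector C (x + s *\<^sub>C y))" if "t \<noteq> s" for t s
    using eigenvector_pencil[OF C e(2)] xy(1) that by blast
  have swap: "eigenvector D (y + (1 / t) *\<^sub>C x)" if "eigenvector D (x + t *\<^sub>C y)" "t \<noteq> 0" for t
    using eigenvector_scale[OF D that(1), of "1 / t"] that(2)
    by (simp add: scaleC_add_right scaleC_scaleC add.commute)
  have D1: "\<not> (eigenvector D (x + t *\<^sub>C y) \<and> eigenvector D (x + s *\<^sub>C y))" if "t \<noteq> s" "t \<noteq> 0" "s \<noteq> 0" for t s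
    using eigenvector_pencil[OF D e(1), of y "1 / t" "1 / s"] swap[of t] swap[of s] xy(2) that by auto
  show False
    using C1[of 1 2] C1[of 1 3] C1[of 2 3] D1[of 1 2] D1[of 1 3] D1[of 2 3]
      CD[of "x + 1 *\<^sub>C y"] CD[of "x + 2 *\<^sub>C y"] CD[of "x + 3 *\<^sub>C y"] by auto
qed

text \<open>Polarisation yields <A v, u>^2 = <B v, u>^2 for orthogonal \<open>u\<close>,
  \<open>v\<close>, so the products of the off-diagonal entries of B - A and B + A vanish. Each
  vector is then an eigenvector of one of them, and by the dichotomy one of them is scalar.\<close>

lemma variance_determines:
  assumes A: "A \<in> self_adjoint_ops" and B: "B \<in> self_adjoint_ops"
    and var: "\<And>x. norm x = 1 \<Longrightarrow> variance A x = variance B x"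
  shows "\<exists>s d. s \<in> {1, -1} \<and> B = s *\<^sub>R A + d *\<^sub>R id_blinfun"
proof -
  have vf: "variance_form A x = variance_form B x" for x by (rule variance_form_eq[OF var])
  have re: "Re ((cinner (A v) u)\<^sup>2) = Re ((cinner (B v) u)\<^sup>2)" if "cinner u v = 0" for u v
    using variance_form_polar[OF A that] variance_form_polar[OF B that] unfolding vf by simp
  have sq: "(cinner (A v) u)\<^sup>2 = (cinner (B v) u)\<^sup>2" if uv: "cinner u v = 0" for u v
  proof -
    \<comment> \<open>The square of 1 + \<i> is 2 \<i>, so the real parts at \<open>w\<close> give
      the imaginary parts at \<open>v\<close>.\<close>
    define w where "w = (1 + \<i>) *\<^sub>C v"
    have "cinner u w = 0" using uv by (simp add: w_def cinner_simps)
    from re[OF this] have "Re (2 * \<i> * (cinner (A v) u)\<^sup>2) = Re (2 * \<i> * (cinner (B v) u)\<^sup>2)"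
      using A B by (simp add: w_def self_adjoint_scaleC cinner_simps power_mult_distrib power2_sum)
    then show ?thesis using re[OF uv] by (simp add: complex_eq_iff)
  qed
  define C where "C = B - A"
  define D where "D = B + A"
  have CD: "C \<in> self_adjoint_ops" "D \<in> self_adjoint_ops" using A B by (simp_all add: C_def D_def)
  have prod: "cinner (C v) u * cinner (D v) u = 0" if "cinner u v = 0" for u v
    using sq[OF that]
    by (simp add: C_def D_def blinfun.bilinear_simps cinner_simps power2_eq_square algebra_simps)
  have "eigenvector C v \<or> eigenvector D v" for v
  proof (rule ccontr)
    assume n: "\<not> ?thesis"
    define p where "p = residual v (C v)"
    define q where "q = residual v (D v)"
    have nz: "p \<noteq> 0" "q \<noteq> 0"
      using n residual_decomp[of "C v" v] residual_decomp[of "D v" v]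
      unfolding p_def q_def eigenvector_def by (metis add.right_neutral)+
    have pv: "cinner p v = 0" "cinner q v = 0" by (simp_all add: p_def q_def)
    have pq: "cinner p u * cinner q u = 0" if "cinner u v = 0" for u
    proof -
      have "cinner v u = 0" using that by (simp add: cinner_eq_0_commute)
      then have "cinner p u = cinner (C v) u" "cinner q u = cinner (D v) u"
        by (simp_all add: p_def q_def residual_def cinner_simps)
      then show ?thesis using prod[OF that] by simp
    qed
    \<comment> \<open>Testing with u = p makes \<open>p\<close> and \<open>q\<close> orthogonal;
      testing with p + q then leaves the product of two nonzero squared norms.\<close>
    have qp: "cinner q p = 0" using pq[OF pv(1)] nz by simp
    then have "cinner p q = 0" by (simp add: cinner_eq_0_commute)
    moreover have "cinner (p + q) v = 0" using pv by (simp add: cinner_simps)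
    ultimately show False using pq[of "p + q"] qp nz by (simp add: cinner_simps)
  qed
  then have "(\<forall>v. eigenvector C v) \<or> (\<forall>v. eigenvector D v)" by (rule eigenvector_dichotomy[OF CD])
  then show ?thesis
  proof
    assume "\<forall>v. eigenvector C v"
    then obtain d where "C = d *\<^sub>R id_blinfun"
      using eigen_all_imp_scalar[OF CD(1)] unfolding eigenvector_def by blast
    then have "B = 1 *\<^sub>R A + d *\<^sub>R id_blinfun" by (simp add: C_def algebra_simps)
    then show ?thesis by blast
  next
    assume "\<forall>v. eigenvector D v"
    then obtain d where "D = d *\<^sub>R id_blinfun"
      using eigen_all_imp_scalar[OF CD(2)] unfolding eigenvector_def by blast
    then have "B = (-1) *\<^sub>R A + d *\<^sub>R id_blinfun" by (simp add: D_def algebra_simps)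
    then show ?thesis by blast
  qed
qed

section \<open>Coherence of signs\<close>

lemma residual_add_multiple:
  assumes "cinner k g = 0"
  shows "residual g (c *\<^sub>C g + k) = k"
  by (cases "g = 0") (simp_all add: residual_def cinner_simps assms)

lemma residual_combination:
  "residual g (a *\<^sub>C g + b *\<^sub>C h) = b *\<^sub>C residual g h"
  by (cases "g = 0") (simp_all add: residual_def cinner_simps add_divide_distrib scaleC_add_left
      scaleC_scaleC complex_vector.scale_right_diff_distrib)

lemma skew2_swap: "skew2 y x = - skew2 x y"
  by (rule blinfun_eqI) (simp add: skew2_apply blinfun.bilinear_simps
      complex_vector.scale_right_diff_distrib)

lemma sym_range_uminus: "B \<in> self_adjoint_ops \<Longrightarrow> sym_range (- A) B \<longleftrightarrow> sym_range A B"
  using comm_range_affine_left[of B "-1" A 0] by (auto simp: sym_range_iff image_image)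

context dim_at_least_3
begin

text \<open>The conclusions are the hypotheses of \<open>skew2_skew2_asymmetric\<close> for both
  \<open>g\<close> and \<open>g'\<close>. Thus any two rank-two operators with the same
  \<open>e\<close> are linked through a third, and their signs agree.\<close>

lemma common_neighbour:
  fixes e g g' :: 'a
  assumes e: "norm e = 1" and g: "cinner g e = 0" "g \<noteq> 0" and g': "cinner g' e = 0" "g' \<noteq> 0"
  obtains h where "cinner h e = 0" "Im (cinner h g) \<noteq> 0" "Im (cinner h g') \<noteq> 0"
    "residual g h \<noteq> 0" "residual g' h \<noteq> 0"
proof (cases "residual g g' = 0")
  case False
  have False': "residual g' g \<noteq> 0"
  proof
    assume "residual g' g = 0"
    then obtain c where c: "g = c *\<^sub>C g'" using residual_decomp[of g g'] by (metis add.right_neutral)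
    then have "c \<noteq> 0" using g by auto
    then have "g' = (1 / c) *\<^sub>C g + 0" by (simp add: c scaleC_scaleC)
    then show False using False residual_add_multiple[of 0 g "1 / c"] by simp
  qed
  define a where "a = norm g"
  define b where "b = norm g'"
  have ab: "a > 0" "b > 0" using g g' by (simp_all add: a_def b_def)
  have "cmod (cinner g' g) \<noteq> b * a"
  proof
    assume "cmod (cinner g' g) = b * a"
    then have "g' = (cinner g' g / cinner g g) *\<^sub>C g"
      by (intro cauchy_schwarz_equality) (simp_all add: a_def b_def g)
    then show False using False by (simp add: residual_def)
  qed
  then have "cmod (cinner g' g) < b * a" using cmod_cinner_le[of g' g] by (simp add: a_def b_def)
  then have pos: "b * a + Re (cinner g' g) > 0" using abs_Re_le_cmod[of "cinner g' g"] by linarith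
  have gg: "cinner g g = a\<^sup>2" "cinner g' g' = b\<^sup>2" by (simp_all add: a_def b_def cinner_self)
  \<comment> \<open>The weights equalise the norms of the two summands, so both imaginary parts are
    positive multiples of b a + Re <g', g>, positive by strict Cauchy-Schwarz.\<close>
  let ?h = "(\<i> * b) *\<^sub>C g + (\<i> * a) *\<^sub>C g'"
  show thesis
  proof (rule that[of ?h])
    show "cinner ?h e = 0" using g g' by (simp add: cinner_simps)
    have "Im (cinner ?h g) = a * (b * a + Re (cinner g' g))"
      by (simp add: cinner_simps gg power2_eq_square algebra_simps)
    then show "Im (cinner ?h g) \<noteq> 0" using ab pos by simp
    have "Re (cinner g g') = Re (cinner g' g)" by (subst cinner_commute) simp
    then have "Im (cinner ?h g') = b * (b * a + Re (cinner g' g))"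
      by (simp add: cinner_simps gg power2_eq_square algebra_simps)
    then show "Im (cinner ?h g') \<noteq> 0" using ab pos by simp
    show "residual g ?h \<noteq> 0" unfolding residual_combination using False ab by simp
    show "residual g' ?h \<noteq> 0"
      unfolding add.commute[of "(\<i> * b) *\<^sub>C g"] residual_combination using False' ab by simp
  qed
next
  case True
  then obtain c where c: "g' = c *\<^sub>C g" using residual_decomp[of g' g] by (metis add.right_neutral)
  have c0: "c \<noteq> 0" using c g' by auto
  obtain k where k: "norm k = 1" "cinner k e = 0" "cinner k g = 0" by (rule ex_unit_orthogonal)
  have k0: "k \<noteq> 0" using k by auto
  \<comment> \<open>For parallel vectors \<open>t\<close> must be non-real and remain so after
    multiplication by \<open>cnj c\<close>; \<i> works unless \<open>c\<close> is purely
    imaginary.\<close>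
  obtain t where t: "Im t \<noteq> 0" "Im (t * cnj c) \<noteq> 0"
  proof (cases "Re c = 0")
    case True
    then have "Im c \<noteq> 0" using c0 by (simp add: complex_eq_iff)
    then show thesis using True by (intro that[of "1 + \<i>"]) simp_all
  next
    case False
    then show thesis by (intro that[of \<i>]) simp_all
  qed
  have n: "(norm g)\<^sup>2 > 0" using g by simp
  let ?h = "t *\<^sub>C g + k"
  show thesis
  proof (rule that[of ?h])
    show "cinner ?h e = 0" using g k by (simp add: cinner_simps)
    have "cinner ?h g = complex_of_real ((norm g)\<^sup>2) * t" by (simp add: cinner_simps k cinner_self)
    then have "Im (cinner ?h g) = (norm g)\<^sup>2 * Im t" by simp
    then show "Im (cinner ?h g) \<noteq> 0" using t n by simp
    have "cinner ?h g' = complex_of_real ((norm g)\<^sup>2) * (t * cnj c)"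
      by (simp add: c cinner_simps k cinner_self)
    then have "Im (cinner ?h g') = (norm g)\<^sup>2 * Im (t * cnj c)" by simp
    then show "Im (cinner ?h g') \<noteq> 0" using t n by simp
    show "residual g ?h \<noteq> 0" unfolding residual_add_multiple[OF k(3)] by (rule k0)
    have "?h = (t / c) *\<^sub>C g' + k" using c0 by (simp add: c scaleC_scaleC)
    moreover have "cinner k g' = 0" by (simp add: c cinner_simps k)
    ultimately show "residual g' ?h \<noteq> 0" using residual_add_multiple[of k g' "t / c"] k0 by simp
  qed
qed

text \<open>Three pairwise linked operators give \<sigma>^3 = (s1 s2 s3)^2 = 1. Links then carry
  equal signs through the rank-two operators, and every operator outside \<open>\<D>\<close> is
  linked to one of these.\<close>

lemma sign_coherence:
  fixes s :: "('a \<Rightarrow>\<^sub>L 'a) \<Rightarrow> real"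
  assumes s: "\<And>A. A \<in> self_adjoint_ops \<Longrightarrow> s A \<in> {1, -1}"
    and link: "\<And>A B. A \<in> self_adjoint_ops \<Longrightarrow> B \<in> self_adjoint_ops \<Longrightarrow> \<not> sym_range A B \<Longrightarrow> s A * s B = \<sigma>"
  shows "\<sigma> = 1" and "\<exists>\<eta>\<in>{1, -1}. \<forall>A\<in>self_adjoint_ops - \<D>. s A = \<eta>"
proof -
  let ?s = "\<lambda>x y. s (skew2 x y)"
  have s2: "?s x y = 1 \<or> ?s x y = -1" for x y using s[OF skew2_self_adjoint] by auto
  have nb: "?s e g * ?s e h = \<sigma>"
    if "norm e = 1" "cinner g e = 0" "cinner h e = 0" "Im (cinner h g) \<noteq> 0" "residual g h \<noteq> 0" for e g h
    by (intro link skew2_self_adjoint skew2_skew2_asymmetric that)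
  obtain e :: 'a where e: "norm e = 1" using ex_unit_orthogonal[of 0 0] by blast
  obtain f where f: "norm f = 1" "cinner f e = 0" by (rule ex_unit_orthogonal[of e e])
  obtain k where k: "norm k = 1" "cinner k e = 0" "cinner k f = 0" by (rule ex_unit_orthogonal)
  show \<sigma>: "\<sigma> = 1"
  proof -
    have o: "cinner f f = 1" "cinner k k = 1" "cinner f k = 0"
      using f k by (simp_all add: norm_eq_1_cinner cinner_eq_0_commute)
    have k0: "k \<noteq> 0" using k by auto
    \<comment> \<open>The pairwise products of \<open>f\<close>, \<open>g2\<close>,
      \<open>g3\<close> have nonzero imaginary part, while no two of these vectors are
      parallel.\<close>
    define g2 where "g2 = \<i> *\<^sub>C f + k"
    define g3 where "g3 = \<i> *\<^sub>C f + \<i> *\<^sub>C k"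
    have ge: "cinner g2 e = 0" "cinner g3 e = 0" using f k by (simp_all add: g2_def g3_def cinner_simps)
    have "?s e f * ?s e g2 = \<sigma>"
    proof (rule nb[OF e f(2) ge(1)])
      show "residual f g2 \<noteq> 0" unfolding g2_def residual_add_multiple[OF k(3)] by (rule k0)
    qed (simp add: g2_def cinner_simps o k)
    moreover have "?s e f * ?s e g3 = \<sigma>"
    proof (rule nb[OF e f(2) ge(2)])
      have "cinner (\<i> *\<^sub>C k) f = 0" by (simp add: cinner_simps k)
      then show "residual f g3 \<noteq> 0" unfolding g3_def using k0 by (simp add: residual_add_multiple)
    qed (simp add: g3_def cinner_simps o k)
    moreover have "?s e g2 * ?s e g3 = \<sigma>"
    proof (rule nb[OF e ge])
      have c: "cinner g3 g2 = 1 + \<i>" "cinner g2 g2 = 2" by (simp_all add: g2_def g3_def cinner_simps o k)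
      have "cinner (residual g2 g3) k = \<i> - (1 + \<i>) / 2"
        unfolding residual_def c by (simp add: g2_def g3_def cinner_simps o k)
      also have "\<dots> \<noteq> 0" by (simp add: complex_eq_iff)
      finally show "residual g2 g3 \<noteq> 0" by auto
      show "Im (cinner g3 g2) \<noteq> 0" by (simp add: c)
    qed
    ultimately show ?thesis using s2[of e f] s2[of e g2] s2[of e g3] by auto
  qed
  have eq: "s A = s B" if "A \<in> self_adjoint_ops" "B \<in> self_adjoint_ops" "\<not> sym_range A B" for A B
    using link[OF that] s[OF that(1)] s[OF that(2)] unfolding \<sigma> by auto
  have change: "?s e g = ?s e g'"
    if eg: "norm e = 1" "cinner g e = 0" "g \<noteq> 0" "cinner g' e = 0" "g' \<noteq> 0" for e g g'
  proof -
    obtain h where h: "cinner h e = 0" "Im (cinner h g) \<noteq> 0" "Im (cinner h g') \<noteq> 0"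
      "residual g h \<noteq> 0" "residual g' h \<noteq> 0" by (rule common_neighbour[OF eg])
    have "?s e g = ?s e h" "?s e g' = ?s e h"
      by (intro eq skew2_self_adjoint skew2_skew2_asymmetric eg h)+
    then show ?thesis by simp
  qed
  \<comment> \<open>Exchanging the arguments negates the operator. Since negation preserves
    asymmetry, both versions share the neighbour \<open>skew2 e h\<close>.\<close>
  have swap: "?s e g = ?s g e" if eg: "norm e = 1" "cinner g e = 0" "g \<noteq> 0" for e g
  proof -
    obtain h where h: "cinner h e = 0" "Im (cinner h g) \<noteq> 0" "Im (cinner h g) \<noteq> 0"
      "residual g h \<noteq> 0" "residual g h \<noteq> 0" by (rule common_neighbour[OF eg eg(2,3)])
    have n: "\<not> sym_range (skew2 e g) (skew2 e h)"
      by (intro skew2_skew2_asymmetric eg h)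
    then have "\<not> sym_range (skew2 g e) (skew2 e h)"
      unfolding skew2_swap[of g e] by (simp add: sym_range_uminus)
    then show ?thesis using n eq skew2_self_adjoint by metis
  qed
  have all: "?s x y = ?s e f" if xy: "norm x = 1" "cinner y x = 0" "y \<noteq> 0" for x y
  proof -
    \<comment> \<open>A vector orthogonal to both \<open>x\<close> and \<open>e\<close> permits the
      passage from \<open>x\<close> to \<open>e\<close> by alternately changing the second argument
      and swapping.\<close>
    obtain w where w: "norm w = 1" "cinner w x = 0" "cinner w e = 0" by (rule ex_unit_orthogonal)
    have nz: "w \<noteq> 0" "x \<noteq> 0" "e \<noteq> 0" "f \<noteq> 0" using w xy e f by auto
    have o: "cinner x w = 0" "cinner e w = 0" using w by (simp_all add: cinner_eq_0_commute)
    have "?s x y = ?s x w" by (rule change) (use xy w nz in auto)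
    also have "\<dots> = ?s w x" by (rule swap) (use xy w nz in auto)
    also have "\<dots> = ?s w e" by (rule change) (use xy w nz o in auto)
    also have "\<dots> = ?s e w" by (rule swap) (use e w nz o in auto)
    also have "\<dots> = ?s e f" by (rule change) (use e f w nz in auto)
    finally show ?thesis .
  qed
  have "s A = ?s e f" if A: "A \<in> self_adjoint_ops - \<D>" for A
  proof -
    obtain x y where xy: "norm x = 1" "cinner y x = 0" "y \<noteq> 0" "\<not> sym_range A (skew2 x y)"
      using not_projection_identity_asymmetric[of A] A by blast
    then have "s A = ?s x y" using A by (intro eq) auto
    also have "\<dots> = ?s e f" by (rule all[OF xy(1-3)])
    finally show ?thesis .
  qed
  then show "\<exists>\<eta>\<in>{1, -1}. \<forall>A\<in>self_adjoint_ops - \<D>. s A = \<eta>"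
    using s2[of e f] by (intro bexI[of _ "?s e f"]) auto
qed

end

section \<open>Implementation by a unitary operator\<close>

context commutator_range_preserver
begin

text \<open>Pulling \<open>\<Phi> A\<close> back through \<open>U\<close> gives an operator with the
  variances of \<open>A\<close>, to which \<open>variance_determines\<close> applies.\<close>

lemma implementing_isometry_signs:
  obtains U V :: "'a \<Rightarrow> 'a" and g s d where "g = (\<lambda>c. c) \<or> g = cnj"
    and "\<And>x y. U (x + y) = U x + U y" "\<And>c x. U (c *\<^sub>C x) = g c *\<^sub>C U x"
    and "\<And>x y. cinner (U x) (U y) = g (cinner x y)"
    and "\<And>x. V (U x) = x" "\<And>y. U (V y) = y"
    and "\<And>A. A \<in> self_adjoint_ops \<Longrightarrow> s A \<in> {1, -1 :: real}"
    and "\<And>A y. A \<in> self_adjoint_ops \<Longrightarrow> \<Phi> A y = s A *\<^sub>R U (A (V y)) + d A *\<^sub>R y"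
proof -
  obtain U g where g: "g = (\<lambda>c. c) \<or> g = cnj"
    and U_add: "\<And>x y. U (x + y) = U x + U y" and U_scaleC: "\<And>c x. U (c *\<^sub>C x) = g c *\<^sub>C U x"
    and U_cinner: "\<And>x y. cinner (U x) (U y) = g (cinner x y)" and "surj U"
    and var: "\<And>A x. A \<in> self_adjoint_ops \<Longrightarrow> norm x = 1 \<Longrightarrow> variance (\<Phi> A) (U x) = variance A x"
    by (rule implementing_isometry) (rule that; assumption)
  have gR: "g (complex_of_real r) = complex_of_real r" "Re (g c) = Re c" "g (g c) = c" for r c
    using g by auto
  have U_scaleR: "U (r *\<^sub>R x) = r *\<^sub>R U x" for r x by (simp add: scaleR_scaleC U_scaleC gR)
  have norm_U: "norm (U x) = norm x" for x
  proof -
    have "(norm (U x))\<^sup>2 = (norm x)\<^sup>2" by (simp only: norm_sq_cinner U_cinner gR)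
    then show ?thesis by (simp add: power2_eq_iff_nonneg)
  qed
  define V where "V = inv U"
  have UV: "U (V y) = y" for y unfolding V_def by (rule surj_f_inv_f[OF \<open>surj U\<close>])
  have "inj U"
  proof (rule injI)
    fix x y assume eq: "U x = U y"
    have "U (x - y) = U x + U ((-1) *\<^sub>R y)" using U_add[of x "(-1) *\<^sub>R y"] by simp
    also have "\<dots> = 0" unfolding U_scaleR eq by simp
    finally show "x = y" using norm_U[of "x - y"] by simp
  qed
  then have VU: "V (U x) = x" for x unfolding V_def by (rule inv_f_f)
  have V_add: "V (x + y) = V x + V y" for x y
    using VU[of "V x + V y"] by (simp add: U_add UV)
  have V_scaleR: "V (r *\<^sub>R x) = r *\<^sub>R V x" for r x
    using VU[of "r *\<^sub>R V x"] by (simp add: U_scaleR UV)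
  have norm_V: "norm (V x) = norm x" for x using norm_U[of "V x"] by (simp add: UV)
  have V_cinner: "g (cinner (V x) y) = cinner x (U y)" "g (cinner y (V x)) = cinner (U y) x" for x y
    using U_cinner[of "V x" y] U_cinner[of y "V x"] by (simp_all add: UV)
  have blU: "bounded_linear U"
    by (rule bounded_linear_intro[of _ 1]) (simp_all add: U_add U_scaleR norm_U)
  have blV: "bounded_linear V"
    by (rule bounded_linear_intro[of _ 1]) (simp_all add: V_add V_scaleR norm_V)
  have ex: "\<exists>s d. s \<in> {1, -1 :: real} \<and> (\<forall>y. \<Phi> A y = s *\<^sub>R U (A (V y)) + d *\<^sub>R y)"
    if A: "A \<in> self_adjoint_ops" for A
  proof -
    define B where "B = Blinfun V o\<^sub>L \<Phi> A o\<^sub>L Blinfun U"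
    have B: "B x = V (\<Phi> A (U x))" for x
      by (simp add: B_def bounded_linear_Blinfun_apply blU blV)
    have "cinner (B x) y = cinner x (B y)" for x y
    proof -
      have "g (cinner (B x) y) = cinner (\<Phi> A (U x)) (U y)" by (simp add: B V_cinner)
      also have "\<dots> = cinner (U x) (\<Phi> A (U y))" by (rule self_adjoint_cinner[OF image_self_adjoint[OF A]])
      also have "\<dots> = g (cinner x (B y))" by (simp add: B V_cinner)
      finally show ?thesis using gR(3) by metis
    qed
    then have Bsa: "B \<in> self_adjoint_ops" by (simp add: self_adjoint_iff)
    have "variance A x = variance B x" if x: "norm x = 1" for x
    proof -
      have "g (cinner (B x) x) = cinner (\<Phi> A (U x)) (U x)" by (simp add: B V_cinner)
      then have "Re (cinner (B x) x) = Re (cinner (\<Phi> A (U x)) (U x))" using gR(2) by metis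
      then have "variance B x = variance (\<Phi> A) (U x)"
        unfolding variance_def by (simp add: B norm_V)
      then show ?thesis using var[OF A x] by simp
    qed
    then obtain s d where sd: "s \<in> {1, -1}" "B = s *\<^sub>R A + d *\<^sub>R id_blinfun"
      using variance_determines[OF A Bsa] by blast
    have "\<Phi> A y = s *\<^sub>R U (A (V y)) + d *\<^sub>R y" for y
    proof -
      have "\<Phi> A y = U (B (V y))" by (simp add: B UV)
      also have "B (V y) = s *\<^sub>R A (V y) + d *\<^sub>R V y" by (simp add: sd(2) blinfun.bilinear_simps)
      also have "U (s *\<^sub>R A (V y) + d *\<^sub>R V y) = s *\<^sub>R U (A (V y)) + d *\<^sub>R y"
        by (simp add: U_add U_scaleR UV)
      finally show ?thesis .
    qed
    then show ?thesis using sd(1) by blast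
  qed
  obtain s where s: "\<And>A. A \<in> self_adjoint_ops \<Longrightarrow>
      \<exists>d. s A \<in> {1, -1 :: real} \<and> (\<forall>y. \<Phi> A y = s A *\<^sub>R U (A (V y)) + d *\<^sub>R y)"
    using ex by metis
  obtain d where d: "\<And>A. A \<in> self_adjoint_ops \<Longrightarrow>
      s A \<in> {1, -1 :: real} \<and> (\<forall>y. \<Phi> A y = s A *\<^sub>R U (A (V y)) + d A *\<^sub>R y)"
    using s by metis
  show thesis
    by (rule that[of g U V s d]) (use g U_add U_scaleC U_cinner VU UV d in blast)+
qed

text \<open>\<open>Im (g \<i>)\<close> is 1 for unitary and -1 for antiunitary \<open>U\<close>,
  since conjugating <B v, A v> reverses its imaginary part. The scalar shifts contribute only real
  terms.\<close>

lemma comm_range_signs: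
  assumes g: "g = (\<lambda>c. c) \<or> g = cnj"
    and U_cinner: "\<And>x y. cinner (U x) (U y) = g (cinner x y)"
    and VU: "\<And>x. V (U x) = x" and UV: "\<And>y. U (V y) = y"
    and sd: "\<And>A y. A \<in> self_adjoint_ops \<Longrightarrow> \<Phi> A y = s A *\<^sub>R U (A (V y)) + d A *\<^sub>R y"
    and A: "A \<in> self_adjoint_ops" and B: "B \<in> self_adjoint_ops"
  shows "comm_range A B = (*) (s A * s B * Im (g \<i>)) ` comm_range A B"
proof -
  have norm_U: "norm (U v) = 1 \<longleftrightarrow> norm v = 1" for v
    using g by (auto simp: norm_eq_1_cinner U_cinner)
  have Im: "Im (cinner (\<Phi> B (U v)) (\<Phi> A (U v))) = s A * s B * Im (g \<i>) * Im (cinner (B v) (A v))" for v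
  proof -
    have real: "Im (cinner (U x) (U v)) = 0" "Im (cinner (U v) (U x)) = 0" if "Im (cinner x v) = 0" for x
    proof -
      have "Im (cinner v x) = 0" using that by (subst cinner_commute) simp
      then show "Im (cinner (U x) (U v)) = 0" "Im (cinner (U v) (U x)) = 0"
        using that g by (auto simp: U_cinner)
    qed
    have "Im (cinner (\<Phi> B (U v)) (\<Phi> A (U v))) = s A * s B * Im (cinner (U (B v)) (U (A v)))"
      using self_adjoint_cinner_self(2)[OF A, of v] self_adjoint_cinner_self(2)[OF B, of v]
      by (simp add: sd[OF A] sd[OF B] VU cinner_simps real cinner_self)
    also have "Im (cinner (U (B v)) (U (A v))) = Im (g \<i>) * Im (cinner (B v) (A v))"
      using g by (auto simp: U_cinner)
    finally show ?thesis by simp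
  qed
  have sphere: "{w. norm w = 1} = U ` {v. norm v = 1}"
  proof (intro set_eqI iffI)
    show "w \<in> U ` {v. norm v = 1}" if "w \<in> {w. norm w = 1}" for w
      using that norm_U[of "V w"] by (intro image_eqI[of _ _ "V w"]) (simp_all add: UV)
  qed (use norm_U in auto)
  have "comm_range A B = (\<lambda>w. Im (cinner (\<Phi> B w) (\<Phi> A w))) ` {w. norm w = 1}"
    unfolding preserves[OF A B] unfolding comm_range_def setcompr_eq_image ..
  also have "\<dots> = (\<lambda>w. Im (cinner (\<Phi> B w) (\<Phi> A w))) ` U ` {v. norm v = 1}"
    by (rule arg_cong[OF sphere])
  also have "\<dots> = (\<lambda>v. Im (cinner (\<Phi> B (U v)) (\<Phi> A (U v)))) ` {v. norm v = 1}"
    unfolding image_image ..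
  also have "\<dots> = (*) (s A * s B * Im (g \<i>)) ` comm_range A B"
    unfolding Im comm_range_def setcompr_eq_image image_image ..
  finally show ?thesis .
qed

lemma implementing_unitary:
  obtains U :: "'a \<Rightarrow>\<^sub>L 'a" and \<eta> s d where "unitary U" "\<eta> \<in> {1, -1 :: real}"
    and "\<And>A. A \<in> self_adjoint_ops \<Longrightarrow> s A \<in> {1, -1 :: real}"
    and "\<And>A. A \<in> self_adjoint_ops \<Longrightarrow> A \<notin> \<D> \<Longrightarrow> s A = \<eta>"
    and "\<And>A. A \<in> self_adjoint_ops \<Longrightarrow> \<Phi> A = s A *\<^sub>R (U o\<^sub>L A o\<^sub>L adj U) + d A *\<^sub>R id_blinfun"
proof -
  obtain U V :: "'a \<Rightarrow> 'a" and g s d where g: "g = (\<lambda>c. c) \<or> g = cnj"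
    and U_add: "\<And>x y. U (x + y) = U x + U y" and U_scaleC: "\<And>c x. U (c *\<^sub>C x) = g c *\<^sub>C U x"
    and U_cinner: "\<And>x y. cinner (U x) (U y) = g (cinner x y)"
    and VU: "\<And>x. V (U x) = x" and UV: "\<And>y. U (V y) = y"
    and s: "\<And>A. A \<in> self_adjoint_ops \<Longrightarrow> s A \<in> {1, -1 :: real}"
    and sd: "\<And>A y. A \<in> self_adjoint_ops \<Longrightarrow> \<Phi> A y = s A *\<^sub>R U (A (V y)) + d A *\<^sub>R y"
    by (rule implementing_isometry_signs) (rule that; assumption)
  have link: "s A * s B = Im (g \<i>)"
    if A: "A \<in> self_adjoint_ops" and B: "B \<in> self_adjoint_ops" and ns: "\<not> sym_range A B" for A B
  proof -
    \<comment> \<open>A factor -1 would make the range equal to its own negative, against the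
      assumed asymmetry.\<close>
    have "s A * s B * Im (g \<i>) \<noteq> -1"
    proof
      assume "s A * s B * Im (g \<i>) = -1"
      then have "comm_range A B = (*) (-1) ` comm_range A B"
        using comm_range_signs[of g U V s d A B] g U_cinner VU UV sd A B by metis
      then show False using ns by (simp add: sym_range_iff)
    qed
    then show ?thesis using s[OF A] s[OF B] g by auto
  qed
  note coherent = sign_coherence[of s "Im (g \<i>)", OF s link]
  have gid: "g c = c" for c using g coherent(1) by auto
  obtain \<eta> where \<eta>: "\<eta> \<in> {1, -1}" "\<forall>A\<in>self_adjoint_ops - \<D>. s A = \<eta>" using coherent(2) by blast
  have U_scaleR: "U (r *\<^sub>R x) = r *\<^sub>R U x" for r x by (simp add: scaleR_scaleC U_scaleC gid)
  have norm_U: "norm (U x) = norm x" for x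
  proof -
    have "(norm (U x))\<^sup>2 = (norm x)\<^sup>2" by (simp only: norm_sq_cinner U_cinner gid)
    then show ?thesis by (simp add: power2_eq_iff_nonneg)
  qed
  have V_cinner: "cinner x (V y) = cinner (U x) y" for x y
    using U_cinner[of x "V y"] by (simp add: UV gid)
  have blU: "bounded_linear U"
    by (rule bounded_linear_intro[of _ 1]) (simp_all add: U_add U_scaleR norm_U)
  have V_add: "V (x + y) = V x + V y" for x y
    using VU[of "V x + V y"] by (simp add: U_add UV)
  have V_scaleR: "V (r *\<^sub>R x) = r *\<^sub>R V x" for r x
    using VU[of "r *\<^sub>R V x"] by (simp add: U_scaleR UV)
  have blV: "bounded_linear V"
    by (rule bounded_linear_intro[of _ 1]) (use norm_U[of "V _"] in \<open>simp_all add: V_add V_scaleR UV\<close>)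
  define W where "W = Blinfun U"
  have W: "W x = U x" for x by (simp add: W_def bounded_linear_Blinfun_apply blU)
  have adjW: "adj W = Blinfun V"
    by (rule adj_unique) (simp add: W bounded_linear_Blinfun_apply blV V_cinner)
  then have adjW': "adj W y = V y" for y by (simp add: bounded_linear_Blinfun_apply blV)
  have "unitary W"
    unfolding unitary_def complex_linear_op_def
    by (intro conjI allI blinfun_eqI) (simp_all add: W adjW' U_scaleC gid UV VU)
  moreover have "\<Phi> A = s A *\<^sub>R (W o\<^sub>L A o\<^sub>L adj W) + d A *\<^sub>R id_blinfun" if "A \<in> self_adjoint_ops" for A
    by (rule blinfun_eqI) (simp add: sd[OF that] blinfun.bilinear_simps W adjW')
  ultimately show thesis using that \<eta> s by blast
qed

end

lemma unitary_conjugate: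
  assumes U: "unitary U" and A: "A \<in> self_adjoint_ops" and B: "B \<in> self_adjoint_ops"
  shows "U o\<^sub>L A o\<^sub>L adj U \<in> self_adjoint_ops"
    and "comm_range (U o\<^sub>L A o\<^sub>L adj U) (U o\<^sub>L B o\<^sub>L adj U) = comm_range A B"
proof -
  have lin: "complex_linear_op U" and "adj U o\<^sub>L U = id_blinfun" "U o\<^sub>L adj U = id_blinfun"
    using U by (auto simp: unitary_def)
  then have inv: "adj U (U x) = x" "U (adj U x) = x" for x
    by (metis blinfun_apply_blinfun_compose blinfun_apply_id_blinfun id_apply)+
  have adj: "cinner (U x) y = cinner x (adj U y)" "cinner y (U x) = cinner (adj U y) x" for x y
    using cinner_adj[OF lin, of x y] cinner_adj[OF lin, of "adj U y" x]
    by (metis cinner_commute)+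
  show "U o\<^sub>L A o\<^sub>L adj U \<in> self_adjoint_ops"
    by (simp add: self_adjoint_iff adj self_adjoint_cinner[OF A] inv)
  have "norm (U v) = 1 \<longleftrightarrow> norm v = 1" for v by (simp add: norm_eq_1_cinner adj inv)
  then have *: "comm_range C D = {Im (cinner (D (U v)) (C (U v))) | v. norm v = 1}" for C D
    unfolding comm_range_def using inv by metis
  show "comm_range (U o\<^sub>L A o\<^sub>L adj U) (U o\<^sub>L B o\<^sub>L adj U) = comm_range A B"
    unfolding *[of "U o\<^sub>L A o\<^sub>L adj U"] by (simp add: adj inv comm_range_def)
qed

theorem theorem3p1:
  fixes \<Phi> :: "('a::complex_hilbert_space \<Rightarrow>\<^sub>L 'a) \<Rightarrow> ('a \<Rightarrow>\<^sub>L 'a)"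
  assumes separable: "separable_space (euclidean :: 'a topology)"
    and dim_ge_3: "\<exists>S :: 'a set. card S = 3 \<and> complex_vector.independent S"
    and surjective: "\<Phi> ` self_adjoint_ops = self_adjoint_ops"
  shows "(\<forall>A \<in> self_adjoint_ops. \<forall>B \<in> self_adjoint_ops.
            numerical_range (commutator A B) = numerical_range (commutator (\<Phi> A) (\<Phi> B)))
     \<longleftrightarrow> (\<exists>(U :: 'a \<Rightarrow>\<^sub>L 'a) (\<epsilon> :: real) (\<S> :: ('a \<Rightarrow>\<^sub>L 'a) set) (f :: ('a \<Rightarrow>\<^sub>L 'a) \<Rightarrow> real).
            unitary U \<and> \<epsilon> \<in> {1, -1} \<and> \<S> \<subseteq> projection_identity_combinations \<and>
            (\<forall>A \<in> self_adjoint_ops - \<S>. \<Phi> A = \<epsilon> *\<^sub>R (U o\<^sub>L A o\<^sub>L adj U) + f A *\<^sub>R id_blinfun) \<and>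
            (\<forall>A \<in> \<S>. \<Phi> A = - \<epsilon> *\<^sub>R (U o\<^sub>L A o\<^sub>L adj U) + f A *\<^sub>R id_blinfun))"
    (is "?preserving \<longleftrightarrow> ?form")
proof
  have image: "\<Phi> A \<in> self_adjoint_ops" if "A \<in> self_adjoint_ops" for A
    using surjective that by blast
  have pres: "?preserving \<longleftrightarrow> (\<forall>A\<in>self_adjoint_ops. \<forall>B\<in>self_adjoint_ops.
      comm_range A B = comm_range (\<Phi> A) (\<Phi> B))"
    using image by (simp add: numerical_range_commutator_eq_iff)
  {
    assume ?preserving
    then have cr: "comm_range A B = comm_range (\<Phi> A) (\<Phi> B)"
      if "A \<in> self_adjoint_ops" "B \<in> self_adjoint_ops" for A B
      using that unfolding pres by blast
    interpret commutator_range_preserver "TYPE('a)" \<Phi>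
    proof
      show "\<exists>S :: 'a set. card S = 3 \<and> complex_vector.independent S" by (rule dim_ge_3)
      show "\<Phi> ` self_adjoint_ops = self_adjoint_ops" by (rule surjective)
      show "comm_range A B = comm_range (\<Phi> A) (\<Phi> B)"
        if "A \<in> self_adjoint_ops" "B \<in> self_adjoint_ops" for A B using that by (rule cr)
    qed
    obtain U :: "'a \<Rightarrow>\<^sub>L 'a" and \<eta> s d where U: "unitary U" and \<eta>: "\<eta> \<in> {1, -1 :: real}"
      and s: "\<And>A. A \<in> self_adjoint_ops \<Longrightarrow> s A \<in> {1, -1 :: real}"
      and sD: "\<And>A. A \<in> self_adjoint_ops \<Longrightarrow> A \<notin> \<D> \<Longrightarrow> s A = \<eta>"
      and sd: "\<And>A. A \<in> self_adjoint_ops \<Longrightarrow> \<Phi> A = s A *\<^sub>R (U o\<^sub>L A o\<^sub>L adj U) + d A *\<^sub>R id_blinfun"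
      by (rule implementing_unitary) (rule that; assumption)
    \<comment> \<open>The exceptional set collects the operators of \<open>\<D>\<close> that
      received the opposite sign; outside \<open>\<D>\<close> the sign is constant.\<close>
    define \<S> where "\<S> = {A \<in> \<D>. s A \<noteq> \<eta>}"
    have sub: "\<S> \<subseteq> \<D>" by (auto simp: \<S>_def)
    have "s A = \<eta>" if "A \<in> self_adjoint_ops - \<S>" for A using that sD by (auto simp: \<S>_def)
    moreover have "A \<in> self_adjoint_ops" "s A = - \<eta>" if "A \<in> \<S>" for A
    proof -
      show A: "A \<in> self_adjoint_ops" using sub that by (auto intro: projection_identity_self_adjoint)
      show "s A = - \<eta>" using s[OF A] \<eta> that by (auto simp: \<S>_def)
    qed
    ultimately have "\<forall>A \<in> self_adjoint_ops - \<S>. \<Phi> A = \<eta> *\<^sub>R (U o\<^sub>L A o\<^sub>L adj U) + d A *\<^sub>R id_blinfun"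
      "\<forall>A \<in> \<S>. \<Phi> A = - \<eta> *\<^sub>R (U o\<^sub>L A o\<^sub>L adj U) + d A *\<^sub>R id_blinfun"
      using sd by (metis DiffD1)+
    then show ?form using U \<eta> sub by blast
  }
  assume ?form
  then obtain U :: "'a \<Rightarrow>\<^sub>L 'a" and \<epsilon> :: real and \<S> f where U: "unitary U" and \<epsilon>: "\<epsilon> \<in> {1, -1}"
    and sub: "\<S> \<subseteq> \<D>"
    and out: "\<forall>A \<in> self_adjoint_ops - \<S>. \<Phi> A = \<epsilon> *\<^sub>R (U o\<^sub>L A o\<^sub>L adj U) + f A *\<^sub>R id_blinfun"
    and ins: "\<forall>A \<in> \<S>. \<Phi> A = - \<epsilon> *\<^sub>R (U o\<^sub>L A o\<^sub>L adj U) + f A *\<^sub>R id_blinfun"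
    by blast
  define c where "c A = (if A \<in> \<S> then - \<epsilon> else \<epsilon>)" for A
  have \<Phi>: "\<Phi> A = c A *\<^sub>R (U o\<^sub>L A o\<^sub>L adj U) + f A *\<^sub>R id_blinfun" if "A \<in> self_adjoint_ops" for A
    using out ins that by (auto simp: c_def)
  have "comm_range A B = comm_range (\<Phi> A) (\<Phi> B)"
    if A: "A \<in> self_adjoint_ops" and B: "B \<in> self_adjoint_ops" for A B
  proof -
    have "comm_range (\<Phi> A) (\<Phi> B) = (*) (c A * c B) ` comm_range A B"
      unfolding \<Phi>[OF A] comm_range_affine_left[OF image[OF B]]
      unfolding \<Phi>[OF B] comm_range_affine_right[OF unitary_conjugate(1)[OF U A A]]
        unitary_conjugate(2)[OF U A B]
      by (simp add: image_image mult.assoc)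
    also have "\<dots> = comm_range A B"
    proof (cases "A \<in> \<S> \<longleftrightarrow> B \<in> \<S>")
      case True
      then have "c A * c B = 1" using \<epsilon> by (auto simp: c_def)
      then show ?thesis by simp
    next
      \<comment> \<open>Exactly one of the two operators lies in \<open>\<S>\<close>, hence in
        \<open>\<D>\<close>, and the symmetry of the range absorbs the factor -1.\<close>
      case False
      then have "sym_range A B"
        using sub A B projection_identity_sym_range sym_range_commute by (metis subsetD)
      moreover have "c A * c B = -1" using \<epsilon> False by (auto simp: c_def)
      ultimately show ?thesis by (simp add: sym_range_iff)
    qed
    finally show ?thesis by simp
  qed
  then show ?preserving unfolding pres by blast
qed

end
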